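(* For all integers $n\ge1$ and $g\ge0$, $$W_n^{(g)}(x,\dots,x)=O\!\left(\frac{1}{x^{3n+2g-2}}\right)\qquad\text{as }x\to\infty,$$ where all $n$ arguments are equal to $x$.
   Context: Fix $T>0$. Let $y(x)=\sqrt{x^2-4T}$ denote the branch analytic on $\mathbb{C}\setminus[-2\sqrt T,2\sqrt T]$ with $y(x)\sim x$ as $x\to\infty$; write $y_i=y(x_i)$. Let $\hbar$ be a parameter (in the application $\hbar=\sqrt{\kappa}-1/\sqrt{\kappa}$, where $\beta=2\kappa$ is the Dyson index of the Gaussian $\beta$-ensemble $\prod_{i<j}|\lambda_i-\lambda_j|^{2\kappa}e^{-\frac{N\kappa}{T}\sum_i\lambda_i^2/2}$). The functions $W_n^{(g)}(x_1,\dots,x_n)$, $n\ge1$, $g\ge0$ (the coefficients of the large-$N$ expansion of the connected correlators of that ensemble), are the symmetric functions determined recursively as follows: $W_1^{(0)}(x)=\tfrac12(x-y(x))$; by convention $W_n^{(-1)}=W_n^{(-2)}=0$; and for every $(n,g)$ with $n\ge1$, $g\ge0$, $(n,g)\neq(1,0)$, writing $I=(x_1,\dots,x_{n-1})$, $$y(x)W_n^{(g)}(x,I)=\hbar\,\partial_xW_n^{(g-1)}(x,I)+W_{n+1}^{(g-2)}(x,x,I)+{\sum_{J\subseteq I}}'\sum_{p=0}^{g}W_{|J|+1}^{(p)}(x,J)\,W_{n-|J|}^{(g-p)}(x,I\setminus J)+\sum_{i=1}^{n-1}\frac{\partial}{\partial x_i}\frac{W_{n-1}^{(g)}(x,I\setminus\{x_i\})-W_{n-1}^{(g)}(I)}{x-x_i},$$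 where the primed double sum omits the two terms $(J=\emptyset,p=0)$ and $(J=I,p=g)$, and for $n=1$ the last sum is empty. These functions are rational in the $x_i$ and $y_i$ and regular on the diagonals, so that $W_n^{(g)}(x,\dots,x)$ is well defined. *)

theory Defs
  imports "HOL-Analysis.Analysis" "HOL-Library.Landau_Symbols"
begin

text \<open>The branch y(x) = sqrt(x^2 - 4T), analytic off the cut [-2 sqrt T, 2 sqrt T], y(x) ~ x.\<close>
definition ybr :: "real \<Rightarrow> complex \<Rightarrow> complex" where
  "ybr T x = x * csqrt (1 - complex_of_real (4 * T) / x ^ 2)"

definition cut_dom :: "real \<Rightarrow> complex set" where
  "cut_dom T = - {complex_of_real t | t. \<bar>t\<bar> \<le> 2 * sqrt T}"

definition generic_pts :: "real \<Rightarrow> nat \<Rightarrow> complex list set" where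
  "generic_pts T n = {q. length q = n \<and> distinct q \<and> set q \<subseteq> cut_dom T}"

text \<open>Approach p (coordinatewise) through generic points; used to take the
  regular (continuous) extension of the rational functions to the diagonals.\<close>
definition near_filter :: "real \<Rightarrow> nat \<Rightarrow> complex list \<Rightarrow> complex list filter" where
  "near_filter T n p =
     (INF e\<in>{0::real<..}. principal {q \<in> generic_pts T n. \<forall>i<n. dist (q ! i) (p ! i) < e})"

text \<open>Right-hand side of the loop equation for W_n^(g)(x, I), where q = x # I, given the
  lower-order functions W (W k h is the function of k arguments W_k^(h)).
  Subsets J of I are encoded by index sets S of positions in I.\<close>
definition loop_rhs ::
  "real \<Rightarrow> complex \<Rightarrow> (nat \<Rightarrow> nat \<Rightarrow> complex list \<Rightarrow> complex) \<Rightarrow> nat \<Rightarrow> nat \<Rightarrow> complex list \<Rightarrow> complex" where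
  "loop_rhs T hbar W n g q =
    (let x = hd q; I = tl q; m = n - 1 in
       (if 1 \<le> g then hbar * deriv (\<lambda>t. W n (g - 1) (t # I)) x else 0)
     + (if 2 \<le> g then W (n + 1) (g - 2) (x # x # I) else 0)
     + (\<Sum>S\<in>Pow {..<m}. \<Sum>p\<in>{0..g}.
          if (S = {} \<and> p = 0) \<or> (S = {..<m} \<and> p = g) then 0
          else W (card S + 1) p (x # nths I S) * W (n - card S) (g - p) (x # nths I (- S)))
     + (\<Sum>i<m. deriv (\<lambda>s. (W m g (x # (take i I @ drop (Suc i) I)) - W m g (I[i := s])) / (x - s))
                    (I ! i)))"

definition W_step ::
  "real \<Rightarrow> complex \<Rightarrow> (nat \<Rightarrow> nat \<Rightarrow> complex list \<Rightarrow> complex) \<Rightarrow> nat \<Rightarrow> nat \<Rightarrow> complex list \<Rightarrow> complex" where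
  "W_step T hbar W n g p =
    (if n = 1 \<and> g = 0 then (hd p - ybr T (hd p)) / 2
     else Lim (near_filter T n p) (\<lambda>q. loop_rhs T hbar W n g q / ybr T (hd q)))"

text \<open>W_n^(g): each step only uses values of strictly smaller 2g+n, so 2g+n iterations suffice.\<close>
definition Wcorr :: "real \<Rightarrow> complex \<Rightarrow> nat \<Rightarrow> nat \<Rightarrow> complex list \<Rightarrow> complex" where
  "Wcorr T hbar n g = ((W_step T hbar) ^^ (2 * g + n)) (\<lambda>_ _ _. 0) n g"

end

theory Submission
  imports Defs "HOL-Computational_Algebra.Formal_Power_Series"
begin

text \<open>
  Expanding at infinity, write the correlator of order g as the sum over multi-indices K of
  coefficients c(K; g) times the product of the x_i^-(K_i
      + 1). The loop equation becomes a recursion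
  for these coefficients which lowers the weight |K| = K_1 + ... + K_n
      by two. The recursion singles out the
  first index; its independence of this choice is the Virasoro commutation relation, and without it
  the divided differences in the loop equation would not be regular on the diagonals.

  Along the recursion c(K; g) = 0 unless |K| \<ge> 2n + 2g - 2, so every monomial that occurs has total
  degree at least 3n + 2g - 2 in the 1/x_i, which is the claimed decay once convergence is known.

  Convergence for |x_i| > 2 sqrt T goes by induction on 2g
      + n. The only term of the recursion that is not of
  lower order is a convolution with twice the expansion of the first correlator, whose norm is at
  most 4T/|x|^2 < 1 by the Catalan recursion, so it can be absorbed. The sum of the series
  then solves the loop equation at points with distinct coordinates, is continuous, and hence
  equals the iterated limit that defines the correlators.
\<close>

section \<open>Sums over splittings of a list\<close>

text \<open>A multi-index is a list in the order of the arguments, so a subset J of I becomes an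
  ordered splitting of a list and the choice of one x_i becomes the removal of an entry. The same
  two sums then act on lists of exponents and on lists of points, and this carries the recursion
  from coefficients to functions. The obstacle is the symmetry. The iteration that defines the
  correlators singles out x, and the divided difference compares two values in which x and x_i stand
  at different places; symmetry must therefore be proved before the series can be shown to satisfy
  the loop equation. Letting powers of a variable mark g absorbs the sum over p into a product, and
  the proof becomes an induction on the weight over one commutative ring. The radius 2 sqrt T has
  two origins that agree: it is where the branch cut ends, and it is where the bound 4T/|x|^2
  reaches 1. Since y = x - 2 W_1^(0), dividing by y is inverting 1 - 2 W_1^(0)/x, and the norm
  estimate says that the corresponding Neumann series converges.\<close>

fun split_sum :: "('a list \<Rightarrow> 'a list \<Rightarrow> 'b::comm_monoid_add) \<Rightarrow> 'a list \<Rightarrow> 'b" where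
  "split_sum f [] = f [] []"
| "split_sum f (x # xs) = split_sum (\<lambda>A B. f (x # A) B) xs + split_sum (\<lambda>A B. f A (x # B)) xs"

fun pick_sum :: "('a \<Rightarrow> 'a list \<Rightarrow> 'b::comm_monoid_add) \<Rightarrow> 'a list \<Rightarrow> 'b" where
  "pick_sum f [] = 0"
| "pick_sum f (x # xs) = f x xs + pick_sum (\<lambda>y ys. f y (x # ys)) xs"

text \<open>Each summand may assume that \<open>A\<close> and \<open>B\<close> together have the
  entries of \<open>ys\<close>. Declared as a function congruence, this reaches the termination
  proof of a recursion that calls itself under \<open>split_sum\<close>, where it bounds the weights
  of \<open>A\<close> and \<open>B\<close>.\<close>

lemma split_sum_cong [fundef_cong]:
  assumes "xs = ys" and "\<And>A B. mset A + mset B = mset ys \<Longrightarrow> f A B = f' A B"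
  shows "split_sum f xs = split_sum f' ys"
  unfolding assms(1) using assms(2)
proof (induction ys arbitrary: f f')
  case (Cons y ys)
  have "split_sum (\<lambda>A B. f (y # A) B) ys = split_sum (\<lambda>A B. f' (y # A) B) ys"
    by (rule Cons.IH) (simp add: Cons.prems)
  moreover have "split_sum (\<lambda>A B. f A (y # B)) ys = split_sum (\<lambda>A B. f' A (y # B)) ys"
    by (rule Cons.IH) (simp add: Cons.prems)
  ultimately show ?case by simp
qed simp

lemma pick_sum_cong [fundef_cong]:
  assumes "xs = ys" and "\<And>y Y. add_mset y (mset Y) = mset ys \<Longrightarrow> f y Y = f' y Y"
  shows "pick_sum f xs = pick_sum f' ys"
  unfolding assms(1) using assms(2)
proof (induction ys arbitrary: f f')
  case (Cons y ys)
  have "pick_sum (\<lambda>z zs. f z (y # zs)) ys = pick_sum (\<lambda>z zs. f' z (y # zs)) ys"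
    by (rule Cons.IH) (simp add: Cons.prems add_mset_commute)
  then show ?case by (simp add: Cons.prems)
qed simp

lemma split_sum_add: "split_sum (\<lambda>A B. f A B + f' A B) xs = split_sum f xs + split_sum f' xs"
  by (induction xs arbitrary: f f') (simp_all add: ac_simps)

lemma split_sum_cmult: "split_sum (\<lambda>A B. c * f A B) xs = (c::'b::comm_semiring_0) * split_sum f xs"
  by (induction xs arbitrary: f) (simp_all add: distrib_left)

lemma split_sum_zero [simp]: "split_sum (\<lambda>A B. 0) xs = 0"
  by (induction xs) simp_all

lemma split_sum_sum: "split_sum (\<lambda>A B. \<Sum>i\<in>I. f i A B) xs = (\<Sum>i\<in>I. split_sum (f i) xs)"
  by (induction xs arbitrary: f) (simp_all add: sum.distrib)

lemma split_sum_commute: "split_sum (\<lambda>A B. f B A) xs = split_sum f xs"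
proof (induction xs arbitrary: f)
  case (Cons x xs)
  show ?case
    using Cons.IH[of "\<lambda>A B. f (x # A) B"] Cons.IH[of "\<lambda>A B. f A (x # B)"] by (simp add: add.commute)
qed simp

text \<open>Both sides distribute the entries over three lists. This is what makes the convolution
  below associative.\<close>

lemma split_sum_assoc:
  "split_sum (\<lambda>A B. split_sum (\<lambda>C D. f C D B) A) xs =
   split_sum (\<lambda>C A. split_sum (\<lambda>D B. f C D B) A) xs"
  by (induction xs arbitrary: f) (simp_all add: split_sum_add add.assoc)

lemma pick_sum_add: "pick_sum (\<lambda>y ys. f y ys + f' y ys) xs = pick_sum f xs + pick_sum f' xs"
  by (induction xs arbitrary: f f') (simp_all add: ac_simps)

lemma pick_sum_zero [simp]: "pick_sum (\<lambda>y ys. 0) xs = 0"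
  by (induction xs) simp_all

lemma pick_sum_cmult: "pick_sum (\<lambda>y ys. c * f y ys) xs = (c::'b::comm_semiring_0) * pick_sum f xs"
  by (induction xs arbitrary: f) (simp_all add: distrib_left)

lemma pick_sum_sum: "pick_sum (\<lambda>y ys. \<Sum>i\<in>I. f i y ys) xs = (\<Sum>i\<in>I. pick_sum (f i) xs)"
  by (induction xs arbitrary: f) (simp_all add: sum.distrib)

lemma pick_sum_commute:
  "pick_sum (\<lambda>y ys. pick_sum (\<lambda>z zs. f y z zs) ys) xs
      = pick_sum (\<lambda>y ys. pick_sum (\<lambda>z zs. f z y zs) ys) xs"
proof (induction xs arbitrary: f)
  case (Cons x xs)
  show ?case
    using Cons.IH[of "\<lambda>y z zs. f y z (x # zs)"] by (simp add: pick_sum_add ac_simps)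
qed simp

text \<open>Removing an entry from one part of a splitting amounts to removing it first and
  splitting the rest; thus a contraction can act inside one factor of a convolution.\<close>

lemma split_sum_pick_sum:
  "split_sum (\<lambda>A B. pick_sum (\<lambda>y ys. f y ys B) A) xs =
   pick_sum (\<lambda>y ys. split_sum (\<lambda>A B. f y A B) ys) xs"
  by (induction xs arbitrary: f) (simp_all add: split_sum_add pick_sum_add ac_simps)

lemma split_sum_move:
  assumes "\<And>A A' B B'. mset A = mset A' \<Longrightarrow> mset B = mset B' \<Longrightarrow> mset A + mset B = mset (x # xs @ ys)
      \<Longrightarrow> f A B = f A' B'"
  shows "split_sum f (xs @ x # ys) = split_sum f (x # xs @ ys)"
  using assms
proof (induction xs arbitrary: f)
  case (Cons z xs)
  have "split_sum (\<lambda>A B. f (z # A) B) (xs @ x # ys) = split_sum (\<lambda>A B. f (z # A) B) (x # xs @ ys)"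
    by (rule Cons.IH) (rule Cons.prems, auto)
  moreover have "split_sum (\<lambda>A B. f A (z # B)) (xs @ x # ys)
      = split_sum (\<lambda>A B. f A (z # B)) (x # xs @ ys)"
    by (rule Cons.IH) (rule Cons.prems, auto)
  moreover have "split_sum (\<lambda>A B. f (z # x # A) B) (xs @ ys)
      = split_sum (\<lambda>A B. f (x # z # A) B) (xs @ ys)"
    by (rule split_sum_cong[OF refl], rule Cons.prems) auto
  moreover have "split_sum (\<lambda>A B. f A (z # x # B)) (xs @ ys)
      = split_sum (\<lambda>A B. f A (x # z # B)) (xs @ ys)"
    by (rule split_sum_cong[OF refl], rule Cons.prems) auto
  ultimately show ?case by (simp add: ac_simps)
next
  case Nil
  show ?case by simp
qed

text \<open>Invariance of \<open>f\<close> is demanded only for pairs that make up the whole list: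
  while the symmetry of the coefficients is being proved, it is available only below a given
  weight.\<close>

lemma split_sum_perm:
  assumes "mset xs = mset ys"
    and "\<And>A A' B B'. mset A = mset A' \<Longrightarrow> mset B = mset B' \<Longrightarrow> mset A + mset B = mset ys \<Longrightarrow> f A B
        = f A' B'"
  shows "split_sum f xs = split_sum f ys"
  using assms
proof (induction xs arbitrary: ys f)
  case (Cons x xs)
  then have "x \<in> set ys" by (metis list.set_intros(1) set_mset_mset)
  then obtain us vs where ys: "ys = us @ x # vs" by (meson split_list)
  have m: "mset xs = mset (us @ vs)" using Cons.prems(1) ys by simp
  have "split_sum (\<lambda>A B. f (x # A) B) xs = split_sum (\<lambda>A B. f (x # A) B) (us @ vs)"
    by (rule Cons.IH[OF m]) (rule Cons.prems(2), auto simp: ys)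
  moreover have "split_sum (\<lambda>A B. f A (x # B)) xs = split_sum (\<lambda>A B. f A (x # B)) (us @ vs)"
    by (rule Cons.IH[OF m]) (rule Cons.prems(2), auto simp: ys)
  moreover have "split_sum f ys = split_sum f (x # us @ vs)"
    unfolding ys by (rule split_sum_move) (rule Cons.prems(2), auto simp: ys)
  ultimately show ?case by simp
next
  case Nil
  show ?case using Nil(1) by simp
qed

lemma pick_sum_move:
  assumes "\<And>y A A'. mset A = mset A' \<Longrightarrow> add_mset y (mset A) = mset (x # xs @ ys) \<Longrightarrow> f y A = f y A'"
  shows "pick_sum f (xs @ x # ys) = pick_sum f (x # xs @ ys)"
  using assms
proof (induction xs arbitrary: f)
  case (Cons z xs)
  have "pick_sum (\<lambda>y A. f y (z # A)) (xs @ x # ys) = pick_sum (\<lambda>y A. f y (z # A)) (x # xs @ ys)"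
    by (rule Cons.IH) (rule Cons.prems, auto)
  moreover have "f z (xs @ x # ys) = f z (x # xs @ ys)"
    by (rule Cons.prems) auto
  moreover have "pick_sum (\<lambda>y A. f y (z # x # A)) (xs @ ys)
      = pick_sum (\<lambda>y A. f y (x # z # A)) (xs @ ys)"
    by (rule pick_sum_cong[OF refl], rule Cons.prems) auto
  ultimately show ?case by (simp add: ac_simps)
next
  case Nil
  show ?case by simp
qed

lemma pick_sum_perm:
  assumes "mset xs = mset ys"
    and "\<And>y A A'. mset A = mset A' \<Longrightarrow> add_mset y (mset A) = mset ys \<Longrightarrow> f y A = f y A'"
  shows "pick_sum f xs = pick_sum f ys"
  using assms
proof (induction xs arbitrary: ys f)
  case (Cons x xs)
  then have "x \<in> set ys" by (metis list.set_intros(1) set_mset_mset)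
  then obtain us vs where ys: "ys = us @ x # vs" by (meson split_list)
  have m: "mset xs = mset (us @ vs)" using Cons.prems(1) ys by simp
  have "pick_sum (\<lambda>y A. f y (x # A)) xs = pick_sum (\<lambda>y A. f y (x # A)) (us @ vs)"
    by (rule Cons.IH[OF m]) (rule Cons.prems(2), auto simp: ys)
  moreover have "f x xs = f x (us @ vs)" by (rule Cons.prems(2)) (auto simp: ys m)
  moreover have "pick_sum f ys = pick_sum f (x # us @ vs)"
    unfolding ys by (rule pick_sum_move) (rule Cons.prems(2), auto simp: ys)
  ultimately show ?case by simp
next
  case Nil
  show ?case using Nil(1) by simp
qed

lemma sum_list_mset_add:
  assumes "mset A + mset B = mset C"
  shows "sum_list A + sum_list B = (sum_list C :: nat)"
proof -
  have "sum_mset (mset A + mset B) = sum_mset (mset C)" using assms by (rule arg_cong)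
  then show ?thesis by (simp add: sum_mset_sum_list)
qed

lemma sum_list_add_mset:
  assumes "add_mset y (mset B) = mset C"
  shows "y + sum_list B = (sum_list C :: nat)"
  using sum_list_mset_add[of "[y]" B C] assms by simp

section \<open>The coefficient recursion and its symmetry\<close>

text \<open>The coefficients over an arbitrary ring: for complex power series in a variable that counts g
  one takes t = T, h = - hbar X and e = X^2, the sign coming from the derivative of x^-k.\<close>
function (sequential) cum :: "'r::comm_ring_1 \<Rightarrow> 'r \<Rightarrow> 'r \<Rightarrow> nat list \<Rightarrow> 'r" where
  "cum t h e [] = 0"
| "cum t h e (0 # K) = (if K = [] then t else 0)"
| "cum t h e (Suc k # K) =
     of_nat k * h * cum t h e ((k - 1) # K)
   + (\<Sum>a<k. e * cum t h e (a # (k - 1 - a) # K)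
        + split_sum (\<lambda>A B. cum t h e (a # A) * cum t h e ((k - 1 - a) # B)) K)
   + pick_sum (\<lambda>j J. of_nat j * cum t h e ((k + j - 1) # J)) K"
  by pat_completeness auto
termination
proof (relation "Wellfounded.measure (\<lambda>(t, h, e, K). sum_list K)", goal_cases)
  case (4 t h e k K a A B)
  then show ?case using sum_list_mset_add[of A B K] by simp
next
  case (5 t h e k K a A B)
  then show ?case using sum_list_mset_add[of A B K] by simp
next
  case (6 t h e k K j J)
  then show ?case using sum_list_add_mset[of j J K] by simp
qed auto

section \<open>Convolution over splittings, a commutative and associative product\<close>

definition conv :: "('a list \<Rightarrow> 'b::comm_ring_1) \<Rightarrow> ('a list \<Rightarrow> 'b) \<Rightarrow> 'a list \<Rightarrow> 'b" where
  "conv f f' K = split_sum (\<lambda>A B. f A * f' B) K"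

lemma conv_commute: "conv f f' = conv f' f"
  unfolding conv_def fun_eq_iff by (subst split_sum_commute[symmetric]) (simp add: mult.commute)

lemma conv_assoc: "conv (conv f f') f'' = conv f (conv f' f'')"
proof
  fix K
  have "conv (conv f f') f'' K = split_sum (\<lambda>A B. split_sum (\<lambda>C D. f C * f' D * f'' B) A) K"
    unfolding conv_def by (simp add: split_sum_cmult[symmetric] mult.commute)
  also have "\<dots> = conv f (conv f' f'') K"
    unfolding split_sum_assoc conv_def by (simp add: split_sum_cmult[symmetric] mult.assoc)
  finally show "conv (conv f f') f'' K = conv f (conv f' f'') K" .
qed

lemma conv_left_commute: "conv f (conv f' f'') = conv f' (conv f f'')"
  by (metis conv_assoc conv_commute)

lemma conv_add_left: "conv (\<lambda>A. f A + f' A) f'' K = conv f f'' K + conv f' f'' K"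
  by (simp add: conv_def distrib_right split_sum_add)

lemma conv_cmult_left: "conv (\<lambda>A. x * f A) f' K = x * conv f f' K"
  by (simp add: conv_def mult.assoc split_sum_cmult)

lemma conv_sum_left: "conv (\<lambda>A. \<Sum>i\<in>I. f i A) f' K = (\<Sum>i\<in>I. conv (f i) f' K)"
  by (simp add: conv_def sum_distrib_right split_sum_sum)

lemma conv_pick_left:
  "conv (\<lambda>A. pick_sum f A) f' K = pick_sum (\<lambda>j J. conv (f j) f' J) K"
  unfolding conv_def split_sum_pick_sum[symmetric]
  by (simp add: pick_sum_cmult[symmetric] mult.commute)

lemma conv_add_right: "conv f'' (\<lambda>A. f A + f' A) K = conv f'' f K + conv f'' f' K"
  by (simp add: conv_commute[of f''] conv_add_left)

lemma conv_cmult_right: "conv f' (\<lambda>A. x * f A) K = x * conv f' f K"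
  by (simp add: conv_commute[of f'] conv_cmult_left)

lemma conv_sum_right: "conv f' (\<lambda>A. \<Sum>i\<in>I. f i A) K = (\<Sum>i\<in>I. conv f' (f i) K)"
  by (simp add: conv_commute[of f'] conv_sum_left)

lemma conv_pick_right:
  "conv f' (\<lambda>A. pick_sum f A) K = pick_sum (\<lambda>j J. conv f' (f j) J) K"
  by (simp add: conv_commute[of f'] conv_pick_left)

lemma conv_Cons: "conv f f' (x # K) = conv (\<lambda>A. f (x # A)) f' K + conv f (\<lambda>A. f' (x # A)) K"
  by (simp add: conv_def)

lemma conv_cong:
  assumes "\<And>A. sum_list A \<le> sum_list K \<Longrightarrow> f A = F A" "\<And>A. sum_list A \<le> sum_list K \<Longrightarrow> f' A = F' A"
  shows "conv f f' K = conv F F' (K::nat list)"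
  unfolding conv_def
proof (rule split_sum_cong[OF refl])
  fix A B assume "mset A + mset B = mset K"
  from sum_list_mset_add[OF this] show "f A * f' B = F A * F' B" using assms[of A] assms[of B]
      by simp
qed

lemma conv_perm:
  assumes "mset K = mset K'"
    and "\<And>A A'. mset A = mset A' \<Longrightarrow> sum_list A \<le> sum_list K' \<Longrightarrow> f A = f A'"
    and "\<And>A A'. mset A = mset A' \<Longrightarrow> sum_list A \<le> sum_list K' \<Longrightarrow> f' A = f' A'"
  shows "conv f f' K = conv f f' (K'::nat list)"
  unfolding conv_def
proof (rule split_sum_perm[OF assms(1)])
  fix A A' B B' assume a: "mset A = mset A'" "mset B = mset B'" "mset A + mset B = mset K'"
  from sum_list_mset_add[OF a(3)] show "f A * f' B = f A' * f' B'"
    using assms(2)[of A A'] assms(3)[of B B'] a(1,2) by simp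
qed

text \<open>The quadratic part of the Virasoro relation: reflect the summation index in half of the
    terms.\<close>
lemma sum_virasoro:
  fixes f :: "nat \<Rightarrow> nat \<Rightarrow> 'r::comm_ring_1"
  assumes sym: "\<And>a b. a + b = k + l - 2 \<Longrightarrow> f a b = f b a" and kl: "k + l \<ge> 1"
  shows "(\<Sum>a<k. of_nat a * f (l + a - 1) (k - 1 - a) + of_nat (k - 1 - a) * f a (l
      + (k - 1 - a) - 1))
       - (\<Sum>a<l. of_nat a * f (k + a - 1) (l - 1 - a) + of_nat (l - 1 - a) * f a (k
           + (l - 1 - a) - 1))
       = (of_nat k - of_nat l) * (\<Sum>a<k + l - 1. f a (k + l - 2 - a))"
proof -
  define F where "F i = f i (k + l - 2 - i)" for i
  \<comment> \<open>Both halves are collected by the first argument \<open>i\<close> of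
    \<open>f\<close>: \<open>i = l + a - 1\<close> in one and \<open>i = a\<close> in the other, the
    second argument being \<open>k + l - 2 - i\<close> throughout. The general form serves again
    with \<open>k\<close> and \<open>l\<close> exchanged.\<close>
  have S: "(\<Sum>a<k. of_nat a * f (l + a - 1) (k - 1 - a) + of_nat (k - 1 - a) * f a (l
      + (k - 1 - a) - 1))
     = (\<Sum>i<k+l-1. (if i \<ge> l then of_nat (i + 1 - l) else 0) * F i)
       + (\<Sum>i<k+l-1. (if i < k then of_nat (k - 1 - i) else 0) * F i)"
    if "k + l \<ge> 1" "\<And>i. F i = f i (k + l - 2 - i)" for k l F
  proof -
    have "(\<Sum>i<k+l-1. (if i \<ge> l then of_nat (i + 1 - l) else 0) * F i)
        = (\<Sum>i\<in>{l..<k+l-1}. of_nat (i + 1 - l) * F i)"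
      by (rule sum.mono_neutral_cong_right) auto
    also have "\<dots> = (\<Sum>a\<in>{1..<k}. of_nat a * f (l + a - 1) (k - 1 - a))"
      by (rule sum.reindex_bij_witness[of _ "\<lambda>a. a + l - 1" "\<lambda>i. i + 1 - l"])
         (auto simp: that(2) intro!: arg_cong2[of _ _ _ _ f])
    also have "\<dots> = (\<Sum>a<k. of_nat a * f (l + a - 1) (k - 1 - a))"
      by (rule sum.mono_neutral_cong_left) (auto simp: not_le)
    finally have 1: "(\<Sum>i<k+l-1. (if i \<ge> l then of_nat (i + 1 - l) else 0) * F i)
        = (\<Sum>a<k. of_nat a * f (l + a - 1) (k - 1 - a))" .
    have "(\<Sum>i<k+l-1. (if i < k then of_nat (k - 1 - i) else 0) * F i)
        = (\<Sum>i<k-1. of_nat (k - 1 - i) * F i)"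
      by (rule sum.mono_neutral_cong_right) (auto simp del: of_nat_diff)
    also have "\<dots> = (\<Sum>a<k. of_nat (k - 1 - a) * f a (l + (k - 1 - a) - 1))"
      by (rule sum.mono_neutral_cong_left) (auto simp: that(2) add.commute simp del: of_nat_diff)
    finally show ?thesis using 1 by (simp add: sum.distrib)
  qed
  have Fsym: "F i = F (k + l - 2 - i)" if "i < k + l - 1" for i
  proof -
    have "k + l - 2 - (k + l - 2 - i) = i" using that by simp
    then show ?thesis using that sym[of i "k+l-2-i"] by (simp only: F_def)
  qed
  have R: "(\<Sum>i<k+l-1. x i * F i) = (\<Sum>i<k+l-1. x (k+l-2-i) * F i)" for x :: "nat \<Rightarrow> 'r"
  proof (rule sum.reindex_bij_witness[of _ "\<lambda>i. k+l-2-i" "\<lambda>i. k+l-2-i"])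
    fix i assume i: "i \<in> {..<k+l-1}"
    then have "k + l - 2 - (k + l - 2 - i) = i" by auto
    then show "x (k + l - 2 - (k + l - 2 - i)) * F (k + l - 2 - i) = x i * F i"
      using Fsym[of i] i by simp
  qed auto
  have S1: "(\<Sum>a<k. of_nat a * f (l + a - 1) (k - 1 - a) + of_nat (k - 1 - a) * f a (l
      + (k - 1 - a) - 1))
     = (\<Sum>i<k+l-1. (if i \<ge> l then of_nat (i + 1 - l) else 0) * F i)
       + (\<Sum>i<k+l-1. (if i < k then of_nat (k - 1 - i) else 0) * F i)"
    by (rule S) (use kl in \<open>simp_all add: F_def\<close>)
  have S2: "(\<Sum>a<l. of_nat a * f (k + a - 1) (l - 1 - a) + of_nat (l - 1 - a) * f a (k
      + (l - 1 - a) - 1))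
     = (\<Sum>i<k+l-1. (if i \<ge> k then of_nat (i + 1 - k) else 0) * F i)
       + (\<Sum>i<k+l-1. (if i < l then of_nat (l - 1 - i) else 0) * F i)"
    using S[of l k F] kl by (simp add: F_def add.commute)
  \<comment> \<open>The two truncated weights are the positive and the negative part of
    \<open>i + 1 - l\<close>, so their difference is linear in \<open>i\<close>. Together with its
    counterpart \<open>k - 1 - i\<close> it adds up to the constant \<open>k - l\<close>.\<close>
  have "(\<Sum>i<k+l-1. (if i \<ge> l then of_nat (i + 1 - l) else 0) * F i)
      - (\<Sum>i<k+l-1. (if i < l then of_nat (l - 1 - i) else 0) * F i)
     = (\<Sum>i<k+l-1. (of_nat i + 1 - of_nat l) * F i)"
    unfolding sum_subtractf[symmetric]
        by (rule sum.cong) (auto simp: of_nat_diff algebra_simps Suc_diff_le)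
  moreover have "(\<Sum>i<k+l-1. (if i < k then of_nat (k - 1 - i) else 0) * F i)
      - (\<Sum>i<k+l-1. (if i \<ge> k then of_nat (i + 1 - k) else 0) * F i)
     = (\<Sum>i<k+l-1. (of_nat k - 1 - of_nat i) * F i)"
    unfolding sum_subtractf[symmetric]
        by (rule sum.cong) (auto simp: of_nat_diff algebra_simps Suc_diff_le)
  moreover have "(\<Sum>i<k+l-1. (of_nat i + 1 - of_nat l) * F i)
      + (\<Sum>i<k+l-1. (of_nat k - 1 - of_nat i) * F i)
      = (of_nat k - of_nat l) * (\<Sum>i<k+l-1. F i)"
    unfolding sum.distrib[symmetric] sum_distrib_left by (rule sum.cong) (auto simp: algebra_simps)
  ultimately show ?thesis unfolding S1 S2 F_def by (simp add: algebra_simps)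
qed

section \<open>Symmetry of the coefficients under permutations of the multi-index\<close>

context
  fixes t h e :: "'r::comm_ring_1"
begin

text \<open>The joint contribution of W(x,x,I) and of the products W W, with the exponents
  \<open>a\<close> and \<open>b\<close> of the two copies of x kept apart.\<close>

definition quad :: "nat \<Rightarrow> nat \<Rightarrow> nat list \<Rightarrow> 'r" where
  "quad a b K = e * cum t h e (a # b # K) + conv (\<lambda>A. cum t h e (a # A)) (\<lambda>B. cum t h e (b # B)) K"

lemma cum_Suc:
  "cum t h e (Suc k # K) = of_nat k * h * cum t h e ((k - 1) # K) + (\<Sum>a<k. quad a (k - 1 - a) K)
     + pick_sum (\<lambda>j J. of_nat j * cum t h e ((k + j - 1) # J)) K"
  by (simp add: quad_def conv_def)

declare cum.simps(3) [simp del]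

text \<open>This is the part of the symmetry that concerns zero entries, since a leading zero
  already kills every list of length at least two. In each term of the recursion the zero stays in
  the tail of some factor, or it is the contracted index and brings the factor
  \<open>of_nat j = 0\<close>.\<close>

lemma cum_zero_tail: "0 \<in> set K \<Longrightarrow> cum t h e (k # K) = 0"
proof (induction "sum_list (k # K)" arbitrary: k K rule: less_induct)
  case less
  show ?case
  proof (cases k)
    case 0 then show ?thesis using less.prems by auto
  next
    case (Suc l)
    have 1: "of_nat l * h * cum t h e ((l - 1) # K) = 0"
      using less.hyps[of "l-1" K] less.prems Suc by simp
    have 2: "quad a (l - 1 - a) K = 0" if "a < l" for a
    proof -
      have "cum t h e (a # (l - 1 - a) # K) = 0"
        by (rule less.hyps) (use less.prems Suc that in auto)
      moreover have "conv (\<lambda>A. cum t h e (a # A)) (\<lambda>B. cum t h e ((l - 1 - a) # B)) K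
          = split_sum (\<lambda>A B. 0) K"
        unfolding conv_def
      proof (rule split_sum_cong[OF refl])
        fix A B assume m: "mset A + mset B = mset K"
        have "0 \<in> set A \<or> 0 \<in> set B"
          using less.prems m by (metis set_mset_mset union_iff)
        moreover note sum_list_mset_add[OF m]
        ultimately show "cum t h e (a # A) * cum t h e ((l - 1 - a) # B) = 0"
          using less.hyps[of a A] less.hyps[of "l-1-a" B] Suc that by auto
      qed
      ultimately show ?thesis by (simp add: quad_def)
    qed
    have 3: "pick_sum (\<lambda>j J. of_nat j * cum t h e ((l + j - 1) # J)) K = pick_sum (\<lambda>j J. 0) K"
    proof (rule pick_sum_cong[OF refl])
      fix j J assume m: "add_mset j (mset J) = mset K"
      show "of_nat j * cum t h e ((l + j - 1) # J) = 0"
      proof (cases j)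
        case (Suc i)
        have "0 \<in># add_mset j (mset J)" using less.prems m by simp
        then have "0 \<in> set J" using Suc by simp
        then show ?thesis using less.hyps[of "l+j-1" J] sum_list_add_mset[OF m] Suc \<open>k = Suc l\<close>
            by simp
      qed simp
    qed
    show ?thesis unfolding Suc cum_Suc using 1 2 3 by simp
  qed
qed


text \<open>The quadratic operation with indices \<open>a'\<close>, \<open>b'\<close> carried out
  inside \<open>quad a b\<close>: on the joint coefficient and, by the Leibniz rule, on each factor
  of the convolution.\<close>

definition quad2 :: "nat \<Rightarrow> nat \<Rightarrow> nat \<Rightarrow> nat \<Rightarrow> nat list \<Rightarrow> 'r" where
  "quad2 a' b' a b K = e * quad a' b' (a # b # K)
     + conv (\<lambda>A. quad a' b' (a # A)) (\<lambda>B. cum t h e (b # B)) K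
     + conv (\<lambda>A. cum t h e (a # A)) (\<lambda>B. quad a' b' (b # B)) K"

context
  fixes N :: nat
  assumes sym: "\<And>L L'. mset L = mset L' \<Longrightarrow> sum_list L < N \<Longrightarrow> cum t h e L = cum t h e L'"
begin

lemma quad_sym: "a + b + sum_list K < N \<Longrightarrow> quad a b K = quad b a K"
  unfolding quad_def by (subst conv_commute) (simp add: sym[of "a # b # K" "b # a # K"])

lemma quad_perm:
  assumes "mset K = mset K'" "a + b + sum_list K' < N"
  shows "quad a b K = quad a b K'"
proof -
  have "sum_list K = sum_list K'" using assms(1) by (metis sum_mset_sum_list)
  then have "cum t h e (a # b # K) = cum t h e (a # b # K')" using assms by (intro sym) auto
  moreover have "conv (\<lambda>A. cum t h e (a # A)) (\<lambda>B. cum t h e (b # B)) K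
      = conv (\<lambda>A. cum t h e (a # A)) (\<lambda>B. cum t h e (b # B)) K'"
    by (rule conv_perm) (use assms in \<open>auto intro!: sym\<close>)
  ultimately show ?thesis by (simp add: quad_def)
qed

text \<open>Two quadratic operations commute. Written out, \<open>quad2\<close> consists of one
  single coefficient and convolutions of two or three coefficients; exchanging the operations only
  permutes the factors and their leading indices, all below weight \<open>N\<close>.\<close>

lemma quad2_sym:
  assumes "a' + b' + a + b + sum_list K < N"
  shows "quad2 a' b' a b K = quad2 a b a' b' K"
proof -
  define f where "f = (\<lambda>i A. cum t h e (i # A))"
  define g where "g = (\<lambda>i j A. cum t h e (i # j # A))"
  define k where "k = (\<lambda>i j l A. cum t h e (i # j # l # A))"
  have gs: "g i j A = g j i A" if "i + j + sum_list A < N" for i j A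
    unfolding g_def by (rule sym) (use that in auto)
  have ks: "k i j l A = k j l i A" "k i j l A = k i l j A" if "i + j + l
      + sum_list A < N" for i j l A
    unfolding k_def by (rule sym; use that in auto)+
  note defs = quad2_def quad_def conv_Cons conv_add_left conv_add_right conv_cmult_left
      conv_cmult_right
  have fold: "quad2 a' b' a b K = e * e * cum t h e (a' # b' # a # b # K)
     + e * (conv (k a' a b) (f b') K + conv (g a' a) (g b' b) K + conv (g a' b) (g b' a) K
       + conv (f a') (k b' a b) K)
     + (e * conv (k a' b' a) (f b) K + conv (conv (g a' a) (f b')) (f b) K
       + conv (conv (f a') (g b' a)) (f b) K)
     + (e * conv (f a) (k a' b' b) K + conv (f a) (conv (g a' b) (f b')) K
       + conv (f a) (conv (f a') (g b' b)) K)" for a' b' a b K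
    unfolding defs by (simp add: f_def g_def k_def algebra_simps conv_def)
  have 0: "cum t h e (a' # b' # a # b # K) = cum t h e (a # b # a' # b' # K)"
      by (rule sym) (use assms in auto)
  have 1: "conv (k a' a b) (f b') K = conv (k a b a') (f b') K"
    "conv (f a') (k b' a b) K = conv (f a') (k a b b') K"
    "conv (k a' b' a) (f b) K = conv (k a a' b') (f b) K"
    "conv (f a) (k a' b' b) K = conv (f a) (k b a' b') K"
    "conv (g a' a) (g b' b) K = conv (g a a') (g b b') K"
    "conv (g a' b) (g b' a) K = conv (g b a') (g a b') K"
    by (rule conv_cong; use assms ks gs in force)+
  have gl: "conv (g i j) f' K = conv (g j i) f' K" if "i + j + sum_list K < N" for i j f' K
    by (rule conv_cong) (use that gs in auto)
  have "conv (conv (g a' a) (f b')) (f b) K = conv (conv (g a a') (f b)) (f b') K"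
    using gl[of a' a K "conv (f b) (f b')"] assms
        by (simp add: conv_assoc conv_commute[of "f b'" "f b"])
  moreover have "conv (conv (f a') (g b' a)) (f b) K = conv (f a') (conv (g a b') (f b)) K"
    using gl[of b' a K "conv (f a') (f b)"] assms
    by (simp add: conv_assoc conv_left_commute[of "f a'"])
  moreover have "conv (f a) (conv (g a' b) (f b')) K = conv (conv (f a) (g b a')) (f b') K"
    using gl[of a' b K "conv (f a) (f b')"] assms
    by (simp add: conv_assoc conv_left_commute[of "f a"])
  moreover have "conv (f a) (conv (f a') (g b' b)) K = conv (f a') (conv (f a) (g b b')) K"
    using gl[of b' b K "conv (f a) (f a')"] assms
    by (simp add: conv_assoc conv_commute[of _ "conv (f a) (f a')"] conv_left_commute[of "f a'"])
  ultimately show ?thesis unfolding fold[of a' b' a b K] fold[of a b a' b' K] 0 1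
    by (simp add: algebra_simps conv_commute[of "g b a'"])
qed

text \<open>The recursion expands the first index only, so \<open>x\<close> is brought to the front
  of every coefficient in which it occurs.\<close>

lemma quad_front:
  assumes "a + b + x + sum_list K < N"
  shows "quad a b (x # K) = e * cum t h e (x # a # b # K)
    + conv (\<lambda>A. cum t h e (x # a # A)) (\<lambda>B. cum t h e (b # B)) K
      + conv (\<lambda>A. cum t h e (a # A)) (\<lambda>B. cum t h e (x # b # B)) K"
proof -
  have "cum t h e (a # b # x # K) = cum t h e (x # a # b # K)" by (rule sym) (use assms in auto)
  moreover have "conv (\<lambda>A. cum t h e (a # x # A)) (\<lambda>B. cum t h e (b # B)) K
      = conv (\<lambda>A. cum t h e (x # a # A)) (\<lambda>B. cum t h e (b # B)) K"
    by (rule conv_cong) (use assms in \<open>auto intro!: sym\<close>)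
  moreover have "conv (\<lambda>A. cum t h e (a # A)) (\<lambda>B. cum t h e (b # x # B)) K
      = conv (\<lambda>A. cum t h e (a # A)) (\<lambda>B. cum t h e (x # b # B)) K"
    by (rule conv_cong) (use assms in \<open>auto intro!: sym\<close>)
  ultimately show ?thesis by (simp add: quad_def conv_Cons add.assoc)
qed

text \<open>With \<open>Suc l\<close> in front, each coefficient is expanded by the recursion. There
  \<open>a\<close> and \<open>b\<close> are later indices and get contracted as well; these two
  contractions supply the quadratic part of the remainder \<open>V\<close> below.\<close>

lemma quad_Suc:
  assumes "a + b + Suc l + sum_list K < N"
  shows "quad a b (Suc l # K) = of_nat l * h * quad a b ((l - 1) # K)
     + (\<Sum>a'<l. quad2 a' (l - 1 - a') a b K)
     + of_nat a * quad (l + a - 1) b K + of_nat b * quad a (l + b - 1) K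
     + pick_sum (\<lambda>j J. of_nat j * quad a b ((l + j - 1) # J)) K"
proof -
  define f where "f = (\<lambda>i A. cum t h e (i # A))"
  define g where "g = (\<lambda>i j A. cum t h e (i # j # A))"
  have gf: "cum t h e (Suc l # x # A) = of_nat l * h * g (l - 1) x A
      + (\<Sum>a'<l. quad a' (l - 1 - a') (x # A))
       + of_nat x * f (l + x - 1) A + pick_sum (\<lambda>j J. of_nat j * g (l + j - 1) x J) A" for x A
    unfolding cum_Suc by (simp add: f_def g_def)
  have X1: "conv (\<lambda>A. cum t h e (Suc l # a # A)) (f b) K = of_nat l * h * conv (g (l - 1) a) (f b) K
    + (\<Sum>a'<l. conv (\<lambda>A. quad a' (l - 1 - a') (a # A)) (f b) K)
    + of_nat a * conv (f (l + a - 1)) (f b) K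
      + pick_sum (\<lambda>j J. of_nat j * conv (g (l + j - 1) a) (f b) J) K"
    unfolding gf conv_add_left conv_cmult_left conv_sum_left conv_pick_left ..
  have X2: "conv (f a) (\<lambda>A. cum t h e (Suc l # b # A)) K = of_nat l * h * conv (f a) (g (l - 1) b) K
    + (\<Sum>a'<l. conv (f a) (\<lambda>A. quad a' (l - 1 - a') (b # A)) K)
    + of_nat b * conv (f a) (f (l + b - 1)) K
      + pick_sum (\<lambda>j J. of_nat j * conv (f a) (g (l + j - 1) b) J) K"
    unfolding gf conv_add_right conv_cmult_right conv_sum_right conv_pick_right ..
  have X0: "cum t h e (Suc l # a # b # K) = of_nat l * h * cum t h e ((l - 1) # a # b # K)
    + (\<Sum>a'<l. quad a' (l - 1 - a') (a # b # K)) + of_nat a * g (l + a - 1) b K + of_nat b * g (l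
      + b - 1) a K
    + pick_sum (\<lambda>j J. of_nat j * cum t h e ((l + j - 1) # a # b # J)) K"
    unfolding cum_Suc by (simp add: g_def)
  have q1: "quad a b ((l - 1) # K) = e * cum t h e ((l - 1) # a # b # K)
      + conv (g (l - 1) a) (f b) K + conv (f a) (g (l - 1) b) K"
    unfolding f_def g_def by (rule quad_front) (use assms in auto)
  have "pick_sum (\<lambda>j J. of_nat j * quad a b ((l + j - 1) # J)) K =
     pick_sum (\<lambda>j J. e * (of_nat j * cum t h e ((l + j - 1) # a # b # J))
         + of_nat j * conv (g (l + j - 1) a) (f b) J
        + of_nat j * conv (f a) (g (l + j - 1) b) J) K"
  proof (rule pick_sum_cong[OF refl])
    fix j J assume m: "add_mset j (mset J) = mset K"
    have "quad a b ((l + j - 1) # J) = e * cum t h e ((l + j - 1) # a # b # J)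
        + conv (g (l + j - 1) a) (f b) J
        + conv (f a) (g (l + j - 1) b) J"
      unfolding f_def g_def by (rule quad_front) (use assms sum_list_add_mset[OF m] in auto)
    then show "of_nat j * quad a b ((l + j - 1) # J)
        = e * (of_nat j * cum t h e ((l + j - 1) # a # b # J))
       + of_nat j * conv (g (l + j - 1) a) (f b) J + of_nat j * conv (f a) (g (l + j - 1) b) J"
      by (simp add: algebra_simps)
  qed
  then have q2: "pick_sum (\<lambda>j J. of_nat j * quad a b ((l + j - 1) # J)) K =
     e * pick_sum (\<lambda>j J. of_nat j * cum t h e ((l + j - 1) # a # b # J)) K
     + pick_sum (\<lambda>j J. of_nat j * conv (g (l + j - 1) a) (f b) J) K
     + pick_sum (\<lambda>j J. of_nat j * conv (f a) (g (l + j - 1) b) J) K"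
    by (simp only: pick_sum_add pick_sum_cmult)
  have q3: "(\<Sum>a'<l. quad2 a' (l - 1 - a') a b K) = e * (\<Sum>a'<l. quad a' (l - 1 - a') (a # b # K))
     + (\<Sum>a'<l. conv (\<lambda>A. quad a' (l - 1 - a') (a # A)) (f b) K)
     + (\<Sum>a'<l. conv (f a) (\<lambda>A. quad a' (l - 1 - a') (b # A)) K)"
    by (simp add: quad2_def f_def sum.distrib sum_distrib_left)
  have q4: "quad (l + a - 1) b K = e * g (l + a - 1) b K + conv (f (l + a - 1)) (f b) K"
    by (simp add: quad_def f_def g_def)
  have "g (l + b - 1) a K = cum t h e (a # (l + b - 1) # K)"
    unfolding g_def by (rule sym) (use assms in auto)
  then have q5: "quad a (l + b - 1) K = e * g (l + b - 1) a K + conv (f a) (f (l + b - 1)) K"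
    by (simp add: quad_def f_def)
  have "quad a b (Suc l # K) = e * cum t h e (Suc l # a # b # K)
    + conv (\<lambda>A. cum t h e (Suc l # a # A)) (f b) K + conv (f a) (\<lambda>B. cum t h e (Suc l # b # B)) K"
    unfolding f_def by (rule quad_front) (use assms in auto)
  then show ?thesis
    unfolding X0 X1 X2 q1 q2 q3 q4 q5 by (simp add: algebra_simps)
qed

text \<open>Expanding in the first and then in the second index gives terms that are symmetric, terms
  that pair up with those of the other order, and a remainder V. The difference of the two
  remainders is k - l times the recursion for the index k
      + l, which cancels the contraction of the two
  indices.\<close>
lemma cum_swap_Suc:
  assumes "Suc k + Suc l + sum_list K \<le> N"
  shows "cum t h e (Suc k # Suc l # K) = cum t h e (Suc l # Suc k # K)"
proof -
  \<comment> \<open>\<open>X\<close> is the recursion for \<open>Suc k\<close> without the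
    contraction of \<open>Suc k\<close> with \<open>Suc l\<close>. That contraction has the factor
    \<open>Suc l\<close>, is not symmetric in the two indices, and is kept apart in
    \<open>c_eq\<close>.\<close>
  define X where "X k l = of_nat k * h * cum t h e ((k - 1) # Suc l # K)
      + (\<Sum>a<k. quad a (k - 1 - a) (Suc l # K))
      + pick_sum (\<lambda>j J. of_nat j * cum t h e ((k + j - 1) # Suc l # J)) K" for k l
  define S where "S k l = of_nat k * h * of_nat l * h * cum t h e ((l - 1) # (k - 1) # K)
      + (\<Sum>a<k. \<Sum>a'<l. quad2 a' (l - 1 - a') a (k - 1 - a) K)
      + pick_sum (\<lambda>j J. pick_sum (\<lambda>i I. of_nat j * of_nat i * cum t h e ((l + i - 1) # (k
        + j - 1) # I)) J) K" for k l
  define Y where "Y k l = of_nat k * h * (\<Sum>a'<l. quad a' (l - 1 - a') ((k - 1) # K))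
      + of_nat k * h * pick_sum (\<lambda>j J. of_nat j * cum t h e ((l + j - 1) # (k - 1) # J)) K
      + pick_sum (\<lambda>j J. of_nat j * (\<Sum>a'<l. quad a' (l - 1 - a') ((k + j - 1) # J))) K" for k l
  define V where "V k l = of_nat k * h * of_nat (k - 1) * cum t h e ((l + (k - 1) - 1) # K)
      + (\<Sum>a<k. of_nat a * quad (l + a - 1) (k - 1 - a) K + of_nat (k - 1 - a) * quad a (l
        + (k - 1 - a) - 1) K)
      + pick_sum (\<lambda>j J. of_nat j * of_nat (k + j - 1) * cum t h e ((l
        + (k + j - 1) - 1) # J)) K" for k l
  have c_eq: "cum t h e (Suc k # Suc l # K) = X k l
      + of_nat (Suc l) * cum t h e ((k + l) # K)" for k l
    unfolding cum_Suc X_def by (simp add: algebra_simps)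
  have X_eq: "X k l = S k l + Y k l + Y l k + V k l" if le: "Suc k + Suc l + sum_list K \<le> N" for k l
  proof -
    have 1: "of_nat k * h * cum t h e ((k - 1) # Suc l # K)
        = of_nat k * h * of_nat l * h * cum t h e ((l - 1) # (k - 1) # K)
       + of_nat k * h * (\<Sum>a'<l. quad a' (l - 1 - a') ((k - 1) # K))
       + of_nat k * h * of_nat (k - 1) * cum t h e ((l + (k - 1) - 1) # K)
       + of_nat k * h * pick_sum (\<lambda>j J. of_nat j * cum t h e ((l + j - 1) # (k - 1) # J)) K"
    proof (cases k)
      case (Suc k')
      have "cum t h e (k' # Suc l # K) = cum t h e (Suc l # k' # K)"
          by (rule sym) (use le Suc in auto)
      then show ?thesis by (simp add: cum_Suc Suc algebra_simps)
    qed simp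
    have "(\<Sum>a<k. quad a (k - 1 - a) (Suc l # K))
        = (\<Sum>a<k. of_nat l * h * quad a (k - 1 - a) ((l - 1) # K)
       + (\<Sum>a'<l. quad2 a' (l - 1 - a') a (k - 1 - a) K)
       + of_nat a * quad (l + a - 1) (k - 1 - a) K + of_nat (k - 1 - a) * quad a (l
         + (k - 1 - a) - 1) K
       + pick_sum (\<lambda>j J. of_nat j * quad a (k - 1 - a) ((l + j - 1) # J)) K)"
      by (rule sum.cong[OF refl], rule quad_Suc) (use le in auto)
    then have 2: "(\<Sum>a<k. quad a (k - 1 - a) (Suc l # K))
        = of_nat l * h * (\<Sum>a<k. quad a (k - 1 - a) ((l - 1) # K))
       + (\<Sum>a<k. \<Sum>a'<l. quad2 a' (l - 1 - a') a (k - 1 - a) K)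
       + (\<Sum>a<k. of_nat a * quad (l + a - 1) (k - 1 - a) K + of_nat (k - 1 - a) * quad a (l
         + (k - 1 - a) - 1) K)
       + pick_sum (\<lambda>j J. of_nat j * (\<Sum>a<k. quad a (k - 1 - a) ((l + j - 1) # J))) K"
      by (simp only: sum.distrib sum_distrib_left pick_sum_sum add.assoc)
    have "pick_sum (\<lambda>j J. of_nat j * cum t h e ((k + j - 1) # Suc l # J)) K =
      pick_sum (\<lambda>j J. of_nat l * h * (of_nat j * cum t h e ((k + j - 1) # (l - 1) # J))
         + of_nat j * (\<Sum>a'<l. quad a' (l - 1 - a') ((k + j - 1) # J))
         + of_nat j * of_nat (k + j - 1) * cum t h e ((l + (k + j - 1) - 1) # J)
         + pick_sum (\<lambda>i I. of_nat j * of_nat i * cum t h e ((l + i - 1) # (k + j - 1) # I)) J) K"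
    proof (rule pick_sum_cong[OF refl])
      fix j J assume m: "add_mset j (mset J) = mset K"
      note w = sum_list_add_mset[OF m]
      have s1: "cum t h e ((k + j - 1) # Suc l # J) = cum t h e (Suc l # (k + j - 1) # J)"
          by (rule sym) (use le w in auto)
      have s2: "cum t h e ((k + j - 1) # (l - 1) # J) = cum t h e ((l - 1) # (k + j - 1) # J)"
          by (rule sym) (use le w in auto)
      show "of_nat j * cum t h e ((k + j - 1) # Suc l # J)
          = of_nat l * h * (of_nat j * cum t h e ((k + j - 1) # (l - 1) # J))
         + of_nat j * (\<Sum>a'<l. quad a' (l - 1 - a') ((k + j - 1) # J))
         + of_nat j * of_nat (k + j - 1) * cum t h e ((l + (k + j - 1) - 1) # J)
         + pick_sum (\<lambda>i I. of_nat j * of_nat i * cum t h e ((l + i - 1) # (k + j - 1) # I)) J"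
        unfolding s1 s2 cum_Suc pick_sum.simps mult.assoc pick_sum_cmult
            by (simp only: algebra_simps)
    qed
    then have 3: "pick_sum (\<lambda>j J. of_nat j * cum t h e ((k + j - 1) # Suc l # J)) K =
      of_nat l * h * pick_sum (\<lambda>j J. of_nat j * cum t h e ((k + j - 1) # (l - 1) # J)) K
      + pick_sum (\<lambda>j J. of_nat j * (\<Sum>a'<l. quad a' (l - 1 - a') ((k + j - 1) # J))) K
      + pick_sum (\<lambda>j J. of_nat j * of_nat (k + j - 1) * cum t h e ((l + (k + j - 1) - 1) # J)) K
      + pick_sum (\<lambda>j J. pick_sum (\<lambda>i I. of_nat j * of_nat i * cum t h e ((l + i - 1) # (k
        + j - 1) # I)) J) K"
      by (simp only: pick_sum_add pick_sum_cmult)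
    show ?thesis unfolding X_def 1 2 3 unfolding S_def Y_def V_def by (simp only: ac_simps)
  qed
  have S_eq: "S k l = S l k"
  proof -
    have "(\<Sum>a<k. \<Sum>a'<l. quad2 a' (l - 1 - a') a (k - 1 - a) K)
        = (\<Sum>a<k. \<Sum>a'<l. quad2 a (k - 1 - a) a' (l - 1 - a') K)"
      by (intro sum.cong refl quad2_sym) (use assms in auto)
    also have "\<dots> = (\<Sum>a'<l. \<Sum>a<k. quad2 a (k - 1 - a) a' (l - 1 - a') K)" by (rule sum.swap)
    finally have 1: "(\<Sum>a<k. \<Sum>a'<l. quad2 a' (l - 1 - a') a (k - 1 - a) K) = \<dots>" .
    have "pick_sum (\<lambda>j J. pick_sum (\<lambda>i I. of_nat j * of_nat i * cum t h e ((l + i - 1) # (k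
        + j - 1) # I)) J) K
      = pick_sum (\<lambda>j J. pick_sum (\<lambda>i I. of_nat i * of_nat j * cum t h e ((k + j - 1) # (l
        + i - 1) # I)) J) K"
    proof (intro pick_sum_cong refl)
      fix j J i I assume "add_mset j (mset J) = mset K" "add_mset i (mset I) = mset J"
      note w = this[THEN sum_list_add_mset]
      have "cum t h e ((l + i - 1) # (k + j - 1) # I) = cum t h e ((k + j - 1) # (l + i - 1) # I)"
        by (rule sym) (use assms w in auto)
      then show "of_nat j * of_nat i * cum t h e ((l + i - 1) # (k + j - 1) # I)
          = of_nat i * of_nat j * cum t h e ((k + j - 1) # (l + i - 1) # I)"
        by (simp add: ac_simps)
    qed
    also have "\<dots> = pick_sum (\<lambda>j J. pick_sum (\<lambda>i I. of_nat j * of_nat i * cum t h e ((k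
        + i - 1) # (l + j - 1) # I)) J) K"
      by (rule pick_sum_commute)
    finally have 2: "pick_sum (\<lambda>j J. pick_sum (\<lambda>i I. of_nat j * of_nat i * cum t h e ((l
        + i - 1) # (k + j - 1) # I)) J) K = \<dots>" .
    have "cum t h e ((l - 1) # (k - 1) # K) = cum t h e ((k - 1) # (l - 1) # K)"
        by (rule sym) (use assms in auto)
    then show ?thesis unfolding S_def 1 2 by (simp add: ac_simps)
  qed
  have V_eq: "V k l - V l k = (of_nat k - of_nat l) * cum t h e ((k + l) # K)"
  proof (cases "k + l")
    case (Suc m)
    have *: "of_nat k * of_nat (k - 1) * cum t h e ((l + (k - 1) - 1) # K)
        = of_nat k * (of_nat k - 1) * cum t h e ((m - 1) # K)"
      if "k + l = Suc m" for k l by (cases k) (use that in \<open>auto simp: add.commute\<close>)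
    \<comment> \<open>This is k (k - 1) - l (l - 1) = (k - l) (k + l - 1) with
      \<open>m = k + l - 1\<close>.\<close>
    have 1: "of_nat k * h * of_nat (k - 1) * cum t h e ((l + (k - 1) - 1) # K) - of_nat l * h
        * of_nat (l - 1) * cum t h e ((k + (l - 1) - 1) # K)
        = (of_nat k - of_nat l) * (of_nat m * h * cum t h e ((m - 1) # K))"
    proof -
      have "(of_nat m :: 'r) = of_nat k + of_nat l - 1"
          using arg_cong[OF Suc, of "of_nat :: nat \<Rightarrow> 'r"] by simp
      moreover have "of_nat k * h * of_nat (k - 1) * cum t h e ((l + (k - 1) - 1) # K)
          = h * (of_nat k * (of_nat k - 1) * cum t h e ((m - 1) # K))"
        using *[of k l] Suc by (simp only: ac_simps)
      moreover have "of_nat l * h * of_nat (l - 1) * cum t h e ((k + (l - 1) - 1) # K)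
          = h * (of_nat l * (of_nat l - 1) * cum t h e ((m - 1) # K))"
        using *[of l k] Suc by (simp only: ac_simps)
      ultimately show ?thesis by (simp only:) (simp add: algebra_simps)
    qed
    have 2: "(\<Sum>a<k. of_nat a * quad (l + a - 1) (k - 1 - a) K + of_nat (k - 1 - a) * quad a (l
        + (k - 1 - a) - 1) K)
       - (\<Sum>a<l. of_nat a * quad (k + a - 1) (l - 1 - a) K + of_nat (l - 1 - a) * quad a (k
           + (l - 1 - a) - 1) K)
       = (of_nat k - of_nat l) * (\<Sum>a<m. quad a (m - 1 - a) K)"
    proof -
      have "k + l - 1 = m" "k + l - 2 = m - 1" using Suc by auto
      then show ?thesis using sum_virasoro[of k l "\<lambda>a b. quad a b K"] quad_sym[of _ _ K] assms Suc
          by simp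
    qed
    have "pick_sum (\<lambda>j J. of_nat j * of_nat (k + j - 1) * cum t h e ((l + (k + j - 1) - 1) # J)) K =
      pick_sum (\<lambda>j J. of_nat j * of_nat (l + j - 1) * cum t h e ((k + (l + j - 1) - 1) # J)
          + (of_nat k - of_nat l) * (of_nat j * cum t h e ((m + j - 1) # J))) K"
    proof (rule pick_sum_cong[OF refl])
      fix j J
      show "of_nat j * of_nat (k + j - 1) * cum t h e ((l + (k + j - 1) - 1) # J) =
        of_nat j * of_nat (l + j - 1) * cum t h e ((k + (l + j - 1) - 1) # J)
            + (of_nat k - of_nat l) * (of_nat j * cum t h e ((m + j - 1) # J))"
      proof (cases j)
        case (Suc i)
        have "l + (k + j - 1) - 1 = m + i" "k + (l + j - 1) - 1 = m + i" "k + j - 1 = k + i" "l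
            + j - 1 = l + i" "m + j - 1 = m + i"
          using \<open>k + l = Suc m\<close> Suc by auto
        then show ?thesis by (simp add: algebra_simps)
      qed simp
    qed
    then have 3: "pick_sum (\<lambda>j J. of_nat j * of_nat (k + j - 1) * cum t h e ((l
        + (k + j - 1) - 1) # J)) K =
       pick_sum (\<lambda>j J. of_nat j * of_nat (l + j - 1) * cum t h e ((k + (l + j - 1) - 1) # J)) K
      + (of_nat k - of_nat l) * pick_sum (\<lambda>j J. of_nat j * cum t h e ((m + j - 1) # J)) K"
      by (simp only: pick_sum_add pick_sum_cmult)
    have "V k l - V l k
        = (of_nat k * h * of_nat (k - 1) * cum t h e ((l + (k - 1) - 1) # K) - of_nat l * h
          * of_nat (l - 1) * cum t h e ((k + (l - 1) - 1) # K))
      + ((\<Sum>a<k. of_nat a * quad (l + a - 1) (k - 1 - a) K + of_nat (k - 1 - a) * quad a (l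
        + (k - 1 - a) - 1) K)
       - (\<Sum>a<l. of_nat a * quad (k + a - 1) (l - 1 - a) K + of_nat (l - 1 - a) * quad a (k
           + (l - 1 - a) - 1) K))
      + (of_nat k - of_nat l) * pick_sum (\<lambda>j J. of_nat j * cum t h e ((m + j - 1) # J)) K"
      unfolding V_def 3 by (simp only: algebra_simps)
    \<comment> \<open>The three differences share the factor k - l, and their cofactors are the
      three parts of the recursion for the index \<open>Suc m = k + l\<close>.\<close>
    also have "\<dots> = (of_nat k - of_nat l) * cum t h e (Suc m # K)"
      unfolding 1 2 cum_Suc by (simp only: algebra_simps)
    finally show ?thesis using Suc by simp
  qed (auto simp: V_def)
  have "cum t h e (Suc k # Suc l # K) - cum t h e (Suc l # Suc k # K) = V k l - V l k
      + (of_nat l - of_nat k) * cum t h e ((k + l) # K)"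
    unfolding c_eq using X_eq[of k l] X_eq[of l k] assms S_eq by (simp add: algebra_simps)
  then show ?thesis unfolding V_eq by (simp add: algebra_simps)
qed

text \<open>For a fixed first index all terms of the recursion have smaller weight, and they see the
  tail only through splittings and removals, which ignore its order. Hence weight \<open>N\<close>
  itself is reached, one step beyond \<open>sym\<close>.\<close>

lemma cum_perm_tail:
  assumes "mset K = mset K'" "sum_list (k # K') \<le> N"
  shows "cum t h e (k # K) = cum t h e (k # K')"
proof (cases k)
  case 0
  then show ?thesis using assms(1) by auto
next
  case (Suc l)
  have w: "sum_list K = sum_list K'" using assms(1) by (metis sum_mset_sum_list)
  have "cum t h e ((l - 1) # K) = cum t h e ((l - 1) # K')"
    by (rule sym) (use assms Suc w in auto)
  moreover have "(\<Sum>a<l. quad a (l - 1 - a) K) = (\<Sum>a<l. quad a (l - 1 - a) K')"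
    by (intro sum.cong refl quad_perm) (use assms Suc in auto)
  moreover have "pick_sum (\<lambda>j J. of_nat j * cum t h e ((l + j - 1) # J)) K
      = pick_sum (\<lambda>j J. of_nat j * cum t h e ((l + j - 1) # J)) K'"
  proof (rule pick_sum_perm[OF assms(1)])
    fix j A A' assume m: "mset A = mset A'" "add_mset j (mset A) = mset K'"
    have "cum t h e ((l + j - 1) # A) = cum t h e ((l + j - 1) # A')"
      by (rule sym) (use m sum_list_add_mset[OF m(2)] assms Suc in auto)
    then show "of_nat j * cum t h e ((l + j - 1) # A) = of_nat j * cum t h e ((l + j - 1) # A')"
        by simp
  qed
  ultimately show ?thesis unfolding Suc cum_Suc by simp
qed

end

text \<open>Permutations of the tail and the exchange of the first two entries generate all
  permutations. The induction hypothesis is \<open>sym\<close> with \<open>N = sum_list K\<close>;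
  the exchange is \<open>cum_zero_tail\<close> if one of the two entries is zero and
  \<open>cum_swap_Suc\<close> otherwise.\<close>

theorem cum_perm: "mset K = mset K' \<Longrightarrow> cum t h e K = cum t h e K'"
proof (induction "sum_list K" arbitrary: K K' rule: less_induct)
  case less
  have sym: "cum t h e L = cum t h e L'" if "mset L = mset L'" "sum_list L < sum_list K" for L L'
    using less.hyps that by blast
  have w: "sum_list K = sum_list K'" using less.prems by (metis sum_mset_sum_list)
  have swap: "cum t h e (x # y # M) = cum t h e (y # x # M)" if "sum_list (x # y # M)
      \<le> sum_list K" for x y M
  proof (cases "x = 0 \<or> y = 0")
    case True
    then show ?thesis using cum_zero_tail[of "y # M" x] cum_zero_tail[of "x # M" y] by auto
  next
    case False
    then obtain x' y' where "x = Suc x'" "y = Suc y'" by (metis not0_implies_Suc)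
    then show ?thesis using cum_swap_Suc[OF sym, where k = x' and l = y' and K = M] that by auto
  qed
  show ?case
  proof (cases K)
    case (Cons x xs)
    then obtain y ys where K': "K' = y # ys" using less.prems by (cases K') auto
    show ?thesis
    proof (cases "x = y")
      case True
      show ?thesis unfolding Cons K' True
        by (rule cum_perm_tail[OF sym]) (use less.prems True Cons K' w in auto)
    next
      case False
      then have "y \<in># mset xs" using less.prems Cons K'
          by (metis insert_noteq_member mset.simps(2) union_single_eq_member add_mset_add_single)
      then obtain zs where zs: "mset xs = mset (y # zs)"
        by (metis ex_mset insert_DiffM mset.simps(2))
      then have ys: "mset ys = mset (x # zs)" using less.prems Cons K'
          by (simp add: add_mset_commute)
      have wz: "sum_list xs = y + sum_list zs" using zs by (metis sum_list.Cons sum_mset_sum_list)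
      have "cum t h e K = cum t h e (x # y # zs)" unfolding Cons
        by (rule cum_perm_tail[OF sym zs]) (use Cons wz in auto)
      also have "\<dots> = cum t h e (y # x # zs)" by (rule swap) (use Cons wz in auto)
      also have "\<dots> = cum t h e K'" unfolding K'
        by (rule cum_perm_tail[OF sym ys[symmetric]]) (use K' w in auto)
      finally show ?thesis .
    qed
  qed (use less.prems in auto)
qed

end

section \<open>Coefficients of fixed order g and their vanishing at low weight\<close>

lemma split_sum_nth: "fps_nth (split_sum f K) g = split_sum (\<lambda>A B. fps_nth (f A B) g) K"
  by (induction K arbitrary: f) simp_all

lemma pick_sum_nth: "fps_nth (pick_sum f K) g = pick_sum (\<lambda>j J. fps_nth (f j J) g) K"
  by (induction K arbitrary: f) simp_all

text \<open>The coefficient of the product of the x_i^-(K_i + 1) in the correlator of order g.\<close>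
definition Wcoeff :: "real \<Rightarrow> complex \<Rightarrow> nat \<Rightarrow> nat list \<Rightarrow> complex" where
  "Wcoeff T hbar g K
      = fps_nth (cum (fps_const (complex_of_real T)) (- fps_const hbar * fps_X) (fps_X ^ 2) K) g"

lemma Wcoeff_perm: "mset K = mset K' \<Longrightarrow> Wcoeff T hbar g K = Wcoeff T hbar g K'"
  unfolding Wcoeff_def using cum_perm by metis

lemma Wcoeff_0: "Wcoeff T hbar g (0 # K) = (if K = [] \<and> g = 0 then complex_of_real T else 0)"
  by (simp add: Wcoeff_def)

text \<open>Coefficients of X^g are compared: factors X and X^2 lower the order by one and two, and
  the product of two series produces the sum over \<open>p\<close>.\<close>

lemma Wcoeff_Suc:
  "Wcoeff T hbar g (Suc k # K) =
     (if 1 \<le> g then - hbar * of_nat k * Wcoeff T hbar (g - 1) ((k - 1) # K) else 0)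
   + (if 2 \<le> g then \<Sum>a<k. Wcoeff T hbar (g - 2) (a # (k - 1 - a) # K) else 0)
   + (\<Sum>a<k. split_sum (\<lambda>A B. \<Sum>p\<le>g. Wcoeff T hbar p (a # A) * Wcoeff T hbar (g - p)
     ((k - 1 - a) # B)) K)
   + pick_sum (\<lambda>j J. of_nat j * Wcoeff T hbar g ((k + j - 1) # J)) K"
proof -
  have h: "fps_nth (of_nat k * (- fps_const hbar * fps_X) * y) g
      = (if 1 \<le> g then - hbar * of_nat k * fps_nth y (g - 1) else 0)" for y :: "complex fps"
  proof -
    have "of_nat k * (- fps_const hbar * fps_X) * y = fps_X * (fps_const (- hbar * of_nat k) * y)"
      by (simp add: fps_of_nat[symmetric] algebra_simps flip: fps_const_mult fps_const_neg)
    then show ?thesis by (simp only: fps_X_mult_nth) simp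
  qed
  have e: "fps_nth (fps_X ^ 2 * y) g
      = (if 2 \<le> g then fps_nth y (g - 2) else 0)" for y :: "complex fps"
    by (simp add: fps_X_power_mult_nth not_less)
  have m: "fps_nth (split_sum (\<lambda>A B. F A * G B) K) g
      = split_sum (\<lambda>A B. \<Sum>p\<le>g. fps_nth (F A) p * fps_nth (G B) (g - p)) K"
    for F G :: "nat list \<Rightarrow> complex fps"
    by (simp add: split_sum_nth fps_mult_nth atMost_atLeast0)
  have j: "fps_nth (of_nat j * y) g = of_nat j * fps_nth y g" for j and y :: "complex fps"
    by (simp add: fps_of_nat[symmetric])
  show ?thesis
    unfolding Wcoeff_def cum.simps(3) fps_add_nth h sum.distrib fps_sum_nth e pick_sum_nth m j
    by simp
qed

text \<open>Every term of the recursion has weight two less. The threshold 2n + 2g - 2 also drops by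
  two for the derivative, the diagonal and the contraction terms. For a product the thresholds of
  the factors add up to the old one, so at least one factor lies below its own. The recursion ends
  at a leading zero, where only \<open>[0]\<close> with \<open>g = 0\<close> survives and weight and
  threshold are both 0.\<close>

lemma Wcoeff_vanish:
  assumes "K \<noteq> []" "sum_list K + 2 < 2 * length K + 2 * g"
  shows "Wcoeff T hbar g K = 0"
  using assms
proof (induction "sum_list K" arbitrary: K g rule: less_induct)
  case less
  obtain k' K' where K: "K = k' # K'" using less.prems(1) by (cases K) auto
  show ?case
  proof (cases k')
    case 0 then show ?thesis using less.prems K by (auto simp: Wcoeff_0)
  next
    case (Suc k)
    have 1: "Wcoeff T hbar (g - 1) ((k - 1) # K') = 0" if "1 \<le> g" "k \<noteq> 0"
      by (rule less.hyps) (use less.prems K Suc that in auto)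
    have 2: "Wcoeff T hbar (g - 2) (a # (k - 1 - a) # K') = 0" if "2 \<le> g" "a < k" for a
      by (rule less.hyps) (use less.prems K Suc that in auto)
    have 3: "split_sum (\<lambda>A B. \<Sum>p\<le>g. Wcoeff T hbar p (a # A) * Wcoeff T hbar (g - p)
        ((k - 1 - a) # B)) K' = split_sum (\<lambda>A B. 0) K'" if "a < k" for a
    proof (rule split_sum_cong[OF refl], rule sum.neutral, rule ballI)
      fix A B p assume m: "mset A + mset B = mset K'" and p: "p \<in> {..g}"
      have l: "length A + length B = length K'" using m by (metis size_mset size_union)
      note w = sum_list_mset_add[OF m]
      show "Wcoeff T hbar p (a # A) * Wcoeff T hbar (g - p) ((k - 1 - a) # B) = 0"
      proof (cases "sum_list (a # A) + 2 < 2 * length (a # A) + 2 * p")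
        case True
        have "Wcoeff T hbar p (a # A) = 0" by (rule less.hyps) (use True w that K Suc in auto)
        then show ?thesis by simp
      next
        case False
        have "Wcoeff T hbar (g - p) ((k - 1 - a) # B) = 0"
          by (rule less.hyps) (use False w that K Suc less.prems l p in auto)
        then show ?thesis by simp
      qed
    qed
    have 4: "pick_sum (\<lambda>j J. of_nat j * Wcoeff T hbar g ((k + j - 1) # J)) K'
        = pick_sum (\<lambda>j J. 0) K'"
    proof (rule pick_sum_cong[OF refl])
      fix j J assume m: "add_mset j (mset J) = mset K'"
      have l: "length K' = Suc (length J)" using m by (metis size_mset size_add_mset)
      note w = sum_list_add_mset[OF m]
      have "Wcoeff T hbar g ((k + j - 1) # J) = 0" if "j \<noteq> 0"
        by (rule less.hyps) (use w l that K Suc less.prems in auto)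
      then show "of_nat j * Wcoeff T hbar g ((k + j - 1) # J) = 0" by auto
    qed
    show ?thesis unfolding K Suc Wcoeff_Suc using 1 2 3 4 by (cases "k = 0") auto
  qed
qed

section \<open>Laurent series in several variables\<close>

definition idx :: "nat \<Rightarrow> nat list set" where
  "idx n = {K. length K = n}"

text \<open>The exponents are shifted by one because the correlators vanish at infinity in each
  variable. The default value 1 ends the product; all sums run over multi-indices as long as the
  list of points.\<close>

fun mon :: "complex list \<Rightarrow> nat list \<Rightarrow> complex" where
  "mon (x # q) (k # K) = (1 / x) ^ Suc k * mon q K"
| "mon q K = 1"

definition ev :: "(nat list \<Rightarrow> complex) \<Rightarrow> complex list \<Rightarrow> complex" where
  "ev a q = (\<Sum>\<^sub>\<infinity>K\<in>idx (length q). a K * mon q K)"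

lemma idx_0 [simp]: "idx 0 = {[]}"
  by (auto simp: idx_def)

lemma Cons_in_idx [simp]: "k # K \<in> idx (Suc n) \<longleftrightarrow> K \<in> idx n"
  by (simp add: idx_def)

lemma idx_SucE:
  assumes "K \<in> idx (Suc n)" obtains k L where "K = k # L" "L \<in> idx n"
  using assms by (auto simp: idx_def length_Suc_conv)

lemma bij_betw_idx_Suc: "bij_betw (\<lambda>(k, K). k # K) (UNIV \<times> idx n) (idx (Suc n))"
  by (rule bij_betwI[of _ _ _ "\<lambda>L. (hd L, tl L)"]) (auto elim: idx_SucE)

lemma has_sum_idx_Suc:
  "((\<lambda>(k, K). f (k # K)) has_sum s) (UNIV \<times> idx n) \<longleftrightarrow> (f has_sum s) (idx (Suc n))"
  using has_sum_reindex_bij_betw[OF bij_betw_idx_Suc, of f] by (simp add: case_prod_unfold)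

lemma summable_on_idx_Suc:
  "(\<lambda>(k, K). f (k # K)) summable_on (UNIV \<times> idx n) \<longleftrightarrow> f summable_on (idx (Suc n))"
  unfolding summable_on_def has_sum_idx_Suc ..

lemma has_sum_times:
  fixes f g :: "_ \<Rightarrow> complex"
  assumes f: "(f has_sum a) A" and g: "(g has_sum b) B"
  shows "((\<lambda>(x, y). f x * g y) has_sum (a * b)) (A \<times> B)"
proof (rule has_sum_SigmaI)
  show "((\<lambda>y. case (x, y) of (x, y) \<Rightarrow> f x * g y) has_sum f x * b) B" for x
    using has_sum_cmult_right[OF g] by simp
  show "((\<lambda>x. f x * b) has_sum a * b) A" by (rule has_sum_cmult_left[OF f])
  have fa: "(\<lambda>x. norm (f x)) summable_on A" and ga: "(\<lambda>x. norm (g x)) summable_on B"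
    using f g by (auto simp flip: summable_on_iff_abs_summable_on_complex simp:
        has_sum_imp_summable)
  have "(\<lambda>x. norm (f x) * infsum (\<lambda>y. norm (g y)) B) summable_on A"
    by (rule summable_on_cmult_left) (use fa in simp)
  moreover have "infsum (\<lambda>y. norm (g y)) B \<ge> 0" by (simp add: infsum_nonneg)
  ultimately have "(\<lambda>z. norm ((\<lambda>(x, y). f x * g y) z)) summable_on A \<times> B"
    by (subst Infinite_Sum.abs_summable_on_Sigma_iff)
       (auto simp: norm_mult infsum_cmult_right' ga intro!: summable_on_cmult_right)
  then show "(\<lambda>(x, y). f x * g y) summable_on A \<times> B" by (rule abs_summable_summable)
qed

text \<open>Different splittings distribute the exponents over different pairs of lists, while the
  sum needs one index set. The parameter \<open>r\<close> resolves this: in the induction the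
  exponent of the variable just assigned is pushed onto \<open>r\<close>, so the claim keeps its
  form with a larger set \<open>P'\<close>. Taking \<open>r\<close> to be a list keeps the type
  unchanged.\<close>

lemma has_sum_split_sum:
  fixes \<phi> :: "nat list \<Rightarrow> nat list \<Rightarrow> nat list \<Rightarrow> complex"
  assumes "\<And>A B. mset A + mset B = mset I \<Longrightarrow>
     ((\<lambda>(r, K, L). \<phi> r K L * (mon A K * mon B L))
         has_sum s A B) (P \<times> idx (length A) \<times> idx (length B))"
  shows "((\<lambda>(r, K). split_sum (\<phi> r) K * mon I K) has_sum split_sum s I) (P \<times> idx (length I))"
  using assms
proof (induction I arbitrary: \<phi> s P)
  case Nil
  have "((\<lambda>(r, K, L). \<phi> r K L * (mon [] K * mon [] L)) has_sum s [] []) (P \<times> idx 0 \<times> idx 0)"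
    using Nil[of "[]" "[]"] by simp
  moreover have "((\<lambda>(r, K). split_sum (\<phi> r) K * mon [] K) has_sum s [] []) (P \<times> idx 0) \<longleftrightarrow>
      ((\<lambda>(r, K, L). \<phi> r K L * (mon [] K * mon [] L)) has_sum s [] []) (P \<times> idx 0 \<times> idx 0)"
    by (rule has_sum_reindex_bij_witness[of _ "\<lambda>(r, K, L). (r, K)" "\<lambda>(r, K). (r, K, [])"]) auto
  ultimately show ?case by simp
next
  case (Cons x I)
  define P' where "P' = (\<lambda>(k, r). k # r) ` (UNIV \<times> P)"
  define \<phi>1 where "\<phi>1 = (\<lambda>r A B. (1 / x) ^ Suc (hd r) * \<phi> (tl r) (hd r # A) B)"
  define \<phi>2 where "\<phi>2 = (\<lambda>r A B. (1 / x) ^ Suc (hd r) * \<phi> (tl r) A (hd r # B))"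
  have P': "r \<in> P' \<longleftrightarrow> r \<noteq> [] \<and> tl r \<in> P" for r by (cases r) (auto simp: P'_def)
  have 1: "((\<lambda>(r, K). split_sum (\<phi>1 r) K * mon I K)
      has_sum split_sum (\<lambda>A B. s (x # A) B) I) (P' \<times> idx (length I))"
  proof (rule Cons.IH)
    fix A B assume "mset A + mset B = mset I"
    then have "((\<lambda>(r, K, L). \<phi> r K L * (mon (x # A) K * mon B L))
        has_sum s (x # A) B) (P \<times> idx (length (x # A)) \<times> idx (length B))"
      by (intro Cons.prems) simp
    then show "((\<lambda>(r, K, L). \<phi>1 r K L * (mon A K * mon B L))
        has_sum s (x # A) B) (P' \<times> idx (length A) \<times> idx (length B))"
      by (subst has_sum_reindex_bij_witness[of _ "\<lambda>(r, K, L). (hd K # r, tl K, L)" "\<lambda>(r, K, L).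
          (tl r, hd r # K, L)"])
         (auto simp: P' \<phi>1_def elim!: idx_SucE)
  qed
  have 2: "((\<lambda>(r, K). split_sum (\<phi>2 r) K * mon I K)
      has_sum split_sum (\<lambda>A B. s A (x # B)) I) (P' \<times> idx (length I))"
  proof (rule Cons.IH)
    fix A B assume "mset A + mset B = mset I"
    then have "((\<lambda>(r, K, L). \<phi> r K L * (mon A K * mon (x # B) L))
        has_sum s A (x # B)) (P \<times> idx (length A) \<times> idx (length (x # B)))"
      by (intro Cons.prems) simp
    then show "((\<lambda>(r, K, L). \<phi>2 r K L * (mon A K * mon B L))
        has_sum s A (x # B)) (P' \<times> idx (length A) \<times> idx (length B))"
      by (subst has_sum_reindex_bij_witness[of _ "\<lambda>(r, K, L). (hd L # r, K, tl L)" "\<lambda>(r, K, L).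
          (tl r, K, hd r # L)"])
         (auto simp: P' \<phi>2_def elim!: idx_SucE)
  qed
  have "((\<lambda>(r, K). split_sum (\<phi> r) K * mon (x # I) K)
      has_sum split_sum s (x # I)) (P \<times> idx (length (x # I))) \<longleftrightarrow>
     ((\<lambda>z. (case z of (r, K) \<Rightarrow> split_sum (\<phi>1 r) K * mon I K)
         + (case z of (r, K) \<Rightarrow> split_sum (\<phi>2 r) K * mon I K))
       has_sum split_sum s (x # I)) (P' \<times> idx (length I))"
    by (rule has_sum_reindex_bij_witness[of _ "\<lambda>(r, K). (tl r, hd r # K)" "\<lambda>(r, K).
        (hd K # r, tl K)"])
       (auto simp: P' \<phi>1_def \<phi>2_def split_sum_cmult algebra_simps simp del: power_Suc elim!:
           idx_SucE)
  then show ?case using has_sum_add[OF 1 2] by simp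
qed

lemma has_sum_pick_sum:
  fixes \<phi> :: "nat list \<Rightarrow> nat \<Rightarrow> nat list \<Rightarrow> complex"
  assumes "\<And>y Y. add_mset y (mset Y) = mset I \<Longrightarrow>
     ((\<lambda>(r, K). \<phi> r (hd K) (tl K) * mon (y # Y) K) has_sum s y Y) (P \<times> idx (Suc (length Y)))"
  shows "((\<lambda>(r, K). pick_sum (\<phi> r) K * mon I K) has_sum pick_sum s I) (P \<times> idx (length I))"
  using assms
proof (induction I arbitrary: \<phi> s P)
  case Nil
  have "((\<lambda>(r, K). pick_sum (\<phi> r) K * mon [] K) has_sum 0) (P \<times> idx 0)"
    by (rule has_sum_0) auto
  then show ?case by simp
next
  case (Cons x I)
  \<comment> \<open>As for splittings, \<open>r\<close> stores the exponents of the variables that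
    have been passed over.\<close>
  define P' where "P' = (\<lambda>(k, r). k # r) ` (UNIV \<times> P)"
  define \<phi>1 where "\<phi>1 = (\<lambda>r j J. (1 / x) ^ Suc (hd r) * \<phi> (tl r) j (hd r # J))"
  have P': "r \<in> P' \<longleftrightarrow> r \<noteq> [] \<and> tl r \<in> P" for r by (cases r) (auto simp: P'_def)
  have 1: "((\<lambda>(r, K). pick_sum (\<phi>1 r) K * mon I K)
      has_sum pick_sum (\<lambda>y Y. s y (x # Y)) I) (P' \<times> idx (length I))"
  proof (rule Cons.IH)
    fix y Y assume "add_mset y (mset Y) = mset I"
    then have "((\<lambda>(r, K). \<phi> r (hd K) (tl K) * mon (y # x # Y) K)
        has_sum s y (x # Y)) (P \<times> idx (Suc (length (x # Y))))"
      by (intro Cons.prems) (simp add: add_mset_commute)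
    then show "((\<lambda>(r, K). \<phi>1 r (hd K) (tl K) * mon (y # Y) K)
        has_sum s y (x # Y)) (P' \<times> idx (Suc (length Y)))"
      by (subst has_sum_reindex_bij_witness[of _ "\<lambda>(r, K). (hd (tl K) # r, hd K # tl (tl K))"
          "\<lambda>(r, K). (tl r, hd K # hd r # tl K)"])
         (auto simp: P' \<phi>1_def elim!: idx_SucE)
  qed
  have 2: "((\<lambda>(r, K). \<phi> r (hd K) (tl K) * mon (x # I) K) has_sum s x I) (P \<times> idx (Suc (length I)))"
    by (rule Cons.prems) simp
  have "((\<lambda>(r, K). pick_sum (\<lambda>y Y. \<phi> r y (hd K # Y)) (tl K) * mon (x # I) K)
      has_sum pick_sum (\<lambda>y Y. s y (x # Y)) I) (P \<times> idx (Suc (length I)))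
     \<longleftrightarrow> ((\<lambda>(r, K). pick_sum (\<phi>1 r) K * mon I K)
         has_sum pick_sum (\<lambda>y Y. s y (x # Y)) I) (P' \<times> idx (length I))"
    by (rule has_sum_reindex_bij_witness[of _ "\<lambda>(r, K). (tl r, hd r # K)" "\<lambda>(r, K).
        (hd K # r, tl K)"])
       (auto simp: P' \<phi>1_def pick_sum_cmult simp del: power_Suc elim!: idx_SucE)
  with 1 have 3: "((\<lambda>(r, K). pick_sum (\<lambda>y Y. \<phi> r y (hd K # Y)) (tl K) * mon (x # I) K)
      has_sum pick_sum (\<lambda>y Y. s y (x # Y)) I) (P \<times> idx (Suc (length I)))"
    by blast
  have "((\<lambda>(r, K). pick_sum (\<phi> r) K * mon (x # I) K)
      has_sum pick_sum s (x # I)) (P \<times> idx (length (x # I))) \<longleftrightarrow>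
     ((\<lambda>z. (case z of (r, K) \<Rightarrow> \<phi> r (hd K) (tl K) * mon (x # I) K)
         + (case z of (r, K) \<Rightarrow> pick_sum (\<lambda>y Y. \<phi> r y (hd K # Y)) (tl K) * mon (x # I) K))
       has_sum pick_sum s (x # I)) (P \<times> idx (Suc (length I)))"
    by (rule has_sum_cong[THEN trans]) (auto simp: algebra_simps elim!: idx_SucE)
  then show ?case using has_sum_add[OF 2 3] by simp
qed

text \<open>Products x^-(a+1) x^-(b+1) are collected by their exponent \<open>Suc k\<close> with
  \<open>k = Suc (a + b)\<close>; no pair belongs to \<open>k = 0\<close>, where the inner sum is
  empty.\<close>

lemma has_sum_group_add:
  fixes f :: "nat \<Rightarrow> nat \<Rightarrow> 'a \<Rightarrow> complex"
  assumes "((\<lambda>(a, b, z). f a b z) has_sum s) (UNIV \<times> UNIV \<times> Z)"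
  shows "((\<lambda>(k, z). \<Sum>a<k. f a (k - 1 - a) z) has_sum s) (UNIV \<times> Z)"
proof (rule has_sum_SigmaD[where B = "\<lambda>(k, z). {..<k}" and f = "\<lambda>((k, z), a). f a (k - 1 - a) z"])
  show "((\<lambda>((k, z), a). f a (k - 1 - a) z) has_sum s) (Sigma (UNIV \<times> Z) (\<lambda>(k, z). {..<k}))"
    by (subst has_sum_reindex_bij_witness[of _ "\<lambda>(a, b, z). ((Suc (a + b), z), a)" "\<lambda>((k, z), a).
        (a, k - 1 - a, z)"
          _ "\<lambda>(a, b, z). f a b z"])
       (use assms in auto)
  show "((\<lambda>y. case (x, y) of (x, xa) \<Rightarrow> (case x of (k, z) \<Rightarrow> \<lambda>a. f a (k - 1 - a) z) xa) has_sum
          (case x of (k, z) \<Rightarrow> \<Sum>a<k. f a (k - 1 - a) z)) (case x of (k, z) \<Rightarrow> {..<k})" for x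
    by (cases x) (auto intro!: has_sum_finiteI)
qed

section \<open>Series convergent outside the disc of radius 2 sqrt T and their derivatives\<close>

definition ext_disc :: "real \<Rightarrow> complex set" where
  "ext_disc T = {x. 2 * sqrt T < cmod x}"

definition good :: "real \<Rightarrow> nat \<Rightarrow> (nat list \<Rightarrow> complex) \<Rightarrow> bool" where
  "good T n a \<longleftrightarrow> (\<forall>q. length q = n \<longrightarrow> set q \<subseteq> ext_disc T \<longrightarrow> (\<lambda>K. a K * mon q K) summable_on idx n)"

text \<open>Minus the derivative of \<open>ev a\<close> in the first argument, term by term. The
  sign keeps the numerical factors positive and returns as \<open>- hbar\<close> in the loop
  equation.\<close>

definition neg_deriv :: "(nat list \<Rightarrow> complex) \<Rightarrow> complex \<Rightarrow> complex list \<Rightarrow> complex" where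
  "neg_deriv a x I = (\<Sum>\<^sub>\<infinity>(k, K)\<in>UNIV \<times> idx (length I). of_nat (Suc k) * a (k # K) * ((1 / x) ^ (k
      + 2) * mon I K))"

text \<open>One factor \<open>Suc k\<close> will come from differentiation, the other from the
  number of terms in a divided difference. The bound is the square of the convergent sequence n
  (sqrt c)^n.\<close>

lemma square_geometric_bounded:
  fixes c :: real assumes "0 \<le> c" "c < 1"
  obtains B where "\<And>k. (real (Suc k))\<^sup>2 * c ^ Suc k \<le> B"
proof -
  have "(\<lambda>n. of_nat n * sqrt c ^ n) \<longlonglongrightarrow> 0" by (rule powser_times_n_limit_0) (use assms in auto)
  then have "Bseq (\<lambda>n. of_nat n * sqrt c ^ n)" by (rule convergent_imp_Bseq[OF convergentI])
  then obtain B where B: "\<And>n. norm (of_nat n * sqrt c ^ n) \<le> B" by (auto simp: Bseq_def)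
  have "(real n)\<^sup>2 * c ^ n \<le> B\<^sup>2" for n
  proof -
    have "(real n)\<^sup>2 * c ^ n = (of_nat n * sqrt c ^ n)\<^sup>2"
      using assms by (simp add: power_mult_distrib power2_eq_square flip: power_mult_distrib)
    also have "\<dots> \<le> B\<^sup>2" using B[of n] by (simp add: abs_le_square_iff[symmetric])
    finally show ?thesis .
  qed
  then show ?thesis using that by blast
qed

text \<open>For u = 1/x and v = 1/s this is the derivative in s of (x^-(m+1) - s^-(m+1)) / (x - s),
  cleared of denominators. The induction rests on S(m+1) = v S(m) + G(m+1) with a geometric sum
  \<open>G\<close>.\<close>

lemma divided_difference_identity:
  fixes u v :: complex
  shows "(\<Sum>k\<le>m. of_nat (Suc m - k) * (u ^ Suc k * v ^ Suc (Suc m - k))) * (v - u)\<^sup>2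
     = of_nat (Suc m) * v ^ (m + 3) * u * (v - u) + u\<^sup>2 * v\<^sup>2 * (u ^ Suc m - v ^ Suc m)"
proof (induction m)
  case 0
  show ?case by (simp add: power2_eq_square power3_eq_cube algebra_simps)
next
  case (Suc m)
  define S where "S m = (\<Sum>k\<le>m. of_nat (Suc m - k) * (u ^ Suc k * v ^ Suc (Suc m - k)))" for m
  define G where "G m = (\<Sum>k\<le>m. u ^ Suc k * v ^ Suc (Suc m - k))" for m
  have G: "G m * (v - u) = u * v\<^sup>2 * (v ^ Suc m - u ^ Suc m)" for m
  proof (induction m)
    case (Suc m)
    have "G (Suc m) = v * G m + u ^ Suc (Suc m) * v\<^sup>2"
      by (simp add: G_def sum_distrib_left Suc_diff_le power2_eq_square ac_simps)
    then have "G (Suc m) * (v - u) = v * (G m * (v - u)) + u ^ Suc (Suc m) * v\<^sup>2 * (v - u)"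
        by (simp add: algebra_simps)
    then show ?case unfolding Suc.IH by (simp add: algebra_simps power2_eq_square)
  qed (simp add: G_def power2_eq_square algebra_simps)
  have "S (Suc m) = v * S m + G (Suc m)"
  proof -
    have "S (Suc m) = (\<Sum>k\<le>m. of_nat (Suc (Suc m) - k) * (u ^ Suc k * v ^ Suc (Suc (Suc m) - k)))
        + u ^ Suc (Suc m) * v\<^sup>2"
      by (simp add: S_def power2_eq_square)
    also have "(\<Sum>k\<le>m. of_nat (Suc (Suc m) - k) * (u ^ Suc k * v ^ Suc (Suc (Suc m) - k))) =
      (\<Sum>k\<le>m. v * (of_nat (Suc m - k) * (u ^ Suc k * v ^ Suc (Suc m - k)))
          + u ^ Suc k * v ^ Suc (Suc (Suc m) - k))"
      by (rule sum.cong) (auto simp: Suc_diff_le algebra_simps simp del: of_nat_diff)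
    also have "\<dots> + u ^ Suc (Suc m) * v\<^sup>2 = v * S m + G (Suc m)"
      by (simp add: S_def G_def sum.distrib sum_distrib_left power2_eq_square)
    finally show ?thesis .
  qed
  then have "S (Suc m) * (v - u)\<^sup>2 = v * (S m * (v - u)\<^sup>2) + (G (Suc m) * (v - u)) * (v - u)"
    by (simp add: algebra_simps power2_eq_square)
  also have "\<dots> = v * (of_nat (Suc m) * v ^ (m + 3) * u * (v - u)
      + u\<^sup>2 * v\<^sup>2 * (u ^ Suc m - v ^ Suc m))
        + u * v\<^sup>2 * (v ^ Suc (Suc m) - u ^ Suc (Suc m)) * (v - u)"
    unfolding G using Suc.IH by (simp add: S_def)
  also have "\<dots> = of_nat (Suc (Suc m)) * v ^ (Suc m + 3) * u * (v - u)
      + u\<^sup>2 * v\<^sup>2 * (u ^ Suc (Suc m) - v ^ Suc (Suc m))"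
    by (simp add: algebra_simps power2_eq_square power3_eq_cube power_add numeral_eq_Suc)
  finally show ?case by (simp only: S_def)
qed


context
  fixes T :: real
  assumes T_pos: "0 < T"
begin

lemma ext_disc_pos: "x \<in> ext_disc T \<Longrightarrow> 0 < cmod x"
  using T_pos by (auto simp: ext_disc_def intro: le_less_trans[of 0 "2 * sqrt T"])

lemma ext_disc_dense:
  assumes "x \<in> ext_disc T"
  obtains y where "2 * sqrt T < y" "y < cmod x" "0 < y" "complex_of_real y \<in> ext_disc T"
proof -
  obtain y where y: "2 * sqrt T < y" "y < cmod x" using assms dense by (auto simp: ext_disc_def)
  moreover have "0 < y" using T_pos y(1) by (intro le_less_trans[of 0 "2 * sqrt T"]) auto
  ultimately show ?thesis using that by (auto simp: ext_disc_def)
qed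

lemma has_sum_ev:
  assumes "good T (length q) a" "set q \<subseteq> ext_disc T"
  shows "((\<lambda>K. a K * mon q K) has_sum ev a q) (idx (length q))"
  using assms unfolding good_def ev_def by auto

lemma has_sum_ev_Cons:
  assumes "good T (Suc (length I)) a" "x \<in> ext_disc T" "set I \<subseteq> ext_disc T"
  shows "((\<lambda>(k, K). a (k # K) * ((1 / x) ^ Suc k * mon I K))
      has_sum ev a (x # I)) (UNIV \<times> idx (length I))"
  using has_sum_ev[of "x # I" a] assms by (simp add: has_sum_idx_Suc[symmetric])

text \<open>Convergence also holds at a real point \<open>y\<close> between 2 sqrt T and
  \<open>cmod x\<close>; the geometric factor in \<open>y / cmod x\<close> absorbs the polynomial
  one.\<close>

lemma good_summable_square:
  assumes "good T (Suc (length I)) a" "x \<in> ext_disc T" "set I \<subseteq> ext_disc T"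
  shows "(\<lambda>(k, K). (real (Suc k))\<^sup>2 * (cmod (a (k # K)) * ((1 / cmod x) ^ Suc k * cmod
      (mon I K)))) summable_on (UNIV \<times> idx (length I))"
proof -
  obtain y where y: "2 * sqrt T < y" "y < cmod x" "0 < y" "complex_of_real y \<in> ext_disc T"
    using ext_disc_dense[OF assms(2)] by blast
  obtain B where B: "\<And>k. (real (Suc k))\<^sup>2 * (y / cmod x) ^ Suc k \<le> B"
    by (rule square_geometric_bounded[of "y / cmod x"]) (use y ext_disc_pos[OF assms(2)] in auto)
  have "(\<lambda>(k, K). a (k # K) * ((1 / complex_of_real y) ^ Suc k * mon I K))
      summable_on UNIV \<times> idx (length I)"
    using has_sum_ev_Cons[OF assms(1) y(4) assms(3)] by (rule has_sum_imp_summable)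
  then have "(\<lambda>z. norm ((\<lambda>(k, K). a (k # K) * ((1 / complex_of_real y) ^ Suc k * mon I K)) z))
      summable_on UNIV \<times> idx (length I)"
    by (simp only: summable_on_iff_abs_summable_on_complex)
  then have "(\<lambda>z. B * norm ((\<lambda>(k, K). a (k # K) * ((1 / complex_of_real y) ^ Suc k * mon I K)) z))
      summable_on UNIV \<times> idx (length I)"
    by (rule summable_on_cmult_right)
  then show ?thesis
  proof (rule summable_on_comparison_test, goal_cases)
    case (1 z)
    obtain k K where z: "z = (k, K)" by (cases z)
    have "(real (Suc k))\<^sup>2 * (1 / cmod x) ^ Suc k
        = (real (Suc k))\<^sup>2 * (y / cmod x) ^ Suc k * (1 / y) ^ Suc k"
      using y by (simp add: field_simps power_divide)
    also have "\<dots> \<le> B * (1 / y) ^ Suc k" using B[of k] y by (intro mult_right_mono) auto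
    finally have "(real (Suc k))\<^sup>2 * (1 / cmod x) ^ Suc k * (cmod (a (k # K)) * cmod (mon I K))
        \<le> B * (1 / y) ^ Suc k * (cmod (a (k # K)) * cmod (mon I K))"
      by (rule mult_right_mono) auto
    then show ?case using y
        by (simp add: z norm_mult norm_divide norm_power ac_simps del: power_Suc of_nat_Suc)
  qed (auto intro!: mult_nonneg_nonneg)
qed

lemma has_sum_neg_deriv:
  assumes "good T (Suc (length I)) a" "x \<in> ext_disc T" "set I \<subseteq> ext_disc T"
  shows "((\<lambda>(k, K). of_nat (Suc k) * a (k # K) * ((1 / x) ^ (k + 2) * mon I K))
      has_sum neg_deriv a x I) (UNIV \<times> idx (length I))"
proof -
  have "(\<lambda>z. 1 / cmod x * (\<lambda>(k, K). (real (Suc k))\<^sup>2 * (cmod (a (k # K)) * ((1 / cmod x) ^ Suc k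
      * cmod (mon I K)))) z) summable_on (UNIV \<times> idx (length I))"
    by (rule summable_on_cmult_right[OF good_summable_square[OF assms]])
  then have "(\<lambda>z. norm ((\<lambda>(k, K). of_nat (Suc k) * a (k # K) * ((1 / x) ^ (k + 2) * mon I K)) z))
      summable_on (UNIV \<times> idx (length I))"
  proof (rule summable_on_comparison_test, goal_cases)
    case (1 z)
    obtain k K where z: "z = (k, K)" by (cases z)
    have "real (Suc k) * ((1 / cmod x) ^ (k+2) * (cmod (a (k # K)) * cmod (mon I K)))
        \<le> (real (Suc k))\<^sup>2 * ((1 / cmod x) ^ (k+2) * (cmod (a (k # K)) * cmod (mon I K)))"
      by (intro mult_right_mono) (auto simp: power2_eq_square)
    then show ?case by (simp add: z norm_mult norm_divide norm_power ac_simps del: of_nat_Suc)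
  qed auto
  then show ?thesis unfolding neg_deriv_def
    by (intro has_sum_infsum) (simp only: summable_on_iff_abs_summable_on_complex)
qed

text \<open>Summation over the remaining indices leaves a power series \<open>H\<close> in u = 1/t
  without constant term. It is differentiated inside its disc of convergence, and the chain rule
  contributes the factor -1/x^2.\<close>

lemma ev_has_field_derivative:
  assumes "good T (Suc (length I)) a" "x \<in> ext_disc T" "set I \<subseteq> ext_disc T"
  shows "((\<lambda>t. ev a (t # I)) has_field_derivative - neg_deriv a x I) (at x)"
proof -
  define C where "C k = (\<Sum>\<^sub>\<infinity>K\<in>idx (length I). a (k # K) * mon I K)" for k
  define c where "c n = (case n of 0 \<Rightarrow> 0 | Suc k \<Rightarrow> C k)" for n
  have inner: "(\<Sum>\<^sub>\<infinity>K\<in>idx (length I). w * a (k # K) * (v * mon I K)) = w * C k * v" for w v k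
    unfolding C_def by (subst infsum_cmult_right'[symmetric], subst infsum_cmult_left'[symmetric])
        (simp add: ac_simps)
  have sums: "(\<lambda>k. w k * C k * v k) sums S"
    if "((\<lambda>(k, K). w k * a (k # K) * (v k * mon I K)) has_sum S) (UNIV \<times> idx (length I))" for w v S
  proof -
    have "(\<lambda>(k, K). w k * a (k # K) * (v k * mon I K)) summable_on UNIV \<times> idx (length I)"
      using that by (rule has_sum_imp_summable)
    then have *: "(\<lambda>K. w k * a (k # K) * (v k * mon I K)) summable_on idx (length I)" for k
      by (rule summable_on_SigmaD1) auto
    have "((\<lambda>k. w k * C k * v k) has_sum S) UNIV"
      by (rule has_sum_SigmaD[OF that]) (use has_sum_infsum[OF *] inner in auto)
    then show ?thesis by (rule has_sum_imp_sums)
  qed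
  have c_sums: "(\<lambda>n. c n * (1 / t) ^ n) sums ev a (t # I)" if "t \<in> ext_disc T" for t
  proof -
    have "(\<lambda>k. 1 * C k * (1 / t) ^ Suc k) sums ev a (t # I)"
      by (rule sums) (use has_sum_ev_Cons[OF assms(1) that assms(3)] in simp)
    then have "(\<lambda>k. c (Suc k) * (1 / t) ^ Suc k) sums ev a (t # I)" by (simp add: c_def)
    then show ?thesis by (subst (asm) sums_Suc_iff) (simp add: c_def)
  qed
  have x0: "x \<noteq> 0" using ext_disc_pos[OF assms(2)] by auto
  obtain y where y: "2 * sqrt T < y" "y < cmod x" "0 < y" "complex_of_real y \<in> ext_disc T"
    using ext_disc_dense[OF assms(2)] by blast
  define H where "H u = (\<Sum>n. c n * u ^ n)" for u
  have "(H has_field_derivative (\<Sum>n. diffs c n * (1 / x) ^ n)) (at (1 / x))"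
    unfolding H_def
    by (rule termdiffs_strong[where K = "1 / complex_of_real y"])
       (use c_sums[OF y(4)] y x0 in \<open>auto simp: sums_iff norm_divide field_simps\<close>)
  moreover have "(\<Sum>n. diffs c n * (1 / x) ^ n) = neg_deriv a x I * x\<^sup>2"
  proof -
    have "(\<lambda>k. of_nat (Suc k) * C k * (1 / x) ^ (k + 2)) sums neg_deriv a x I"
      by (rule sums) (use has_sum_neg_deriv[OF assms(1-3)] in simp)
    then have "(\<lambda>k. of_nat (Suc k) * C k * (1 / x) ^ (k + 2) * x\<^sup>2) sums (neg_deriv a x I * x\<^sup>2)"
      by (rule sums_mult2)
    moreover have "of_nat (Suc k) * C k * (1 / x) ^ (k + 2) * x\<^sup>2 = diffs c k * (1 / x) ^ k" for k
      using x0 by (simp add: diffs_def c_def power_add power2_eq_square)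
    ultimately show ?thesis by (simp add: sums_iff)
  qed
  ultimately have H: "(H has_field_derivative (neg_deriv a x I * x\<^sup>2)) (at (1 / x))" by simp
  have "((\<lambda>t. H (1 / t)) has_field_derivative (neg_deriv a x I * x\<^sup>2) * (- (1 / x\<^sup>2))) (at x)"
    by (rule DERIV_chain2[where f = H and g
        = "\<lambda>t. 1 / t", OF H]) (use x0 in \<open>auto intro!: derivative_eq_intros simp: power2_eq_square\<close>)
  then have "((\<lambda>t. H (1 / t)) has_field_derivative - neg_deriv a x I) (at x)" using x0 by simp
  moreover have "open (ext_disc T)" unfolding ext_disc_def
      by (intro open_Collect_less continuous_intros)
  moreover have "H (1 / t) = ev a (t # I)" if "t \<in> ext_disc T" for t
    using c_sums[OF that] by (simp add: H_def sums_iff)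
  ultimately show ?thesis
    using has_field_derivative_transform_within_open[of "\<lambda>t. H (1 / t)" "- neg_deriv a x I" x
        "ext_disc T"] assms(2) by simp
qed

end

section \<open>Differentiated divided differences as series that are regular on the diagonal\<close>

definition divdiff :: "(nat list \<Rightarrow> complex) \<Rightarrow> complex \<Rightarrow> complex \<Rightarrow> complex list \<Rightarrow> complex" where
  "divdiff a x s Y = (\<Sum>\<^sub>\<infinity>(k, j, J)\<in>UNIV \<times> UNIV \<times> idx (length Y).
      of_nat j * a ((k + j - 1) # J) * ((1 / x) ^ Suc k * ((1 / s) ^ Suc j * mon Y J)))"

context
  fixes T :: real
  assumes T_pos: "0 < T"
begin

text \<open>The terms are regrouped by the index \<open>m = k + j - 1\<close> of their coefficient,
  so that \<open>j = Suc m - k\<close>. Terms with \<open>j = 0\<close> have the factor zero and are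
  dropped before the change of index.\<close>

lemma has_sum_divdiff_iff:
  "((\<lambda>(k, j, J). of_nat j * a ((k + j - 1) # J) * ((1 / x) ^ Suc k * ((1 / s) ^ Suc j * mon Y J)))
      has_sum S)
      (UNIV \<times> UNIV \<times> idx m) \<longleftrightarrow>
   ((\<lambda>((m, J), k). of_nat (Suc m - k) * a (m # J) * ((1 / x) ^ Suc k * ((1 / s) ^ Suc (Suc m - k)
       * mon Y J))) has_sum S)
      (Sigma (UNIV \<times> idx m) (\<lambda>(m, J). {..m}))"
  (is "(?f has_sum S) ?A \<longleftrightarrow> (?g has_sum S) ?B")
proof -
  have "(?f has_sum S) ?A \<longleftrightarrow> (?f has_sum S) (UNIV \<times> {0<..} \<times> idx m)"
    by (rule has_sum_cong_neutral) auto
  also have "\<dots> \<longleftrightarrow> (?g has_sum S) ?B"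
    by (rule has_sum_reindex_bij_witness[of _ "\<lambda>((m, J), k). (k, Suc m - k, J)" "\<lambda>(k, j, J). ((k
        + j - 1, J), k)"])
       (auto simp del: of_nat_diff)
  finally show ?thesis .
qed

text \<open>Both moduli are replaced by their minimum \<mu>. The \<open>m + 1\<close> terms sharing
  the coefficient \<open>a (m # J)\<close> have factors of at most \<open>m + 1\<close>, which gives
  the square.\<close>

lemma summable_divdiff:
  assumes "good T (Suc (length Y)) a" "x \<in> ext_disc T" "s \<in> ext_disc T" "set Y \<subseteq> ext_disc T"
  shows "(\<lambda>((m, J), k). of_nat (Suc m - k) * a (m # J) * ((1 / x) ^ Suc k *
      ((1 / s) ^ Suc (Suc m - k) * mon Y J)))
     summable_on (Sigma (UNIV \<times> idx (length Y)) (\<lambda>(m, J). {..m}))"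
    (is "?g summable_on _")
proof -
  define \<mu> where "\<mu> = min (cmod x) (cmod s)"
  have \<mu>: "0 < \<mu>" "\<mu> \<le> cmod x" "\<mu> \<le> cmod s" "complex_of_real \<mu> \<in> ext_disc T"
    using ext_disc_pos[OF T_pos] assms(2,3) by (auto simp: \<mu>_def ext_disc_def min_def)
  have "(\<lambda>z. (1 / \<mu>)\<^sup>2 * (\<lambda>(k, K). (real (Suc k))\<^sup>2 * (cmod (a (k # K)) *
      ((1 / cmod (complex_of_real \<mu>)) ^ Suc k * cmod (mon Y K)))) z)
      summable_on (UNIV \<times> idx (length Y))"
    by (rule summable_on_cmult_right[OF good_summable_square[OF T_pos assms(1) \<mu>(4) assms(4)]])
  then have "(\<lambda>(m, J). \<Sum>k\<le>m. norm (?g ((m, J), k))) summable_on (UNIV \<times> idx (length Y))"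
  proof (rule summable_on_comparison_test, goal_cases)
    case (1 z)
    obtain m J where z: "z = (m, J)" by (cases z)
    have "(\<Sum>k\<le>m. norm (?g ((m, J), k)))
        \<le> (\<Sum>k\<le>m. real (Suc m) * (cmod (a (m # J)) * ((1 / \<mu>) ^ (m + 3) * cmod (mon Y J))))"
    proof (rule sum_mono)
      fix k assume k: "k \<in> {..m}"
      have "(1 / cmod x) ^ Suc k * (1 / cmod s) ^ Suc (Suc m - k)
          \<le> (1 / \<mu>) ^ Suc k * (1 / \<mu>) ^ Suc (Suc m - k)"
        using \<mu> ext_disc_pos[OF T_pos assms(2)] ext_disc_pos[OF T_pos assms(3)]
        by (intro mult_mono power_mono divide_left_mono mult_pos_pos) auto
      also have "\<dots> = (1 / \<mu>) ^ (Suc k + Suc (Suc m - k))" by (simp only: power_add)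
      also have "Suc k + Suc (Suc m - k) = m + 3" using k by simp
      finally have "real (Suc m - k) * (cmod (a (m # J)) *
          (((1 / cmod x) ^ Suc k * (1 / cmod s) ^ Suc (Suc m - k)) * cmod (mon Y J)))
        \<le> real (Suc m) * (cmod (a (m # J)) * ((1 / \<mu>) ^ (m + 3) * cmod (mon Y J)))"
        using \<mu>(1) by (intro mult_mono mult_nonneg_nonneg) auto
      then show "norm (?g ((m, J), k))
          \<le> real (Suc m) * (cmod (a (m # J)) * ((1 / \<mu>) ^ (m + 3) * cmod (mon Y J)))"
        by (simp add: norm_mult norm_divide norm_power ac_simps del: power_Suc of_nat_Suc
            of_nat_diff)
    qed
    also have "\<dots>
        = (1 / \<mu>)\<^sup>2 * ((real (Suc m))\<^sup>2 * (cmod (a (m # J)) * ((1 / \<mu>) ^ Suc m * cmod (mon Y J))))"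
    proof -
      have "(1 / \<mu>) ^ (m + 3) = (1 / \<mu>)\<^sup>2 * (1 / \<mu>) ^ Suc m" by (simp add: numeral_eq_Suc)
      then show ?thesis by (simp add: power2_eq_square ac_simps del: power_Suc)
    qed
    finally show ?case using \<mu>(1) by (simp add: z del: power_Suc of_nat_Suc)
  qed (auto intro: sum_nonneg)
  then have "(\<lambda>z. norm (?g z)) summable_on (Sigma (UNIV \<times> idx (length Y)) (\<lambda>(m, J). {..m}))"
    by (intro summable_on_SigmaI[where g = "\<lambda>(m, J). \<Sum>k\<le>m. norm (?g ((m, J), k))"])
       (auto intro!: has_sum_finiteI)
  then show ?thesis by (simp only: summable_on_iff_abs_summable_on_complex)
qed

lemma has_sum_divdiff:
  assumes "good T (Suc (length Y)) a" "x \<in> ext_disc T" "s \<in> ext_disc T" "set Y \<subseteq> ext_disc T"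
  shows "((\<lambda>(k, j, J). of_nat j * a ((k
      + j - 1) # J) * ((1 / x) ^ Suc k * ((1 / s) ^ Suc j * mon Y J))) has_sum divdiff a x s Y)
      (UNIV \<times> UNIV \<times> idx (length Y))"
  unfolding divdiff_def using summable_divdiff[OF assms] has_sum_divdiff_iff
  by (intro has_sum_infsum) (auto simp: summable_on_def)

text \<open>The right side is the derivative in \<open>s\<close> of the difference quotient of
  \<open>ev a\<close>, by the quotient rule. The comparison is made for each coefficient
  \<open>a (m # J)\<close> with the identity above.\<close>

lemma divdiff_eq:
  assumes "good T (Suc (length Y)) a" "x \<in> ext_disc T" "s \<in> ext_disc T" "set Y \<subseteq> ext_disc T" "x \<noteq> s"
  shows "divdiff a x s Y = (neg_deriv a s Y * (x - s) + (ev a (x # Y) - ev a (s # Y))) / (x - s)\<^sup>2"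
proof -
  have nz: "x \<noteq> 0" "s \<noteq> 0" using ext_disc_pos[OF T_pos] assms(2,3) by fastforce+
  define g where "g
      = (\<lambda>(m, J). a (m # J) * mon Y J * (\<Sum>k\<le>m. of_nat (Suc m - k) * ((1 / x) ^ Suc k *
        (1 / s) ^ Suc (Suc m - k))))"
  have "((\<lambda>((m, J), k). of_nat (Suc m - k) * a (m # J) * ((1 / x) ^ Suc k *
      ((1 / s) ^ Suc (Suc m - k) * mon Y J))) has_sum divdiff a x s Y)
      (Sigma (UNIV \<times> idx (length Y)) (\<lambda>(m, J). {..m}))"
    using has_sum_divdiff[OF assms(1-4)] by (simp only: has_sum_divdiff_iff)
  then have 1: "(g has_sum divdiff a x s Y) (UNIV \<times> idx (length Y))"
    by (rule has_sum_SigmaD)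
       (auto intro!:
           has_sum_finiteI simp: g_def sum_distrib_left ac_simps simp del: power_Suc of_nat_diff)
  have "((\<lambda>z. ((\<lambda>(k, K). of_nat (Suc k) * a (k # K) * ((1 / s) ^ (k + 2) * mon Y K)) z * (x - s)
       + ((\<lambda>(k, K). a (k # K) * ((1 / x) ^ Suc k * mon Y K)) z
         - (\<lambda>(k, K). a (k # K) * ((1 / s) ^ Suc k * mon Y K)) z)) / (x - s)\<^sup>2)
     has_sum (neg_deriv a s Y * (x - s) + (ev a (x # Y) - ev a (s # Y))) / (x - s)\<^sup>2)
         (UNIV \<times> idx (length Y))"
    unfolding diff_conv_add_uminus[of "_::complex" "ev a (s # Y)"] diff_conv_add_uminus[of _
        "(\<lambda>(k, K). a (k # K) * ((1 / s) ^ Suc k * mon Y K)) _"]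
    by (intro has_sum_divide_const has_sum_add has_sum_cmult_left has_sum_uminusI
        has_sum_neg_deriv[OF T_pos] has_sum_ev_Cons[OF T_pos] assms)
  moreover have "((\<lambda>(k, K). of_nat (Suc k) * a (k # K) * ((1 / s) ^ (k + 2) * mon Y K)) z * (x - s)
       + ((\<lambda>(k, K). a (k # K) * ((1 / x) ^ Suc k * mon Y K)) z
         - (\<lambda>(k, K). a (k # K) * ((1 / s) ^ Suc k * mon Y K)) z)) / (x - s)\<^sup>2 = g z" for z
  proof -
    obtain m J where z: "z = (m, J)" by (cases z)
    define u v where "u = 1 / x" and "v = 1 / s"
    have uv: "x - s = (v - u) / (u * v)" "u \<noteq> 0" "v \<noteq> 0" "v \<noteq> u"
      using nz assms(5) by (auto simp: u_def v_def field_simps)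
    define S where "S = (\<Sum>k\<le>m. of_nat (Suc m - k) * (u ^ Suc k * v ^ Suc (Suc m - k)))"
    have "S = (of_nat (Suc m) * v ^ (m + 3) * u * (v - u)
        + u\<^sup>2 * v\<^sup>2 * (u ^ Suc m - v ^ Suc m)) / (v - u)\<^sup>2"
      using divided_difference_identity[of m u v] uv
          by (simp add: S_def field_simps del: power_Suc of_nat_diff)
    also have "\<dots> = (of_nat (Suc m) * v ^ (m + 2) * (x - s) + (u ^ Suc m - v ^ Suc m)) / (x - s)\<^sup>2"
    proof -
      have e: "v ^ (m + 3) = v ^ (m + 2) * v" by (simp add: numeral_eq_Suc)
      have "(c * (p * v) * u * d + u\<^sup>2 * v\<^sup>2 * r) / d\<^sup>2 = (c * p * (d / (u * v))
          + r) / (d / (u * v))\<^sup>2"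
        if "d \<noteq> 0" for c p d r :: complex
        using that uv(2,3) by (simp add: field_simps power2_eq_square)
      then show ?thesis unfolding uv(1) e using uv(4) by simp
    qed
    finally have S: "S = \<dots>" .
    have "g z = a (m # J) * mon Y J * S" by (simp add: z g_def S_def u_def v_def)
    then show ?thesis unfolding S z by (simp add: u_def v_def field_simps del: power_Suc of_nat_Suc)
  qed
  ultimately have "(g has_sum (neg_deriv a s Y * (x - s)
      + (ev a (x # Y) - ev a (s # Y))) / (x - s)\<^sup>2) (UNIV \<times> idx (length Y))"
    by simp
  with 1 show ?thesis by (rule has_sum_unique)
qed

lemma has_sum_neg_deriv_shift:
  assumes "good T (Suc (length I)) a" "x \<in> ext_disc T" "set I \<subseteq> ext_disc T"
  shows "((\<lambda>(k, K). of_nat k * a ((k - 1) # K) * ((1 / x) ^ Suc k * mon I K))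
      has_sum neg_deriv a x I) (UNIV \<times> idx (length I))"
    (is "(?f has_sum _) _")
proof -
  have "(?f has_sum neg_deriv a x I) (UNIV \<times> idx (length I))
      \<longleftrightarrow> (?f has_sum neg_deriv a x I) ({0<..} \<times> idx (length I))"
    by (rule has_sum_cong_neutral) auto
  also have "\<dots> \<longleftrightarrow> ((\<lambda>(k, K). of_nat (Suc k) * a (k # K) * ((1 / x) ^ (k + 2) * mon I K))
      has_sum neg_deriv a x I) (UNIV \<times> idx (length I))"
    by (rule has_sum_reindex_bij_witness[of _ "\<lambda>(k, K). (Suc k, K)" "\<lambda>(k, K). (k - 1, K)"])
        (auto simp: gr0_conv_Suc)
  finally show ?thesis using has_sum_neg_deriv[OF T_pos assms] by simp
qed

lemma has_sum_diagonal:
  assumes "good T (Suc (Suc (length I))) a" "x \<in> ext_disc T" "set I \<subseteq> ext_disc T"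
  shows "((\<lambda>(k, K). (\<Sum>i<k. a (i # (k - 1 - i) # K)) * ((1 / x) ^ Suc k * mon I K))
      has_sum ev a (x # x # I)) (UNIV \<times> idx (length I))"
proof -
  define f where "f i j K
      = a (i # j # K) * ((1 / x) ^ Suc i * ((1 / x) ^ Suc j * mon I K))" for i j K
  have "((\<lambda>K. a K * mon (x # x # I) K) has_sum ev a (x # x # I)) (idx (length (x # x # I)))"
    by (rule has_sum_ev[OF T_pos]) (use assms in auto)
  moreover have "((\<lambda>(i, j, K). f i j K) has_sum ev a (x # x # I)) (UNIV \<times> UNIV \<times> idx (length I)) \<longleftrightarrow>
     ((\<lambda>K. a K * mon (x # x # I) K) has_sum ev a (x # x # I)) (idx (length (x # x # I)))"
    by (rule has_sum_reindex_bij_witness[of _ "\<lambda>K. (hd K, hd (tl K), tl (tl K))"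
        "\<lambda>(i, j, K). i # j # K"])
       (auto simp: f_def elim!: idx_SucE)
  ultimately have "((\<lambda>(k, K). \<Sum>i<k. f i (k - 1 - i) K)
      has_sum ev a (x # x # I)) (UNIV \<times> idx (length I))"
    by (intro has_sum_group_add) simp
  moreover have "(\<Sum>i<k. f i (k - 1 - i) K)
      = (\<Sum>i<k. a (i # (k - 1 - i) # K)) * ((1 / x) ^ Suc k * mon I K)" for k K
    unfolding sum_distrib_right
  proof (rule sum.cong[OF refl])
    fix i assume "i \<in> {..<k}"
    then have "Suc i + Suc (k - 1 - i) = Suc k" by auto
    then have "(1 / x) ^ Suc i * (1 / x) ^ Suc (k - 1 - i) = (1 / x) ^ Suc k" by (metis power_add)
    then show "f i (k - 1 - i) K = a (i # (k - 1 - i) # K) * ((1 / x) ^ Suc k * mon I K)"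
      unfolding f_def by (metis mult.assoc)
  qed
  ultimately show ?thesis by simp
qed

text \<open>The weight \<open>w\<close> depends on lengths alone, so it agrees for a splitting of
  exponents and the matching splitting of points. Factors must converge only where \<open>w\<close>
  is nonzero; this allows the induction to leave out the products that contain the correlator under
  study.\<close>

lemma has_sum_conv:
  fixes w :: "nat \<Rightarrow> nat \<Rightarrow> complex"
  assumes "\<And>A B. mset A + mset B = mset I \<Longrightarrow> w (length A) (length B) \<noteq> 0 \<Longrightarrow>
        good T (Suc (length A)) a \<and> good T (Suc (length B)) b"
    and "x \<in> ext_disc T" "set I \<subseteq> ext_disc T"
  shows "((\<lambda>(k, K). (\<Sum>i<k. split_sum (\<lambda>A B. w (length A) (length B) *
      (a (i # A) * b ((k - 1 - i) # B))) K) * ((1 / x) ^ Suc k * mon I K))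
     has_sum split_sum (\<lambda>A B. w (length A) (length B) * (ev a (x # A) * ev b (x # B))) I)
         (UNIV \<times> idx (length I))"
proof -
  \<comment> \<open>The exponent of \<open>x\<close> is carried by the parameter, as the singleton
    \<open>r = [k]\<close>.\<close>
  define \<phi> where "\<phi>
      = (\<lambda>r A B. \<Sum>i<hd r. (1 / x) ^ Suc (hd r) * (w (length A) (length B) *
        (a (i # A) * b ((hd r - 1 - i) # B))))"
  have "((\<lambda>(r, K). split_sum (\<phi> r) K * mon I K)
      has_sum split_sum (\<lambda>A B. w (length A) (length B) * (ev a (x # A) * ev b (x # B))) I)
          (idx (Suc 0) \<times> idx (length I))"
  proof (rule has_sum_split_sum)
    fix A B assume m: "mset A + mset B = mset I"
    define c where "c = w (length A) (length B)"
    have AB: "set A \<subseteq> ext_disc T" "set B \<subseteq> ext_disc T"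
      using assms(3) m by (metis Un_subset_iff set_mset_mset set_mset_union)+
    define f where "f i j z
        = c * (a (i # fst z) * ((1 / x) ^ Suc i * mon A (fst z)) *
          (b (j # snd z) * ((1 / x) ^ Suc j * mon B (snd z))))" for i j z
    have "((\<lambda>(i, j, z). f i j z)
        has_sum c * (ev a (x # A) * ev b (x # B))) (UNIV \<times> UNIV \<times> (idx (length A) \<times> idx
            (length B)))"
    proof (cases "c = 0")
      case False
      then have "good T (Suc (length A)) a" "good T (Suc (length B)) b" using assms(1)[OF m]
          by (auto simp: c_def)
      from has_sum_cmult_right[OF has_sum_times[OF
          has_sum_ev_Cons[OF T_pos this(1) assms(2) AB(1)]
              has_sum_ev_Cons[OF T_pos this(2) assms(2) AB(2)]], of c]
      show ?thesis
        by (subst has_sum_reindex_bij_witness[of _ "\<lambda>((i, K), (j, L)). (i, j, (K, L))"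
            "\<lambda>(i, j, (K, L)). ((i, K), (j, L))"])
           (auto simp: f_def simp del: power_Suc)
    qed (simp add: f_def case_prod_unfold)
    then have 1: "((\<lambda>(k, z). \<Sum>i<k. f i (k - 1 - i) z)
        has_sum c * (ev a (x # A) * ev b (x # B))) (UNIV \<times> (idx (length A) \<times> idx (length B)))"
      by (rule has_sum_group_add)
    have 2: "\<phi> [k] K L * (mon A K * mon B L)
        = (\<Sum>i<k. f i (k - 1 - i) (K, L))" if "K \<in> idx (length A)" "L \<in> idx (length B)" for k K L
      unfolding \<phi>_def sum_distrib_right list.sel(1)
    proof (rule sum.cong[OF refl])
      fix i assume "i \<in> {..<k}"
      then have "Suc i + Suc (k - 1 - i) = Suc k" by auto
      then have e: "(1 / x) ^ Suc k = (1 / x) ^ Suc i * (1 / x) ^ Suc (k - 1 - i)"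
          by (metis power_add)
      show "(1 / x) ^ Suc k * (w (length K) (length L) * (a (i # K) * b ((k - 1 - i) # L))) *
          (mon A K * mon B L) = f i (k - 1 - i) (K, L)"
        unfolding e f_def c_def using that by (simp add: idx_def ac_simps del: power_Suc)
    qed
    show "((\<lambda>(r, K, L). \<phi> r K L * (mon A K * mon B L))
        has_sum w (length A) (length B) * (ev a (x # A) * ev b (x # B))) (idx (Suc 0) \<times> idx
            (length A) \<times> idx (length B))"
      using 1 unfolding c_def[symmetric]
      by (subst has_sum_reindex_bij_witness[of _ "\<lambda>(k, (K, L)). ([k], K, L)" "\<lambda>(r, K, L).
          (hd r, (K, L))"])
         (auto simp: 2 elim!: idx_SucE)
  qed
  moreover have eq: "split_sum (\<phi> [k]) K * mon I K
      = (\<Sum>i<k. split_sum (\<lambda>A B. w (length A) (length B) * (a (i # A) * b ((k - 1 - i) # B))) K) *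
        ((1 / x) ^ Suc k * mon I K)" for k K
    unfolding \<phi>_def list.sel(1) split_sum_sum split_sum_cmult
    unfolding sum_distrib_left[symmetric] by (simp only: ac_simps)
  ultimately show ?thesis
    by (subst has_sum_reindex_bij_witness[of _ "\<lambda>(r, K). (hd r, K)" "\<lambda>(k, K). ([k], K)"])
       (auto simp: eq simp del: power_Suc elim!: idx_SucE)
qed

lemma has_sum_pick:
  assumes "good T (length I) a" "x \<in> ext_disc T" "set I \<subseteq> ext_disc T"
  shows "((\<lambda>(k, K). pick_sum (\<lambda>j J. of_nat j * a ((k + j - 1) # J)) K * ((1 / x) ^ Suc k * mon I K))
     has_sum pick_sum (\<lambda>s Y. divdiff a x s Y) I) (UNIV \<times> idx (length I))"
proof -
  define \<phi> where "\<phi> = (\<lambda>r j J. (1 / x) ^ Suc (hd r) * (of_nat j * a ((hd r + j - 1) # J)))"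
  have "((\<lambda>(r, K). pick_sum (\<phi> r) K * mon I K)
      has_sum pick_sum (\<lambda>s Y. divdiff a x s Y) I) (idx (Suc 0) \<times> idx (length I))"
  proof (rule has_sum_pick_sum)
    fix s Y assume m: "add_mset s (mset Y) = mset I"
    have l: "length I = Suc (length Y)" using m by (metis size_mset size_add_mset)
    have "set_mset (add_mset s (mset Y)) = set I" using m by simp
    then have "s \<in> ext_disc T" "set Y \<subseteq> ext_disc T" using assms(3) by auto
    then have "((\<lambda>(k, j, J). of_nat j * a ((k
        + j - 1) # J) * ((1 / x) ^ Suc k * ((1 / s) ^ Suc j * mon Y J))) has_sum divdiff a x s Y)
      (UNIV \<times> UNIV \<times> idx (length Y))" using assms l by (intro has_sum_divdiff) auto
    then show "((\<lambda>(r, K). \<phi> r (hd K) (tl K) * mon (s # Y) K)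
        has_sum divdiff a x s Y) (idx (Suc 0) \<times> idx (Suc (length Y)))"
      by (subst has_sum_reindex_bij_witness[of _ "\<lambda>(k, j, J). ([k], j # J)" "\<lambda>(r, K).
          (hd r, hd K, tl K)"])
         (auto simp: \<phi>_def simp del: power_Suc elim!: idx_SucE)
  qed
  then show ?thesis
    by (subst has_sum_reindex_bij_witness[of _ "\<lambda>(r, K). (hd r, K)" "\<lambda>(k, K). ([k], K)"])
       (auto simp: \<phi>_def pick_sum_cmult simp del: power_Suc elim!: idx_SucE)
qed

end

section \<open>Convergence and the loop equation\<close>

lemma split_sum_Nil_left: "split_sum (\<lambda>A B. if A = [] then f A B else 0) K = f [] K"
  by (induction K arbitrary: f) simp_all

lemma split_sum_Nil_right: "split_sum (\<lambda>A B. if B = [] then f A B else 0) K = f K []"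
  using split_sum_Nil_left[of "\<lambda>A B. f B A" K] split_sum_commute[of "\<lambda>A B. if A
      = [] then f B A else 0" K] by simp

lemma sum_triangle_le:
  fixes f g :: "nat \<Rightarrow> real"
  assumes "\<And>i. 0 \<le> f i" "\<And>i. 0 \<le> g i"
  shows "(\<Sum>k<N. \<Sum>a<k. f a * g (k - 1 - a)) \<le> (\<Sum>a<N. f a) * (\<Sum>b<N. g b)"
proof -
  have "(\<Sum>k<N. \<Sum>a<k. f a * g (k - 1 - a))
      = (\<Sum>(k, a)\<in>Sigma {..<N} (\<lambda>k. {..<k}). f a * g (k - 1 - a))"
    by (simp add: sum.Sigma)
  also have "\<dots> = (\<Sum>(a, b)\<in>{(a, b). Suc (a + b) < N}. f a * g b)"
    by (rule sum.reindex_bij_witness[of _ "\<lambda>(a, b). (Suc (a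
        + b), a)" "\<lambda>(k, a). (a, k - 1 - a)"]) auto
  also have "\<dots> \<le> (\<Sum>(a, b)\<in>{..<N} \<times> {..<N}. f a * g b)"
    by (rule sum_mono2) (auto simp: assms)
  also have "\<dots> = (\<Sum>a<N. f a) * (\<Sum>b<N. g b)"
    by (simp add: sum_product sum.cartesian_product)
  finally show ?thesis .
qed

text \<open>With B and R the truncated norms of \<open>b\<close> and \<open>r\<close>, the recursion
  gives B \<le> 2 \<rho>^2 (2T) B + \<rho> R. Truncated sums are finite, so the term with B may be
  moved to the left before convergence is known.\<close>

lemma resolvent_bound:
  fixes b r c :: "nat \<Rightarrow> complex" and \<rho> T :: real
  assumes b: "b 0 = 0" "\<And>k. b (Suc k) = 2 * (\<Sum>a<k. c a * b (k - 1 - a)) + r k"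
    and c: "\<And>N. (\<Sum>a<N. cmod (c a) * \<rho> ^ a) \<le> 2 * T"
    and \<rho>: "0 \<le> \<rho>"
  shows "(1 - 4 * T * \<rho>\<^sup>2) * (\<Sum>k<N. cmod (b k) * \<rho> ^ k) \<le> \<rho> * (\<Sum>k<N. cmod (r k) * \<rho> ^ k)"
proof -
  define B where "B N = (\<Sum>k<N. cmod (b k) * \<rho> ^ k)" for N
  have "cmod (b (Suc k)) * \<rho> ^ Suc k
      \<le> 2 * \<rho>\<^sup>2 * (\<Sum>a<k. (cmod (c a) * \<rho> ^ a) * (cmod (b (k - 1 - a)) * \<rho> ^ (k - 1 - a)))
          + \<rho> * (cmod (r k) * \<rho> ^ k)" for k
  proof -
    have "cmod (b (Suc k)) \<le> 2 * cmod (\<Sum>a<k. c a * b (k - 1 - a)) + cmod (r k)"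
      unfolding b(2) by (rule order.trans[OF norm_triangle_ineq]) (simp add: norm_mult)
    also have "cmod (\<Sum>a<k. c a * b (k - 1 - a)) \<le> (\<Sum>a<k. cmod (c a) * cmod (b (k - 1 - a)))"
      by (rule order.trans[OF norm_sum]) (simp add: norm_mult)
    finally have "cmod (b (Suc k)) * \<rho> ^ Suc k \<le> (2 * (\<Sum>a<k. cmod (c a) * cmod (b (k - 1 - a)))
        + cmod (r k)) * \<rho> ^ Suc k"
      using \<rho> by (intro mult_right_mono) auto
    also have "\<dots> = 2 * (\<Sum>a<k. cmod (c a) * cmod (b (k - 1 - a)) * \<rho> ^ Suc k)
        + \<rho> * (cmod (r k) * \<rho> ^ k)"
      by (simp add: distrib_right sum_distrib_right)
    also have "(\<Sum>a<k. cmod (c a) * cmod (b (k - 1 - a)) * \<rho> ^ Suc k)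
        = \<rho>\<^sup>2 * (\<Sum>a<k. (cmod (c a) * \<rho> ^ a) * (cmod (b (k - 1 - a)) * \<rho> ^ (k - 1 - a)))"
      unfolding sum_distrib_left
    proof (rule sum.cong[OF refl])
      fix a assume "a \<in> {..<k}"
      then have "Suc k = 2 + a + (k - 1 - a)" by auto
      then have e: "\<rho> ^ Suc k = \<rho>\<^sup>2 * \<rho> ^ a * \<rho> ^ (k - 1 - a)" by (metis power_add)
      show "cmod (c a) * cmod (b (k - 1 - a)) * \<rho> ^ Suc k
          = \<rho>\<^sup>2 * ((cmod (c a) * \<rho> ^ a) * (cmod (b (k - 1 - a)) * \<rho> ^ (k - 1 - a)))"
        unfolding e by (simp only: ac_simps)
    qed
    finally show ?thesis by (simp add: ac_simps)
  qed
  then have "(\<Sum>k<N. cmod (b (Suc k)) * \<rho> ^ Suc k)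
      \<le> (\<Sum>k<N. 2 * \<rho>\<^sup>2 * (\<Sum>a<k. (cmod (c a) * \<rho> ^ a) * (cmod (b (k - 1 - a)) * \<rho> ^ (k - 1 - a)))
          + \<rho> * (cmod (r k) * \<rho> ^ k))"
    by (rule sum_mono)
  also have "\<dots>
      = 2 * \<rho>\<^sup>2 * (\<Sum>k<N. \<Sum>a<k. (cmod (c a) * \<rho> ^ a) * (cmod (b (k - 1 - a)) * \<rho> ^ (k - 1 - a)))
        + \<rho> * (\<Sum>k<N. cmod (r k) * \<rho> ^ k)"
    by (simp only: sum.distrib sum_distrib_left)
  also have "(\<Sum>k<N. \<Sum>a<k. (cmod (c a) * \<rho> ^ a) * (cmod (b (k - 1 - a)) * \<rho> ^ (k - 1 - a)))
      \<le> (\<Sum>a<N. cmod (c a) * \<rho> ^ a) * B N"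
    unfolding B_def by (rule sum_triangle_le) (use \<rho> in auto)
  also have "\<dots> \<le> 2 * T * B N" unfolding B_def
      by (intro mult_right_mono c sum_nonneg) (use \<rho> in auto)
  finally have "(\<Sum>k<N. cmod (b (Suc k)) * \<rho> ^ Suc k) \<le> 2 * \<rho>\<^sup>2 * (2 * T * B N)
      + \<rho> * (\<Sum>k<N. cmod (r k) * \<rho> ^ k)"
    by (simp add: mult_left_mono)
  moreover have "(\<Sum>k<N. cmod (b (Suc k)) * \<rho> ^ Suc k) = B (Suc N)"
    unfolding B_def by (subst sum.lessThan_Suc_shift) (simp add: b(1))
  moreover have "B N \<le> B (Suc N)" unfolding B_def using \<rho> by simp
  ultimately show ?thesis unfolding B_def[symmetric] by (simp add: algebra_simps)
qed

lemma has_sum_shift_first: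
  fixes x :: complex
  assumes "((\<lambda>(k, K). b (k # K) * ((1 / x) ^ Suc k * mon I K)) has_sum s) (UNIV \<times> idx m)"
    and "((\<lambda>K. b (0 # K) * mon I K) has_sum s0) (idx m)" "x \<noteq> 0"
  shows "((\<lambda>(k, K). b (Suc k # K) * ((1 / x) ^ Suc k * mon I K)) has_sum x * s - s0) (UNIV \<times> idx m)"
proof -
  define f where "f = (\<lambda>(k, K). b (k # K) * ((1 / x) ^ k * mon I K))"
  define h where "h = (\<lambda>(k::nat, K). if k = 0 then b (0 # K) * mon I K else 0)"
  have f: "(f has_sum x * s) (UNIV \<times> idx m)"
    using has_sum_cmult_right[OF assms(1), of x] assms(3) by (simp add: f_def case_prod_unfold)
  have "(h has_sum s0) (UNIV \<times> idx m) \<longleftrightarrow> (h has_sum s0) ({0} \<times> idx m)"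
    by (rule has_sum_cong_neutral) (auto simp: h_def split: if_splits)
  also have "\<dots> \<longleftrightarrow> ((\<lambda>K. b (0 # K) * mon I K) has_sum s0) (idx m)"
    by (rule has_sum_reindex_bij_witness[of _ "\<lambda>K. (0, K)" snd]) (auto simp: h_def)
  finally have h: "(h has_sum s0) (UNIV \<times> idx m)" using assms(2) by simp
  have "((\<lambda>z. f z + - h z) has_sum x * s + - s0) (UNIV \<times> idx m)"
    by (intro has_sum_add f has_sum_uminusI h)
  then have "((\<lambda>z. f z - h z) has_sum x * s - s0) (UNIV \<times> idx m)" by simp
  also have "((\<lambda>z. f z - h z) has_sum x * s - s0) (UNIV \<times> idx m)
      \<longleftrightarrow> (f has_sum x * s - s0) ({0<..} \<times> idx m)"
    by (rule has_sum_cong_neutral) (auto simp: f_def h_def split: if_splits)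
  also have "\<dots> \<longleftrightarrow> ((\<lambda>(k, K). b (Suc k # K) * ((1 / x) ^ Suc k * mon I K))
      has_sum x * s - s0) (UNIV \<times> idx m)"
    by (rule has_sum_reindex_bij_witness[of _ "\<lambda>(k, K). (Suc k, K)" "\<lambda>(k, K). (k - 1, K)"])
        (auto simp: f_def gr0_conv_Suc)
  finally show ?thesis .
qed

lemma has_sum_finite_sum:
  fixes f :: "'i \<Rightarrow> 'a \<Rightarrow> complex"
  assumes "\<And>i. i \<in> I \<Longrightarrow> (f i has_sum s i) A"
  shows "((\<lambda>z. \<Sum>i\<in>I. f i z) has_sum (\<Sum>i\<in>I. s i)) A"
  using assms by (induction I rule: infinite_finite_induct) (auto intro!: has_sum_add)

text \<open>The restriction imposed by the primed sum, in terms of the sizes of J and its complement.\<close>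
definition wt :: "nat \<Rightarrow> nat \<Rightarrow> nat \<Rightarrow> nat \<Rightarrow> complex" where
  "wt g p i j = (if (i = 0 \<and> p = 0) \<or> (j = 0 \<and> p = g) then 0 else 1)"

context
  fixes T :: real and hbar :: complex
  assumes T_pos: "0 < T"
begin

text \<open>All terms of the recursion except the two products with W_1^(0), which belong to y on
  the left of the loop equation.\<close>

definition src :: "nat \<Rightarrow> nat \<Rightarrow> nat list \<Rightarrow> complex" where
  "src g k K =
     (if 1 \<le> g then - hbar * (of_nat k * Wcoeff T hbar (g - 1) ((k - 1) # K)) else 0)
   + (if 2 \<le> g then \<Sum>a<k. Wcoeff T hbar (g - 2) (a # (k - 1 - a) # K) else 0)
   + (\<Sum>p\<le>g. \<Sum>a<k. split_sum (\<lambda>A B. wt g p (length A) (length B) * (Wcoeff T hbar p (a # A)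
     * Wcoeff T hbar (g - p) ((k - 1 - a) # B))) K)
   + pick_sum (\<lambda>j J. of_nat j * Wcoeff T hbar g ((k + j - 1) # J)) K"

definition src_ev :: "nat \<Rightarrow> complex \<Rightarrow> complex list \<Rightarrow> complex" where
  "src_ev g x I =
     (if 1 \<le> g then - hbar * neg_deriv (Wcoeff T hbar (g - 1)) x I else 0)
   + (if 2 \<le> g then ev (Wcoeff T hbar (g - 2)) (x # x # I) else 0)
   + (\<Sum>p\<le>g. split_sum (\<lambda>A B. wt g p (length A) (length B) * (ev (Wcoeff T hbar p) (x # A) * ev
     (Wcoeff T hbar (g - p)) (x # B))) I)
   + pick_sum (divdiff (Wcoeff T hbar g) x) I"

text \<open>The two products set apart agree after \<open>a\<close> is replaced by
  \<open>k - 1 - a\<close>, hence the factor 2. The hypothesis excludes W_1^(0) itself, for which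
  they would be one and the same term.\<close>

lemma Wcoeff_Suc_src:
  assumes "K \<noteq> [] \<or> g \<noteq> 0"
  shows "Wcoeff T hbar g (Suc k # K)
      = 2 * (\<Sum>a<k. Wcoeff T hbar 0 [a] * Wcoeff T hbar g ((k - 1 - a) # K)) + src g k K"
proof -
  have 1: "split_sum (\<lambda>A B. \<Sum>p\<le>g. Wcoeff T hbar p (a # A) * Wcoeff T hbar (g - p) (b # B)) K =
     (\<Sum>p\<le>g. split_sum (\<lambda>A B. wt g p (length A) (length B) * (Wcoeff T hbar p (a # A)
         * Wcoeff T hbar (g - p) (b # B))) K)
     + Wcoeff T hbar 0 [a] * Wcoeff T hbar g (b # K)
       + Wcoeff T hbar g (a # K) * Wcoeff T hbar 0 [b]" for a b
  proof -
    have "split_sum (\<lambda>A B. \<Sum>p\<le>g. Wcoeff T hbar p (a # A) * Wcoeff T hbar (g - p) (b # B)) K =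
      split_sum (\<lambda>A B. (\<Sum>p\<le>g. wt g p (length A) (length B) * (Wcoeff T hbar p (a # A)
          * Wcoeff T hbar (g - p) (b # B)))
        + (if A = [] then Wcoeff T hbar 0 (a # A) * Wcoeff T hbar g (b # B) else 0)
          + (if B = [] then Wcoeff T hbar g (a # A) * Wcoeff T hbar 0 (b # B) else 0)) K"
    proof (rule split_sum_cong[OF refl])
      fix A B assume m: "mset A + mset B = mset K"
      have ne: "\<not> (A = [] \<and> B = [] \<and> g = 0)" using assms m by auto
      have "(\<Sum>p\<le>g. Wcoeff T hbar p (a # A) * Wcoeff T hbar (g - p) (b # B)) =
        (\<Sum>p\<le>g. wt g p (length A) (length B) * (Wcoeff T hbar p (a # A) * Wcoeff T hbar (g - p)
            (b # B))
          + (if p = 0 then if A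
            = [] then Wcoeff T hbar 0 (a # A) * Wcoeff T hbar g (b # B) else 0 else 0)
          + (if p = g then if B
            = [] then Wcoeff T hbar g (a # A) * Wcoeff T hbar 0 (b # B) else 0 else 0))"
        by (rule sum.cong) (use ne in \<open>auto simp: wt_def\<close>)
      then show "(\<Sum>p\<le>g. Wcoeff T hbar p (a # A) * Wcoeff T hbar (g - p) (b # B)) =
         (\<Sum>p\<le>g. wt g p (length A) (length B) * (Wcoeff T hbar p (a # A) * Wcoeff T hbar (g - p)
             (b # B)))
        + (if A = [] then Wcoeff T hbar 0 (a # A) * Wcoeff T hbar g (b # B) else 0)
          + (if B = [] then Wcoeff T hbar g (a # A) * Wcoeff T hbar 0 (b # B) else 0)"
        by (simp only: sum.distrib sum.delta finite_atMost) simp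
    qed
    also have "\<dots>
        = (\<Sum>p\<le>g. split_sum (\<lambda>A B. wt g p (length A) (length B) * (Wcoeff T hbar p (a # A)
          * Wcoeff T hbar (g - p) (b # B))) K)
     + Wcoeff T hbar 0 [a] * Wcoeff T hbar g (b # K)
       + Wcoeff T hbar g (a # K) * Wcoeff T hbar 0 [b]"
      by (simp only: split_sum_add split_sum_sum split_sum_Nil_left split_sum_Nil_right)
    finally show ?thesis .
  qed
  have 2: "(\<Sum>a<k. Wcoeff T hbar g (a # K) * Wcoeff T hbar 0 [k - 1 - a])
      = (\<Sum>a<k. Wcoeff T hbar 0 [a] * Wcoeff T hbar g ((k - 1 - a) # K))"
    by (rule sum.reindex_bij_witness[of _ "\<lambda>a. k - 1 - a" "\<lambda>a. k - 1 - a"]) auto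
  have 3: "(\<Sum>a<k. split_sum (\<lambda>A B. \<Sum>p\<le>g. Wcoeff T hbar p (a # A) * Wcoeff T hbar (g - p)
      ((k - 1 - a) # B)) K) =
     (\<Sum>p\<le>g. \<Sum>a<k. split_sum (\<lambda>A B. wt g p (length A) (length B) * (Wcoeff T hbar p (a # A)
         * Wcoeff T hbar (g - p) ((k - 1 - a) # B))) K)
     + 2 * (\<Sum>a<k. Wcoeff T hbar 0 [a] * Wcoeff T hbar g ((k - 1 - a) # K))"
    unfolding 1 sum.distrib 2 by (subst sum.swap) simp
  show ?thesis unfolding Wcoeff_Suc 3 src_def by (simp add: algebra_simps)
qed

text \<open>The value of 2g + n drops by 2 in the derivative, by 3 on the diagonal and by 1 in the
  contractions. In a product it drops by at least 1 for each factor, because \<open>wt\<close>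
  removes the pairs in which the other factor is W_1^(0).\<close>

lemma has_sum_src:
  assumes IH: "\<And>n' g'. 1 \<le> n' \<Longrightarrow> 2 * g' + n' < 2 * g + Suc (length I) \<Longrightarrow> good T n' (Wcoeff T hbar g')"
    and ext_disc: "x \<in> ext_disc T" "set I \<subseteq> ext_disc T"
  shows "((\<lambda>(k, K). src g k K * ((1 / x) ^ Suc k * mon I K))
      has_sum src_ev g x I) (UNIV \<times> idx (length I))"
proof -
  let ?U = "\<lambda>k K. (1 / x) ^ Suc k * mon I K"
  have 1: "((\<lambda>(k, K). (if 1
      \<le> g then - hbar * (of_nat k * Wcoeff T hbar (g - 1) ((k - 1) # K)) else 0) * ?U k K) has_sum
     (if 1 \<le> g then - hbar * neg_deriv (Wcoeff T hbar (g - 1)) x I else 0)) (UNIV \<times> idx (length I))"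
  proof (cases "1 \<le> g")
    case True
    have "((\<lambda>(k, K). of_nat k * Wcoeff T hbar (g - 1) ((k - 1) # K) * ?U k K)
        has_sum neg_deriv (Wcoeff T hbar (g - 1)) x I) (UNIV \<times> idx (length I))"
      by (rule has_sum_neg_deriv_shift[OF T_pos]) (use True ext_disc in \<open>auto intro!: IH\<close>)
    from has_sum_cmult_right[OF this, of "- hbar"] show ?thesis using True
        by (simp add: case_prod_unfold mult.assoc)
  qed (simp add: case_prod_unfold)
  have 2: "((\<lambda>(k, K). (if 2 \<le> g then \<Sum>a<k. Wcoeff T hbar (g - 2) (a # (k - 1 - a) # K) else 0)
      * ?U k K) has_sum
     (if 2 \<le> g then ev (Wcoeff T hbar (g - 2)) (x # x # I) else 0)) (UNIV \<times> idx (length I))"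
  proof (cases "2 \<le> g")
    case True
    have "((\<lambda>(k, K). (\<Sum>a<k. Wcoeff T hbar (g - 2) (a # (k - 1 - a) # K)) * ?U k K)
        has_sum ev (Wcoeff T hbar (g - 2)) (x # x # I)) (UNIV \<times> idx (length I))"
      by (rule has_sum_diagonal[OF T_pos]) (use True ext_disc in \<open>auto intro!: IH\<close>)
    then show ?thesis using True by simp
  qed (simp add: case_prod_unfold)
  have 3: "((\<lambda>z. \<Sum>p\<le>g. (\<lambda>(k, K). (\<Sum>a<k. split_sum (\<lambda>A B. wt g p (length A) (length B) *
      (Wcoeff T hbar p (a # A) * Wcoeff T hbar (g - p) ((k - 1 - a) # B))) K) * ?U k K) z)
     has_sum (\<Sum>p\<le>g. split_sum (\<lambda>A B. wt g p (length A) (length B) * (ev (Wcoeff T hbar p) (x # A)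
         * ev (Wcoeff T hbar (g - p)) (x # B))) I)) (UNIV \<times> idx (length I))"
  proof (rule has_sum_finite_sum)
    fix p assume p: "p \<in> {..g}"
    show "((\<lambda>(k, K). (\<Sum>a<k. split_sum (\<lambda>A B. wt g p (length A) (length B) *
        (Wcoeff T hbar p (a # A) * Wcoeff T hbar (g - p) ((k - 1 - a) # B))) K) * ?U k K)
      has_sum split_sum (\<lambda>A B. wt g p (length A) (length B) * (ev (Wcoeff T hbar p) (x # A) * ev
          (Wcoeff T hbar (g - p)) (x # B))) I) (UNIV \<times> idx (length I))"
    proof (rule has_sum_conv[OF T_pos _ ext_disc])
      fix A B assume m: "mset A + mset B = mset I" and w: "wt g p (length A) (length B) \<noteq> 0"
      have l: "length A + length B = length I" using m by (metis size_mset size_union)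
      have "0 < length A \<or> 0 < p" "0 < length B \<or> p < g"
        using w p by (auto simp: wt_def split: if_splits)
      then have "2 * p + Suc (length A) < 2 * g + Suc (length I)" "2 * (g - p)
          + Suc (length B) < 2 * g + Suc (length I)"
        using l p by (simp_all del: length_greater_0_conv) arith+
      then show "good T (Suc (length A)) (Wcoeff T hbar p) \<and> good T (Suc (length B))
          (Wcoeff T hbar (g - p))"
        by (intro conjI IH) simp_all
    qed
  qed
  have 4: "((\<lambda>(k, K). pick_sum (\<lambda>j J. of_nat j * Wcoeff T hbar g ((k + j - 1) # J)) K * ?U k K)
      has_sum pick_sum (divdiff (Wcoeff T hbar g) x) I) (UNIV \<times> idx (length I))"
  proof (cases "I = []")
    case True
    then show ?thesis by (auto intro!: has_sum_0)
  next
    case False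
    then have "good T (length I) (Wcoeff T hbar g)" by (intro IH) (auto simp: Suc_le_eq)
    then show ?thesis by (rule has_sum_pick[OF T_pos _ ext_disc])
  qed
  have "((\<lambda>z. (\<lambda>(k, K). (if 1
      \<le> g then - hbar * (of_nat k * Wcoeff T hbar (g - 1) ((k - 1) # K)) else 0) * ?U k K) z
     + (\<lambda>(k, K). (if 2 \<le> g then \<Sum>a<k. Wcoeff T hbar (g - 2) (a # (k - 1 - a) # K) else 0)
       * ?U k K) z
     + (\<Sum>p\<le>g. (\<lambda>(k, K). (\<Sum>a<k. split_sum (\<lambda>A B. wt g p (length A) (length B) *
       (Wcoeff T hbar p (a # A) * Wcoeff T hbar (g - p) ((k - 1 - a) # B))) K) * ?U k K) z)
     + (\<lambda>(k, K). pick_sum (\<lambda>j J. of_nat j * Wcoeff T hbar g ((k + j - 1) # J)) K * ?U k K) z)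
       has_sum src_ev g x I) (UNIV \<times> idx (length I))"
    unfolding src_ev_def by (intro has_sum_add 1 2 3 4)
  then show ?thesis
    by (rule has_sum_cong[THEN iffD1, rotated])
       (auto simp: src_def distrib_right sum_distrib_right simp del: power_Suc)
qed

text \<open>The truncated sums satisfy S(N+1) \<le> T + \<rho>^2 S(N)^2, and the bound 2T is
  preserved exactly when 4T \<rho>^2 \<le> 1. In the case of equality 2T is the double root of S = T
  + \<rho>^2 S^2.\<close>

lemma Wcoeff_single_bound:
  assumes "0 \<le> \<rho>" "4 * T * \<rho>\<^sup>2 \<le> 1"
  shows "(\<Sum>a<N. cmod (Wcoeff T hbar 0 [a]) * \<rho> ^ a) \<le> 2 * T"
proof (induction N)
  case (Suc N)
  define f where "f a = cmod (Wcoeff T hbar 0 [a]) * \<rho> ^ a" for a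
  have "f (Suc k) \<le> \<rho>\<^sup>2 * (\<Sum>a<k. f a * f (k - 1 - a))" for k
  proof -
    have "Wcoeff T hbar 0 [Suc k] = (\<Sum>a<k. Wcoeff T hbar 0 [a] * Wcoeff T hbar 0 [k - 1 - a])"
        by (simp add: Wcoeff_Suc)
    then have "cmod (Wcoeff T hbar 0 [Suc k])
        \<le> (\<Sum>a<k. cmod (Wcoeff T hbar 0 [a]) * cmod (Wcoeff T hbar 0 [k - 1 - a]))"
      by (simp only:) (rule order.trans[OF norm_sum], simp add: norm_mult)
    then have "f (Suc k) \<le> (\<Sum>a<k. cmod (Wcoeff T hbar 0 [a]) * cmod (Wcoeff T hbar 0 [k - 1 - a]))
        * \<rho> ^ Suc k"
      unfolding f_def using assms(1) by (intro mult_right_mono) auto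
    also have "\<dots> = \<rho>\<^sup>2 * (\<Sum>a<k. f a * f (k - 1 - a))"
      unfolding sum_distrib_left sum_distrib_right
    proof (rule sum.cong[OF refl])
      fix a assume "a \<in> {..<k}"
      then have "Suc k = 2 + a + (k - 1 - a)" by auto
      then have e: "\<rho> ^ Suc k = \<rho>\<^sup>2 * \<rho> ^ a * \<rho> ^ (k - 1 - a)" by (metis power_add)
      show "cmod (Wcoeff T hbar 0 [a]) * cmod (Wcoeff T hbar 0 [k - 1 - a]) * \<rho> ^ Suc k
          = \<rho>\<^sup>2 * (f a * f (k - 1 - a))"
        unfolding e f_def by (simp only: ac_simps)
    qed
    finally show ?thesis .
  qed
  then have "(\<Sum>k<N. f (Suc k)) \<le> \<rho>\<^sup>2 * (\<Sum>k<N. \<Sum>a<k. f a * f (k - 1 - a))"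
    unfolding sum_distrib_left by (rule sum_mono)
  also have "\<dots> \<le> \<rho>\<^sup>2 * ((\<Sum>a<N. f a) * (\<Sum>a<N. f a))"
    by (intro mult_left_mono sum_triangle_le) (use assms in \<open>auto simp: f_def\<close>)
  also have "\<dots> \<le> \<rho>\<^sup>2 * ((2 * T) * (2 * T))"
    using Suc.IH T_pos assms(1)
        by (intro mult_left_mono mult_mono) (auto simp: f_def intro!: sum_nonneg)
  also have "\<dots> \<le> T" using mult_left_mono[OF assms(2), of T] T_pos
      by (simp add: power2_eq_square ac_simps)
  finally have "(\<Sum>k<N. f (Suc k)) \<le> T" .
  moreover have "f 0 = T" using T_pos by (simp add: f_def Wcoeff_0)
  ultimately show ?case unfolding f_def[symmetric] by (subst sum.lessThan_Suc_shift) simp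
qed (use T_pos in simp)

lemma ext_disc_rho:
  assumes "x \<in> ext_disc T"
  shows "4 * T * (1 / cmod x)\<^sup>2 < 1"
proof -
  have "(2 * sqrt T)\<^sup>2 < (cmod x)\<^sup>2" using assms T_pos
      by (intro power_strict_mono) (auto simp: ext_disc_def)
  then show ?thesis using T_pos ext_disc_pos[OF T_pos assms]
      by (simp add: power_mult_distrib power_divide field_simps)
qed

text \<open>A finite set of indices is enlarged to a rectangle so that estimates for a fixed tail
  \<open>K\<close> can be added up. The rectangle is the same for every \<open>b\<close>.\<close>

lemma finite_sum_mon_le:
  assumes "finite F" "F \<subseteq> UNIV \<times> idx m" "x \<in> ext_disc T"
  obtains N G where "finite G" "G \<subseteq> idx m"
    "\<And>b. (\<Sum>z\<in>F. cmod ((\<lambda>(k, K). b (k # K) * ((1 / x) ^ Suc k * mon I K)) z)) \<le>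
       (\<Sum>K\<in>G. 1 / cmod x * cmod (mon I K) * (\<Sum>k<N. cmod (b (k # K)) * (1 / cmod x) ^ k))"
proof -
  obtain N where N: "fst ` F \<subseteq> {..<N}" using finite_nat_bounded[of "fst ` F"] assms(1) by auto
  have F: "F \<subseteq> {..<N} \<times> snd ` F" using N by force
  show ?thesis
  proof (rule that[of "snd ` F" N])
    fix b
    have "(\<Sum>z\<in>F. cmod ((\<lambda>(k, K). b (k # K) * ((1 / x) ^ Suc k * mon I K)) z)) \<le>
      (\<Sum>z\<in>{..<N} \<times> snd ` F. cmod ((\<lambda>(k, K). b (k # K) * ((1 / x) ^ Suc k * mon I K)) z))"
      by (rule sum_mono2) (use F assms(1) in auto)
    also have "\<dots> = (\<Sum>K\<in>snd ` F. \<Sum>k<N. cmod (b (k # K) * ((1 / x) ^ Suc k * mon I K)))"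
      by (subst sum.swap) (simp add: sum.cartesian_product case_prod_unfold)
    also have "\<dots>
        = (\<Sum>K\<in>snd ` F. 1 / cmod x * cmod (mon I K) * (\<Sum>k<N. cmod (b (k # K)) * (1 / cmod x) ^ k))"
      by (simp add: sum_distrib_left norm_mult norm_divide norm_power ac_simps)
    finally show "(\<Sum>z\<in>F. cmod ((\<lambda>(k, K). b (k # K) * ((1 / x) ^ Suc k * mon I K)) z)) \<le> \<dots>" .
  qed (use assms in auto)
qed

lemma summable_single_norm:
  assumes "x \<in> ext_disc T" "finite F" "F \<subseteq> UNIV \<times> idx 0"
  shows "(\<Sum>z\<in>F. cmod ((\<lambda>(k, K). Wcoeff T hbar 0 (k # K) * ((1 / x) ^ Suc k * mon [] K)) z))
      \<le> 2 * T / cmod x"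
proof -
  obtain N G where G: "finite G" "G \<subseteq> idx 0" and
    le: "\<And>b. (\<Sum>z\<in>F. cmod ((\<lambda>(k, K). b (k # K) * ((1 / x) ^ Suc k * mon [] K)) z)) \<le>
       (\<Sum>K\<in>G. 1 / cmod x * cmod (mon [] K) * (\<Sum>k<N. cmod (b (k # K)) * (1 / cmod x) ^ k))"
    by (rule finite_sum_mon_le[OF assms(2,3,1), where I = "[]"]) auto
  note le[of "Wcoeff T hbar 0"]
  also have "(\<Sum>K\<in>G. 1 / cmod x * cmod (mon [] K) * (\<Sum>k<N. cmod (Wcoeff T hbar 0 (k # K)) *
      (1 / cmod x) ^ k))
     \<le> (\<Sum>K\<in>{[]}. 1 / cmod x * cmod (mon [] K) * (\<Sum>k<N. cmod (Wcoeff T hbar 0 (k # K)) *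
         (1 / cmod x) ^ k))"
    by (rule sum_mono2) (use G in \<open>auto intro!: mult_nonneg_nonneg divide_nonneg_nonneg sum_nonneg\<close>)
  also have "\<dots> = 1 / cmod x * (\<Sum>k<N. cmod (Wcoeff T hbar 0 [k]) * (1 / cmod x) ^ k)" by simp
  also have "\<dots> \<le> 1 / cmod x * (2 * T)"
    by (intro mult_left_mono Wcoeff_single_bound) (use ext_disc_rho[OF assms(1)] in auto)
  finally show ?thesis by simp
qed

text \<open>The constant \<open>\<rho> / \<theta>\<close> depends neither on the tail
  \<open>K\<close> nor on the truncation, so all finite sums for \<open>b\<close> are bounded by the
  norm sum of \<open>r\<close>.\<close>

lemma good_resolvent:
  assumes x: "x \<in> ext_disc T"
    and b0: "\<And>K. K \<in> idx m \<Longrightarrow> b (0 # K) = 0"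
    and b: "\<And>k K. K \<in> idx m \<Longrightarrow> b (Suc k # K)
        = 2 * (\<Sum>a<k. Wcoeff T hbar 0 [a] * b ((k - 1 - a) # K)) + r (k # K)"
    and r: "(\<lambda>(k, K). r (k # K) * ((1 / x) ^ Suc k * mon I K)) summable_on UNIV \<times> idx m"
  shows "(\<lambda>(k, K). b (k # K) * ((1 / x) ^ Suc k * mon I K)) summable_on UNIV \<times> idx m"
proof -
  define \<rho> where "\<rho> = 1 / cmod x"
  define \<theta> where "\<theta> = 1 - 4 * T * \<rho>\<^sup>2"
  have \<theta>: "\<theta> > 0" using ext_disc_rho[OF x] by (simp add: \<theta>_def \<rho>_def)
  have \<rho>: "\<rho> > 0" using ext_disc_pos[OF T_pos x] by (simp add: \<rho>_def)
  let ?r = "\<lambda>(k, K). r (k # K) * ((1 / x) ^ Suc k * mon I K)"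
  let ?b = "\<lambda>(k, K). b (k # K) * ((1 / x) ^ Suc k * mon I K)"
  have r': "(\<lambda>z. cmod (?r z)) summable_on UNIV \<times> idx m"
    using r by (simp only: summable_on_iff_abs_summable_on_complex)
  have "(\<lambda>z. cmod (?b z)) summable_on UNIV \<times> idx m"
  proof (rule nonneg_bdd_above_summable_on)
    show "bdd_above (sum (\<lambda>z. cmod (?b z)) ` {F. F \<subseteq> UNIV \<times> idx m \<and> finite F})"
    proof (rule bdd_aboveI2)
      fix F :: "(nat \<times> nat list) set" assume F: "F \<in> {F. F \<subseteq> UNIV \<times> idx m \<and> finite F}"
      obtain N G where G: "finite G" "G \<subseteq> idx m" and
        le: "\<And>b. (\<Sum>z\<in>F. cmod ((\<lambda>(k, K). b (k # K) * ((1 / x) ^ Suc k * mon I K)) z)) \<le>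
           (\<Sum>K\<in>G. 1 / cmod x * cmod (mon I K) * (\<Sum>k<N. cmod (b (k # K)) * (1 / cmod x) ^ k))"
        by (rule finite_sum_mon_le[OF _ _ x, where F = F and m = m and I = I]) (use F in auto)
      have "(\<Sum>z\<in>F. cmod (?b z)) \<le> (\<Sum>K\<in>G. \<rho> * cmod (mon I K) * (\<Sum>k<N. cmod (b (k # K)) * \<rho> ^ k))"
        using le[of b] by (simp add: \<rho>_def)
      also have "\<dots> \<le> (\<Sum>K\<in>G. \<rho> * cmod (mon I K) * (\<rho> / \<theta> * (\<Sum>k<N. cmod (r (k # K)) * \<rho> ^ k)))"
      proof (rule sum_mono)
        fix K assume "K \<in> G"
        then have K: "K \<in> idx m" using G by auto
        have "\<theta> * (\<Sum>k<N. cmod (b (k # K)) * \<rho> ^ k) \<le> \<rho> * (\<Sum>k<N. cmod (r (k # K)) * \<rho> ^ k)"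
          unfolding \<theta>_def
        proof (rule resolvent_bound[where c = "\<lambda>a. Wcoeff T hbar 0 [a]"])
          show "(\<Sum>a<N. cmod (Wcoeff T hbar 0 [a]) * \<rho> ^ a) \<le> 2 * T" for N
            by (rule Wcoeff_single_bound) (use \<rho> \<theta> in \<open>auto simp: \<theta>_def\<close>)
        qed (use b0[OF K] b[OF K] \<rho> in auto)
        then have "(\<Sum>k<N. cmod (b (k # K)) * \<rho> ^ k) \<le> \<rho> / \<theta> * (\<Sum>k<N. cmod (r (k # K)) * \<rho> ^ k)"
          using \<theta> by (simp add: field_simps)
        then show "\<rho> * cmod (mon I K) * (\<Sum>k<N. cmod (b (k # K)) * \<rho> ^ k)
            \<le> \<rho> * cmod (mon I K) * (\<rho> / \<theta> * (\<Sum>k<N. cmod (r (k # K)) * \<rho> ^ k))"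
          by (rule mult_left_mono) (use \<rho> in auto)
      qed
      also have "\<dots> = \<rho> / \<theta> * (\<Sum>K\<in>G. \<Sum>k<N. cmod (?r (k, K)))"
        by (simp add: sum_distrib_left norm_mult norm_divide norm_power \<rho>_def ac_simps)
      also have "(\<Sum>K\<in>G. \<Sum>k<N. cmod (?r (k, K))) = (\<Sum>z\<in>{..<N} \<times> G. cmod (?r z))"
        by (subst sum.swap) (simp add: sum.cartesian_product case_prod_unfold)
      also have "\<rho> / \<theta> * (\<Sum>z\<in>{..<N} \<times> G. cmod (?r z))
          \<le> \<rho> / \<theta> * infsum (\<lambda>z. cmod (?r z)) (UNIV \<times> idx m)"
        by (intro mult_left_mono finite_sum_le_infsum[OF r']) (use G \<rho> \<theta> in auto)
      finally show "(\<Sum>z\<in>F. cmod (?b z)) \<le> \<rho> / \<theta> * infsum (\<lambda>z. cmod (?r z)) (UNIV \<times> idx m)" .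
    qed
  qed auto
  then show ?thesis by (simp only: summable_on_iff_abs_summable_on_complex)
qed

lemma good_Wcoeff: "1 \<le> n \<Longrightarrow> good T n (Wcoeff T hbar g)"
proof (induction "2 * g + n" arbitrary: n g rule: less_induct)
  case less
  show ?case unfolding good_def
  proof (intro allI impI)
    fix q assume q: "length q = n" "set q \<subseteq> ext_disc T"
    then obtain x I where qI: "q = x # I" using less.prems by (cases q) auto
    have n: "n = Suc (length I)" using q qI by simp
    have x: "x \<in> ext_disc T" "set I \<subseteq> ext_disc T" using q qI by auto
    have "(\<lambda>(k, K). Wcoeff T hbar g (k # K) * ((1 / x) ^ Suc k * mon I K))
        summable_on UNIV \<times> idx (length I)"
    proof (cases "I = [] \<and> g = 0")
      \<comment> \<open>W_1^(0) obeys a quadratic recursion instead of a linear one with source; its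
        convergence is the Catalan bound.\<close>
      case True
      have "(\<lambda>z. cmod ((\<lambda>(k, K). Wcoeff T hbar 0 (k # K) * ((1 / x) ^ Suc k * mon [] K)) z))
          summable_on UNIV \<times> idx 0"
        by (rule nonneg_bdd_above_summable_on)
           (use summable_single_norm[OF x(1)] in \<open>auto intro!: bdd_aboveI2[where M
               = "2 * T / cmod x"]\<close>)
      then show ?thesis using True by (simp only: summable_on_iff_abs_summable_on_complex) simp
    next
      case False
      show ?thesis
      proof (rule good_resolvent[OF x(1), where r = "\<lambda>L. src g (hd L) (tl L)"])
        fix k K assume K: "K \<in> idx (length I)"
        then have ne: "K \<noteq> [] \<or> g \<noteq> 0" using False by (auto simp: idx_def)
        show "Wcoeff T hbar g (0 # K) = 0" using ne by (auto simp: Wcoeff_0)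
        show "Wcoeff T hbar g (Suc k # K)
            = 2 * (\<Sum>a<k. Wcoeff T hbar 0 [a] * Wcoeff T hbar g ((k - 1 - a) # K))
              + src g (hd (k # K)) (tl (k # K))"
          using Wcoeff_Suc_src[OF ne] by simp
      next
        have "((\<lambda>(k, K). src g k K * ((1 / x) ^ Suc k * mon I K))
            has_sum src_ev g x I) (UNIV \<times> idx (length I))"
          by (rule has_sum_src[OF less.hyps x]) (use n in auto)
        then show "(\<lambda>(k, K). src g (hd (k # K)) (tl (k # K)) * ((1 / x) ^ Suc k * mon I K))
            summable_on UNIV \<times> idx (length I)"
          by (simp only: list.sel has_sum_imp_summable)
      qed
    qed
    then show "(\<lambda>K. Wcoeff T hbar g K * mon q K) summable_on idx n"
      unfolding n qI summable_on_idx_Suc[symmetric] by simp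
  qed
qed

lemma ev_single_bound:
  assumes "x \<in> ext_disc T"
  shows "cmod (ev (Wcoeff T hbar 0) [x]) \<le> 2 * T / cmod x"
proof -
  have "((\<lambda>(k, K). Wcoeff T hbar 0 (k # K) * ((1 / x) ^ Suc k * mon [] K))
      has_sum ev (Wcoeff T hbar 0) [x]) (UNIV \<times> idx (length ([]::complex list)))"
    by (rule has_sum_ev_Cons[OF T_pos]) (use assms good_Wcoeff in auto)
  then have h: "((\<lambda>(k, K). Wcoeff T hbar 0 (k # K) * ((1 / x) ^ Suc k * mon [] K))
      has_sum ev (Wcoeff T hbar 0) [x]) (UNIV \<times> idx 0)" by simp
  then have "((\<lambda>F. cmod (\<Sum>z\<in>F. (\<lambda>(k, K). Wcoeff T hbar 0 (k # K) * ((1 / x) ^ Suc k * mon [] K))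
      z)) \<longlongrightarrow> cmod (ev (Wcoeff T hbar 0) [x])) (finite_subsets_at_top (UNIV \<times> idx 0))"
    unfolding has_sum_def by (rule tendsto_norm)
  then show ?thesis
  proof (rule tendsto_upperbound)
    show "\<forall>\<^sub>F F in finite_subsets_at_top (UNIV \<times> idx 0). cmod
        (\<Sum>z\<in>F. (\<lambda>(k, K). Wcoeff T hbar 0 (k # K) * ((1 / x) ^ Suc k * mon [] K)) z)
            \<le> 2 * T / cmod x"
      by (rule eventually_finite_subsets_at_top_weakI)
         (rule order.trans[OF norm_sum], use summable_single_norm[OF assms] in auto)
  qed simp
qed

text \<open>A weight that selects \<open>A = []\<close> reduces the convolution over splittings to a
  product with a function of \<open>x\<close> alone.\<close>

lemma has_sum_leading:
  assumes "x \<in> ext_disc T" "set I \<subseteq> ext_disc T"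
  shows "((\<lambda>(k, K). (\<Sum>a<k. Wcoeff T hbar 0 [a] * Wcoeff T hbar g ((k - 1 - a) # K)) *
      ((1 / x) ^ Suc k * mon I K))
          has_sum ev (Wcoeff T hbar 0) [x] * ev (Wcoeff T hbar g) (x # I)) (UNIV \<times> idx (length I))"
proof -
  define w :: "nat \<Rightarrow> nat \<Rightarrow> complex" where "w i j = (if i = 0 then 1 else 0)" for i j
  have e: "split_sum (\<lambda>A B. w (length A) (length B) * f A B) L = f [] L" for f and L :: "'z list"
  proof -
    have "(\<lambda>A B. w (length A) (length B) * f A B) = (\<lambda>A B. if A = [] then f A B else 0)"
        by (auto simp: w_def fun_eq_iff)
    then show ?thesis by (simp only: split_sum_Nil_left)
  qed
  show ?thesis using
      has_sum_conv[OF T_pos _ assms, of w "Wcoeff T hbar 0" "Wcoeff T hbar g"] good_Wcoeff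
          by (simp add: e)
qed

lemma ev_single_quadratic:
  assumes "x \<in> ext_disc T"
  shows "x * ev (Wcoeff T hbar 0) [x] = T + (ev (Wcoeff T hbar 0) [x])\<^sup>2"
proof -
  have x0: "x \<noteq> 0" using ext_disc_pos[OF T_pos assms] by auto
  have 1: "((\<lambda>(k, K). Wcoeff T hbar 0 (k # K) * ((1 / x) ^ Suc k * mon [] K))
      has_sum ev (Wcoeff T hbar 0) [x]) (UNIV \<times> idx 0)"
    using has_sum_ev_Cons[OF T_pos, of "[]" "Wcoeff T hbar 0" x] assms good_Wcoeff[of 1 0] by simp
  have 2: "((\<lambda>K. Wcoeff T hbar 0 (0 # K) * mon [] K) has_sum T) (idx 0)"
      by (auto intro!: has_sum_finiteI simp: Wcoeff_0)
  have "((\<lambda>(k, K). Wcoeff T hbar 0 (Suc k # K) * ((1 / x) ^ Suc k * mon [] K))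
      has_sum x * ev (Wcoeff T hbar 0) [x] - T) (UNIV \<times> idx 0)"
    by (rule has_sum_shift_first[OF 1 2 x0])
  moreover have "((\<lambda>(k, K). Wcoeff T hbar 0 (Suc k # K) * ((1 / x) ^ Suc k * mon [] K))
      has_sum (ev (Wcoeff T hbar 0) [x])\<^sup>2) (UNIV \<times> idx 0)"
    by (rule has_sum_cong[THEN iffD1, OF _
        has_sum_leading[OF assms, of "[]" 0, simplified list.size power2_eq_square[symmetric]]])
       (auto simp: Wcoeff_Suc)
  ultimately have "x * ev (Wcoeff T hbar 0) [x] - T = (ev (Wcoeff T hbar 0) [x])\<^sup>2"
      by (rule has_sum_unique)
  then show ?thesis by (simp add: algebra_simps)
qed

text \<open>By the quadratic equation \<open>1 - 2 * w / x\<close> squares to the radicand. The sign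
  is settled by the norm bound: |2w/x| < 1 puts it in the right half plane, so it is the principal
  root, and it does not vanish.\<close>

lemma ybr_eq:
  assumes "x \<in> ext_disc T"
  shows "ybr T x = x - 2 * ev (Wcoeff T hbar 0) [x]" and "ybr T x \<noteq> 0"
proof -
  have x0: "x \<noteq> 0" using ext_disc_pos[OF T_pos assms] by auto
  define w where "w = ev (Wcoeff T hbar 0) [x]"
  define b where "b = 1 - 2 * w / x"
  have "cmod (2 * w / x) \<le> 4 * T * (1 / cmod x)\<^sup>2"
    using ev_single_bound[OF assms] ext_disc_pos[OF T_pos assms]
    by (simp add: w_def norm_mult norm_divide field_simps power2_eq_square)
  also have "\<dots> < 1" by (rule ext_disc_rho[OF assms])
  finally have n: "cmod (2 * w / x) < 1" .
  then have Re: "0 < Re b" using complex_Re_le_cmod[of "2 * w / x"] by (simp add: b_def)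
  have "b\<^sup>2 = 1 - 4 * (x * w - w\<^sup>2) / x\<^sup>2" using x0
      by (simp add: b_def field_simps power2_eq_square)
  also have "x * w - w\<^sup>2 = T" using ev_single_quadratic[OF assms] by (simp add: w_def)
  finally have "b\<^sup>2 = 1 - complex_of_real (4 * T) / x\<^sup>2" by simp
  then have "csqrt (1 - complex_of_real (4 * T) / x\<^sup>2) = b" using Re by (metis csqrt_square)
  then have y: "ybr T x = x * b" by (simp add: ybr_def)
  then show "ybr T x = x - 2 * ev (Wcoeff T hbar 0) [x]" using x0
      by (simp add: b_def w_def right_diff_distrib)
  show "ybr T x \<noteq> 0" using y x0 Re by auto
qed

text \<open>Multiplication by \<open>x\<close> shifts the first index, without a constant term since
  the coefficients with first index zero vanish here. The recursion sums the shifted series to 2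
  W_1^(0) W plus the source, and x - 2 W_1^(0) is y.\<close>

theorem loop_equation:
  assumes "x \<in> ext_disc T" "set I \<subseteq> ext_disc T" "I \<noteq> [] \<or> g \<noteq> 0"
  shows "ybr T x * ev (Wcoeff T hbar g) (x # I) = src_ev g x I"
proof -
  have x0: "x \<noteq> 0" using ext_disc_pos[OF T_pos assms(1)] by auto
  have ne: "K \<noteq> [] \<or> g \<noteq> 0" if "K \<in> idx (length I)" for K using assms(3) that
      by (auto simp: idx_def)
  have 1: "((\<lambda>(k, K). Wcoeff T hbar g (k # K) * ((1 / x) ^ Suc k * mon I K))
      has_sum ev (Wcoeff T hbar g) (x # I)) (UNIV \<times> idx (length I))"
    by (rule has_sum_ev_Cons[OF T_pos]) (use assms good_Wcoeff in auto)
  have 2: "((\<lambda>K. Wcoeff T hbar g (0 # K) * mon I K) has_sum 0) (idx (length I))"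
    by (rule has_sum_0) (use ne in \<open>auto simp: Wcoeff_0\<close>)
  have 3: "((\<lambda>(k, K). Wcoeff T hbar g (Suc k # K) * ((1 / x) ^ Suc k * mon I K))
      has_sum x * ev (Wcoeff T hbar g) (x # I)) (UNIV \<times> idx (length I))"
    using has_sum_shift_first[OF 1 2 x0] by simp
  have "((\<lambda>(k, K). src g k K * ((1 / x) ^ Suc k * mon I K))
      has_sum src_ev g x I) (UNIV \<times> idx (length I))"
    by (rule has_sum_src) (use assms good_Wcoeff in auto)
  from has_sum_add[OF has_sum_cmult_right[OF has_sum_leading[OF assms(1,2), of g], of 2] this]
  have 4: "((\<lambda>(k, K). Wcoeff T hbar g (Suc k # K) * ((1 / x) ^ Suc k * mon I K))
      has_sum 2 * (ev (Wcoeff T hbar 0) [x] * ev (Wcoeff T hbar g) (x # I))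
          + src_ev g x I) (UNIV \<times> idx (length I))"
    by (rule has_sum_cong[THEN iffD1, rotated])
       (auto simp: Wcoeff_Suc_src[OF ne] distrib_right mult.assoc simp del: power_Suc)
  from has_sum_unique[OF 3 4] show ?thesis unfolding ybr_eq(1)[OF assms(1)]
      by (simp add: algebra_simps)
qed

end

section \<open>Identification with the correlators\<close>

lemma sum_Pow_nths:
  "(\<Sum>S\<in>Pow {..<length I}. f (nths I S) (nths I (- S))) = split_sum f I"
proof (induction I arbitrary: f)
  case (Cons x I)
  let ?P = "Pow {..<length I}"
  have P: "Pow {..<length (x # I)} = (`) Suc ` ?P \<union> (\<lambda>S. insert 0 (Suc ` S)) ` ?P"
  proof -
    have "Pow (Suc ` {..<length I}) = (`) Suc ` ?P" by (simp add: image_Pow_surj)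
    then show ?thesis
        by (simp only: list.size add_0_right add_Suc_right lessThan_Suc_eq_insert_0 Pow_insert
            image_image)
  qed
  have inj: "inj_on ((`) Suc) ?P" "inj_on (\<lambda>S. insert 0 (Suc ` S)) ?P"
    by (auto simp: inj_on_def dest: inj_image_eq_iff[THEN iffD1, rotated] insert_ident[THEN iffD1,
        rotated 2])
  have "(\<Sum>S\<in>Pow {..<length (x # I)}. f (nths (x # I) S) (nths (x # I) (- S))) =
     (\<Sum>S\<in>?P. f (nths (x # I) (Suc ` S)) (nths (x # I) (- (Suc ` S))))
   + (\<Sum>S\<in>?P. f (nths (x # I) (insert 0 (Suc ` S))) (nths (x # I) (- insert 0 (Suc ` S))))"
    unfolding P
        by (subst sum.union_disjoint) (auto simp: sum.reindex[OF inj(1)] sum.reindex[OF inj(2)])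
  also have "\<dots> = (\<Sum>S\<in>?P. f (nths I S) (x # nths I (- S)))
      + (\<Sum>S\<in>?P. f (x # nths I S) (nths I (- S)))"
  proof -
    have "{j. Suc j \<in> Suc ` S} = S" "{j. Suc j \<in> - Suc ` S}
        = - S" "{j. Suc j \<in> insert 0 (Suc ` S)} = S"
      "{j. Suc j \<in> - insert 0 (Suc ` S)} = - S" for S by auto
    then show ?thesis by (simp add: nths_Cons)
  qed
  also have "\<dots> = split_sum f (x # I)"
    using Cons.IH[of "\<lambda>A B. f A (x # B)"] Cons.IH[of "\<lambda>A B. f (x # A) B"] by (simp add: add.commute)
  finally show ?case .
qed simp

lemma sum_lessThan_pick_sum:
  "(\<Sum>i<length I. f (I ! i) (take i I @ drop (Suc i) I)) = pick_sum f I"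
proof (induction I arbitrary: f)
  case (Cons x I)
  show ?case using Cons.IH[of "\<lambda>y Y. f y (x # Y)"]
    by (simp only: list.size sum.lessThan_Suc_shift add_0_right add_Suc_right) simp
qed simp

lemma mon_append: "length A = length C \<Longrightarrow> mon (A @ B) (C @ D) = mon A C * mon B D"
  by (induction A C rule: list_induct2) auto

text \<open>Here the symmetry of the coefficients enters the analysis: the loop equation evaluates a
  correlator at \<open>I[i := s]\<close>, whereas derivatives of the series are taken in the first
  argument.\<close>

lemma ev_move_front:
  assumes perm: "\<And>K K'. mset K = mset K' \<Longrightarrow> a K = a K'"
  shows "ev a (A @ s # B) = ev a (s # A @ B)"
proof -
  define i where "i = length A"
  have K: "\<exists>C k D. K = C @ k # D \<and> length C = i \<and> length D = length B" if "K \<in> idx (i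
      + Suc (length B))" for K
    using that id_take_nth_drop[of i K]
        by (intro exI[of _ "take i K"] exI[of _ "K ! i"] exI[of _ "drop (Suc i) K"])
            (auto simp: idx_def)
  have L: "\<exists>k C D. L = k # C @ D \<and> length C = i \<and> length D = length B" if in_idx: "L \<in> idx (i
      + Suc (length B))" for L
  proof -
    obtain k M where "L = k # M" "length M = i + length B" using in_idx
        by (cases L) (auto simp: idx_def)
    then show ?thesis by (intro exI[of _ k] exI[of _ "take i M"] exI[of _ "drop i M"]) auto
  qed
  show ?thesis unfolding ev_def
  proof (rule infsum_reindex_bij_witness[of _ "\<lambda>L. take i (tl L) @ hd L # drop i (tl L)"
      "\<lambda>K. K ! i # take i K @ drop (Suc i) K"], goal_cases)
    case (1 K) then show ?case using K[of K] by (auto simp: nth_append i_def[symmetric])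
  next
    case (2 K) then show ?case using K[of K] by (auto simp: nth_append i_def[symmetric] idx_def)
  next
    case (3 L) then show ?case using L[of L] by (auto simp: nth_append i_def[symmetric])
  next
    case (4 L) then show ?case using L[of L] by (auto simp: i_def[symmetric] idx_def)
  next
    case (5 K)
    then obtain C k D where C: "K = C @ k # D" "length C = i" "length D = length B" using K[of K]
        by (auto simp: i_def)
    have "a (k # C @ D) = a K" by (rule perm) (simp add: C)
    moreover have "mon (s # A @ B) (k # C @ D) = mon (A @ s # B) K"
      using C by (simp add: mon_append i_def)
    ultimately show ?case using C by (simp add: nth_append)
  qed
qed

lemma mon_eq_prod: "length q = length K \<Longrightarrow> mon q K = (\<Prod>i<length q. (1 / q ! i) ^ Suc (K ! i))"
  by (induction q K rule: list_induct2) (simp_all add: prod.lessThan_Suc_shift del: power_Suc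
      prod.lessThan_Suc)

lemma mon_replicate: "length K = n \<Longrightarrow> mon (replicate n x) K = (1 / x) ^ (sum_list K + n)"
  by (induction n arbitrary: K) (auto simp: length_Suc_conv power_add)

lemma norm_mon_le:
  assumes "length q = length K" "\<And>x. x \<in> set q \<Longrightarrow> R \<le> cmod x" "0 < R"
  shows "cmod (mon q K) \<le> (1 / R) ^ (sum_list K + length q)"
  using assms(1,2)
proof (induction q K rule: list_induct2)
  case (Cons x q k K)
  have "cmod (mon (x # q) (k # K)) = (1 / cmod x) ^ Suc k * cmod (mon q K)"
    by (simp add: norm_mult norm_divide norm_power)
  also have "\<dots> \<le> (1 / R) ^ Suc k * (1 / R) ^ (sum_list K + length q)"
  proof -
    have "R \<le> cmod x" using Cons.prems by simp
    moreover have "cmod (mon q K) \<le> (1 / R) ^ (sum_list K + length q)" using Cons by simp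
    ultimately show ?thesis
      using assms(3)
          by (intro mult_mono power_mono divide_left_mono mult_pos_pos) (linarith | simp)+
  qed
  finally show ?case by (simp add: power_add ac_simps)
qed simp

section \<open>Limits through points with distinct coordinates\<close>

lemma eventually_near_filter:
  "eventually P (near_filter T n p) \<longleftrightarrow>
     (\<exists>e>0. \<forall>q\<in>generic_pts T n. (\<forall>i<n. dist (q ! i) (p ! i) < e) \<longrightarrow> P q)"
proof -
  have "eventually P (near_filter T n p) \<longleftrightarrow>
    (\<exists>e\<in>{0<..}. eventually P (principal {q \<in> generic_pts T n. \<forall>i<n. dist (q ! i) (p ! i) < e}))"
    unfolding near_filter_def
  proof (rule eventually_INF_base)
    fix a b :: real assume "a \<in> {0<..}" "b \<in> {0<..}"
    then show "\<exists>x\<in>{0<..}. principal {q \<in> generic_pts T n. \<forall>i<n. dist (q ! i) (p ! i) < x}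
      \<le> inf (principal {q \<in> generic_pts T n. \<forall>i<n. dist (q ! i) (p ! i) < a})
            (principal {q \<in> generic_pts T n. \<forall>i<n. dist (q ! i) (p ! i) < b})"
      by (intro bexI[of _ "min a b"]) auto
  qed auto
  then show ?thesis by (simp add: eventually_principal Bex_def Ball_def imp_conjL)
qed

text \<open>A nonempty open set in a perfect space is infinite, so each coordinate can avoid those
  already chosen. This makes the limit filter nontrivial, without which \<open>Lim\<close> would not
  be determined.\<close>

lemma exists_distinct_near:
  fixes p :: "'a::{real_normed_vector, perfect_space} list"
  assumes "open U" "set p \<subseteq> U" "0 < e"
  shows "\<exists>q. length q = length p \<and> distinct q \<and> set q \<subseteq> U \<and> (\<forall>i<length p. dist (q ! i) (p ! i) < e)"
  using assms(2)
proof (induction p)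
  case (Cons x p)
  then obtain q where q: "length q
      = length p" "distinct q" "set q \<subseteq> U" "\<forall>i<length p. dist (q ! i) (p ! i) < e" by auto
  have "open (ball x e \<inter> U)" using assms by auto
  moreover have "ball x e \<inter> U \<noteq> {}" using assms Cons.prems by force
  ultimately have "\<not> finite (ball x e \<inter> U)" using finite_imp_not_open by auto
  then have "\<not> ball x e \<inter> U \<subseteq> set q" using finite_subset[OF _ List.finite_set] by auto
  then obtain z where "z \<in> ball x e \<inter> U" "z \<notin> set q" by blast
  then show ?case using q
      by (intro exI[of _ "z # q"]) (auto simp: nth_Cons dist_commute split: nat.split)
qed simp

text \<open>Nearness of lists is given by a filter, so continuity at \<open>p\<close> is phrased as
  convergence along \<open>G\<close> to the value at \<open>p\<close>. The point \<open>p\<close>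
  must be in \<open>S\<close> even when it is not generic.\<close>

lemma tendsto_uniform_limit:
  assumes "uniform_limit S f h F" "F \<noteq> bot" "eventually (\<lambda>q. q \<in> S) G" "p \<in> S"
    and "eventually (\<lambda>n. (f n \<longlongrightarrow> f n p) G) F"
  shows "(h \<longlongrightarrow> (h p :: 'a::metric_space)) G"
proof (rule tendstoI)
  fix e :: real assume "e > 0"
  then have "eventually (\<lambda>n. \<forall>q\<in>S. dist (f n q) (h q) < e / 3) F" using assms(1)
      by (intro uniform_limitD) auto
  with assms(5) have "eventually (\<lambda>n. (f n \<longlongrightarrow> f n p) G \<and> (\<forall>q\<in>S. dist (f n q) (h q) < e / 3)) F"
    by eventually_elim auto
  then obtain n where n: "(f n \<longlongrightarrow> f n p) G" "\<And>q. q \<in> S \<Longrightarrow> dist (f n q) (h q) < e / 3"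
    using assms(2) eventually_happens' by blast
  have "eventually (\<lambda>q. dist (f n q) (f n p) < e / 3) G"
      using tendstoD[OF n(1), of "e / 3"] \<open>e > 0\<close> by simp
  with assms(3) show "eventually (\<lambda>q. dist (h q) (h p) < e) G"
  proof eventually_elim
    case (elim q)
    have "dist (h q) (h p) \<le> dist (h q) (f n q) + dist (f n q) (f n p) + dist (f n p) (h p)"
      by (meson add_right_mono dist_triangle order_trans)
    then show ?case using elim n(2)[of q] n(2)[of p] assms(4) by (simp add: dist_commute)
  qed
qed

context
  fixes T :: real and hbar :: complex
  assumes T_pos: "0 < T"
begin

lemma open_ext_disc: "open (ext_disc T)"
  unfolding ext_disc_def by (intro open_Collect_less continuous_intros)

lemma ext_disc_subset_cut_dom: "ext_disc T \<subseteq> cut_dom T"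
  by (auto simp: ext_disc_def cut_dom_def)

lemma near_filter_nontrivial:
  assumes "length p = n" "set p \<subseteq> ext_disc T"
  shows "near_filter T n p \<noteq> bot"
proof
  assume "near_filter T n p = bot"
  then have "eventually (\<lambda>_. False) (near_filter T n p)" by simp
  then obtain e where e: "e > 0" "\<And>q. q \<in> generic_pts T n \<Longrightarrow> \<not> (\<forall>i<n. dist (q ! i) (p ! i) < e)"
    unfolding eventually_near_filter by auto
  obtain q where "length q = n" "distinct q" "set q \<subseteq> ext_disc T" "\<forall>i<n. dist (q ! i) (p ! i) < e"
    using exists_distinct_near[OF open_ext_disc assms(2) e(1)] assms(1) by auto
  then show False using e(2)[of q] ext_disc_subset_cut_dom by (auto simp: generic_pts_def)
qed

text \<open>A radius strictly below all |x_i| leaves room for a neighbourhood of the points on which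
  one convergent majorant serves.\<close>

lemma radius_below:
  assumes "set p \<subseteq> ext_disc T"
  obtains R where "2 * sqrt T < R" "0 < R" "\<And>x. x \<in> set p \<Longrightarrow> R < cmod x"
proof -
  have "\<exists>R. 2 * sqrt T < R \<and> (\<forall>x\<in>set p. R < cmod x)" using assms
  proof (induction p)
    case (Cons x p)
    then obtain R where R: "2 * sqrt T < R" "\<forall>x\<in>set p. R < cmod x" by auto
    have "2 * sqrt T < min R (cmod x)" using R Cons.prems by (auto simp: ext_disc_def)
    then obtain R' where "2 * sqrt T < R'" "R' < min R (cmod x)" using dense by blast
    then show ?case using R by (intro exI[of _ R']) auto
  qed (auto intro: gt_ex)
  then obtain R where R: "2 * sqrt T < R" "\<forall>x\<in>set p. R < cmod x" by blast
  moreover have "0 < R" using T_pos R(1) by (intro le_less_trans[of 0 "2 * sqrt T"]) auto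
  ultimately show ?thesis using that by blast
qed

lemma eventually_near_radius:
  assumes "length p = n" "\<And>x. x \<in> set p \<Longrightarrow> R < cmod x"
  shows "eventually (\<lambda>q. q \<in> generic_pts T n \<and> (\<forall>x\<in>set q. R < cmod x)) (near_filter T n p)"
proof -
  have "\<exists>e>0. \<forall>x\<in>set p. e \<le> cmod x - R" using assms(2)
  proof (induction p)
    case (Cons x p)
    then obtain e where e: "e > 0" "\<forall>x\<in>set p. e \<le> cmod x - R" by auto
    then show ?case using Cons.prems by (intro exI[of _ "min e (cmod x - R)"]) auto
  qed (auto intro: exI[of _ 1])
  then obtain e where e: "e > 0" "\<forall>x\<in>set p. e \<le> cmod x - R" by blast
  show ?thesis unfolding eventually_near_filter
  proof (intro exI[of _ e] conjI ballI impI)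
    fix q x assume q: "q \<in> generic_pts T n" "\<forall>i<n. dist (q ! i) (p ! i) < e" and "x \<in> set q"
    then obtain i where i: "i < n" "x = q ! i" by (auto simp: in_set_conv_nth generic_pts_def)
    have "cmod (p ! i) - cmod x \<le> dist x (p ! i)"
        by (metis dist_commute dist_norm norm_triangle_ineq2)
    also have "\<dots> < e" using q i by auto
    also have "e \<le> cmod (p ! i) - R" using e(2) i assms(1) by simp
    finally show "R < cmod x" by simp
  qed (use e in auto)
qed

lemma summable_radius:
  assumes "good T n a" "2 * sqrt T < R" "0 < R"
  shows "(\<lambda>K. cmod (a K) * (1 / R) ^ (sum_list K + n)) summable_on idx n"
proof -
  have "(\<lambda>K. a K * mon (replicate n (complex_of_real R)) K) summable_on idx n"
    using assms(1)[unfolded good_def, rule_format, of "replicate n (complex_of_real R)"] assms(2,3)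
    by (auto simp: ext_disc_def set_replicate_conv_if)
  then have "(\<lambda>K. cmod (a K * mon (replicate n (complex_of_real R)) K)) summable_on idx n"
    by (simp only: summable_on_iff_abs_summable_on_complex)
  then show ?thesis
    by (rule summable_on_cong[THEN iffD1, rotated])
       (use assms in \<open>auto simp: idx_def mon_replicate norm_mult norm_divide norm_power\<close>)
qed

lemma tendsto_ev:
  assumes "good T n a" "length p = n" "set p \<subseteq> ext_disc T"
  shows "(ev a \<longlongrightarrow> ev a p) (near_filter T n p)"
proof -
  obtain R where R: "2 * sqrt T < R" "0 < R" "\<And>x. x \<in> set p \<Longrightarrow> R < cmod x"
    using radius_below[OF assms(3)] by blast
  define S where "S = {q. length q = n \<and> (\<forall>x\<in>set q. R < cmod x)}"
  define h where "h q = (\<Sum>\<^sub>\<infinity>K\<in>idx n. a K * mon q K)" for q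
  have ul: "uniform_limit S (\<lambda>X q. \<Sum>K\<in>X. a K * mon q K) h (finite_subsets_at_top (idx n))"
    unfolding h_def
  proof (rule Weierstrass_m_test_general[OF _ summable_radius[OF assms(1) R(1,2)]])
    fix K q assume "K \<in> idx n" "q \<in> S"
    then have "length q = n" "length K = n" "\<forall>x\<in>set q. R < cmod x" by (auto simp: S_def idx_def)
    then have "cmod (mon q K) \<le> (1 / R) ^ (sum_list K + n)"
      using norm_mon_le[of q K R] R(2) by (simp add: less_imp_le)
    then show "cmod (a K * mon q K) \<le> cmod (a K) * (1 / R) ^ (sum_list K + n)"
      by (simp add: norm_mult mult_left_mono)
  qed
  have S: "eventually (\<lambda>q. q \<in> S) (near_filter T n p)"
    using eventually_near_radius[OF assms(2) R(3)]
        by (rule eventually_mono) (auto simp: S_def generic_pts_def)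
  have mon: "((\<lambda>q. mon q K) \<longlongrightarrow> mon p K) (near_filter T n p)" if "K \<in> idx n" for K
  proof -
    have "((\<lambda>q. q ! i) \<longlongrightarrow> p ! i) (near_filter T n p)" if "i < n" for i
      using that by (intro tendstoI) (auto simp: eventually_near_filter)
    moreover have "p ! i \<noteq> 0" if "i < n" for i using R(2) R(3)[of "p ! i"] that assms(2) by auto
    ultimately have "((\<lambda>q. \<Prod>i<n. (1 / q ! i) ^ Suc (K ! i))
        \<longlongrightarrow> (\<Prod>i<n. (1 / p ! i) ^ Suc (K ! i))) (near_filter T n p)"
      by (intro tendsto_prod tendsto_power tendsto_divide tendsto_const) auto
    then have 1: "((\<lambda>q. \<Prod>i<n. (1 / q ! i) ^ Suc (K ! i)) \<longlongrightarrow> mon p K) (near_filter T n p)"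
        using that assms(2) mon_eq_prod[of p K] by (simp add: idx_def)
    have "eventually (\<lambda>q. (\<Prod>i<n. (1 / q ! i) ^ Suc (K ! i)) = mon q K) (near_filter T n p)"
      using S by (rule eventually_mono) (use that mon_eq_prod[of _ K] in \<open>auto simp: S_def idx_def\<close>)
    with 1 show ?thesis by (rule Lim_transform_eventually)
  qed
  have "(h \<longlongrightarrow> h p) (near_filter T n p)"
  proof (rule tendsto_uniform_limit[OF ul _ S])
    show "p \<in> S" using assms(2) R(3) by (auto simp: S_def)
    show "eventually (\<lambda>X. ((\<lambda>q. \<Sum>K\<in>X. a K * mon q K) \<longlongrightarrow> (\<Sum>K\<in>X. a K * mon p K)) (near_filter T n p))
        (finite_subsets_at_top (idx n))"
      by (rule eventually_finite_subsets_at_top_weakI)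
          (intro tendsto_sum tendsto_mult tendsto_const mon, auto)
  qed simp
  then have 1: "(h \<longlongrightarrow> ev a p) (near_filter T n p)" using assms(2) by (simp add: h_def ev_def)
  have "eventually (\<lambda>q. h q = ev a q) (near_filter T n p)"
    using S by (rule eventually_mono) (auto simp: S_def h_def ev_def)
  with 1 show ?thesis by (rule Lim_transform_eventually)
qed

text \<open>The functions differentiated in the loop equation are known only on
  \<open>ext_disc\<close>; as this set is open, agreement there fixes the derivative.\<close>

lemma deriv_ev:
  assumes "good T (Suc (length I)) a" "x \<in> ext_disc T" "set I \<subseteq> ext_disc T"
    and "\<And>t. t \<in> ext_disc T \<Longrightarrow> f t = ev a (t # I)"
  shows "deriv f x = - neg_deriv a x I"
  by (rule DERIV_imp_deriv, rule has_field_derivative_transform_within_open[OF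
      ev_has_field_derivative[OF T_pos assms(1-3)] open_ext_disc assms(2)])
     (simp add: assms(4))

lemma deriv_divided_difference:
  assumes "good T (Suc (length Y)) a" "x \<in> ext_disc T" "s \<in> ext_disc T" "set Y \<subseteq> ext_disc T" "x \<noteq> s"
    and "\<And>t. t \<in> ext_disc T \<Longrightarrow> f t = (ev a (x # Y) - ev a (t # Y)) / (x - t)"
  shows "deriv f s = divdiff a x s Y"
proof (rule DERIV_imp_deriv, rule has_field_derivative_transform_within_open[OF _ open_ext_disc
    assms(3)])
  have "((\<lambda>t. (ev a (x # Y) - ev a (t # Y)) / (x - t)) has_field_derivative
     ((0 - - neg_deriv a s Y) * (x - s)
         - (ev a (x # Y) - ev a (s # Y)) * (0 - 1)) / ((x - s) * (x - s))) (at s)"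
    by (intro DERIV_divide DERIV_diff DERIV_const DERIV_ident ev_has_field_derivative[OF T_pos
        assms(1,3,4)]) (use assms(5) in auto)
  then show "((\<lambda>t. (ev a (x # Y) - ev a (t # Y)) / (x - t)) has_field_derivative divdiff a x s Y)
      (at s)"
    unfolding divdiff_eq[OF T_pos assms(1-5)] by (simp add: power2_eq_square algebra_simps)
qed (use assms(6) in simp)

text \<open>The divided differences only ask that \<open>x\<close> differ from the entries of
  \<open>I\<close>. The argument \<open>x # x # I\<close> is never generic, but \<open>W\<close> is
  assumed to agree with the series on the diagonals too.\<close>

lemma loop_rhs_eq:
  assumes W: "\<And>n' g' q. 1 \<le> n' \<Longrightarrow> 2 * g' + n' < 2 * g + Suc (length I) \<Longrightarrow> length q = n'
      \<Longrightarrow> set q \<subseteq> ext_disc T \<Longrightarrow> W n' g' q = ev (Wcoeff T hbar g') q"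
    and x: "x \<in> ext_disc T" "set I \<subseteq> ext_disc T" "x \<notin> set I"
  shows "loop_rhs T hbar W (Suc (length I)) g (x # I) = src_ev T hbar g x I"
proof -
  note good = good_Wcoeff[OF T_pos, of _ hbar]
  have 1: "hbar * deriv (\<lambda>t. W (Suc (length I)) (g - 1) (t # I)) x
      = - hbar * neg_deriv (Wcoeff T hbar (g - 1)) x I" if "1 \<le> g"
    by (subst deriv_ev[OF good x(1,2)]) (use that x in \<open>auto intro!: W\<close>)
  have 2: "W (Suc (length I) + 1) (g - 2) (x # x # I)
      = ev (Wcoeff T hbar (g - 2)) (x # x # I)" if "2 \<le> g"
    using that x by (intro W) auto
  have "(\<Sum>S\<in>Pow {..<length I}. \<Sum>p\<in>{0..g}. if (S = {} \<and> p = 0) \<or> (S = {..<length I} \<and> p = g) then 0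
          else W (card S + 1) p (x # nths I S) * W (Suc (length I) - card S) (g - p)
              (x # nths I (- S)))
     = (\<Sum>S\<in>Pow {..<length I}. \<Sum>p\<le>g. wt g p (length (nths I S)) (length (nths I (- S))) *
       (ev (Wcoeff T hbar p) (x # nths I S) * ev (Wcoeff T hbar (g - p)) (x # nths I (- S))))"
  proof (rule sum.cong[OF refl], rule sum.cong)
    fix S p assume S: "S \<in> Pow {..<length I}" and p: "p \<in> {..g}"
    have fin: "finite S" using S finite_subset by auto
    have "{i. i < length I \<and> i \<in> S} = S" using S by auto
    then have l1: "length (nths I S) = card S" by (simp add: length_nths)
    have "{i. i < length I \<and> i \<in> - S} = {..<length I} - S" by auto
    then have l2: "length (nths I (- S)) = length I - card S" using S fin
        by (simp add: length_nths card_Diff_subset)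
    have c: "card S \<le> length I" using S card_mono[of "{..<length I}" S] by auto
    \<comment> \<open>\<open>wt\<close> sees only lengths, and the size of a set of positions
      decides whether it is empty or full.\<close>
    have full: "S = {..<length I} \<longleftrightarrow> length I - card S = 0"
      using S c card_subset_eq[of "{..<length I}" S] by auto
    have empty: "S = {} \<longleftrightarrow> card S = 0" using fin by auto
    show "(if (S = {} \<and> p = 0) \<or> (S = {..<length I} \<and> p = g) then 0
          else W (card S + 1) p (x # nths I S) * W (Suc (length I) - card S) (g - p)
              (x # nths I (- S)))
      = wt g p (length (nths I S)) (length (nths I (- S))) * (ev (Wcoeff T hbar p) (x # nths I S)
        * ev (Wcoeff T hbar (g - p)) (x # nths I (- S)))"
    proof (cases "(S = {} \<and> p = 0) \<or> (S = {..<length I} \<and> p = g)")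
      case True
      then have "wt g p (length (nths I S)) (length (nths I (- S))) = 0"
          unfolding l1 l2 wt_def full empty by auto
      then show ?thesis using True by simp
    next
      case False
      have w: "wt g p (length (nths I S)) (length (nths I (- S))) = 1"
        using False unfolding l1 l2 wt_def full empty by auto
      have o: "0 < card S \<or> 0 < p" "0 < length I - card S \<or> p < g" using False p
          unfolding full empty by auto
      have sub: "set (nths I A) \<subseteq> ext_disc T" for A using x(2) set_nths_subset[of I A] by auto
      have "2 * p + (card S + 1) < 2 * g + Suc (length I)" using o(2) p c by (simp, arith)
      then have a: "W (card S + 1) p (x # nths I S) = ev (Wcoeff T hbar p) (x # nths I S)"
        by (intro W) (use x sub l1 in auto)
      have "2 * (g - p) + (Suc (length I) - card S) < 2 * g + Suc (length I)" using o(1) p c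
          by (simp, arith)
      then have b: "W (Suc (length I) - card S) (g - p) (x # nths I (- S))
          = ev (Wcoeff T hbar (g - p)) (x # nths I (- S))"
        by (intro W) (use x sub l2 c in auto)
      show ?thesis unfolding a b w if_not_P[OF False] by simp
    qed
  qed auto
  also have "\<dots>
      = (\<Sum>p\<le>g. \<Sum>S\<in>Pow {..<length I}. wt g p (length (nths I S)) (length (nths I (- S))) *
        (ev (Wcoeff T hbar p) (x # nths I S) * ev (Wcoeff T hbar (g - p)) (x # nths I (- S))))"
    by (rule sum.swap)
  also have "\<dots>
      = (\<Sum>p\<le>g. split_sum (\<lambda>A B. wt g p (length A) (length B) * (ev (Wcoeff T hbar p) (x # A) * ev
        (Wcoeff T hbar (g - p)) (x # B))) I)"
    by (rule sum.cong[OF refl], rule sum_Pow_nths)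
  finally have 3: "(\<Sum>S\<in>Pow {..<length I}. \<Sum>p\<in>{0..g}. if (S = {} \<and> p = 0) \<or> (S = {..<length I} \<and> p
      = g) then 0
          else W (card S + 1) p (x # nths I S) * W (Suc (length I) - card S) (g - p)
              (x # nths I (- S))) = \<dots>" .
  have "(\<Sum>i<length I. deriv (\<lambda>s. (W (length I) g (x # (take i I @ drop (Suc i) I)) - W
      (length I) g (I[i := s])) / (x - s)) (I ! i))
    = (\<Sum>i<length I. divdiff (Wcoeff T hbar g) x (I ! i) (take i I @ drop (Suc i) I))"
  proof (rule sum.cong[OF refl])
    fix i assume "i \<in> {..<length I}"
    then have i: "i < length I" by simp
    define Y where "Y = take i I @ drop (Suc i) I"
    have lY: "length I = Suc (length Y)" using i by (simp add: Y_def)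
    have Y: "set Y \<subseteq> ext_disc T" using x(2) set_take_subset[of i I] set_drop_subset[of "Suc i" I]
        by (auto simp: Y_def)
    have s: "I ! i \<in> ext_disc T" "x \<noteq> I ! i" using i x by (auto dest: nth_mem)
    have "deriv (\<lambda>s. (W (length I) g (x # Y) - W (length I) g (I[i := s])) / (x - s)) (I ! i)
        = divdiff (Wcoeff T hbar g) x (I ! i) Y"
    proof (rule deriv_divided_difference[OF _ x(1) s(1) Y s(2)])
      fix t assume t: "t \<in> ext_disc T"
      have "W (length I) g (x # Y) = ev (Wcoeff T hbar g) (x # Y)" by (rule W) (use x Y lY in auto)
      moreover have "W (length I) g (I[i := t]) = ev (Wcoeff T hbar g) (I[i := t])"
        by (rule W) (use x(2) t lY set_update_subset_insert[of I i t] in auto)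
      moreover have "ev (Wcoeff T hbar g) (I[i := t]) = ev (Wcoeff T hbar g) (t # Y)"
        unfolding upd_conv_take_nth_drop[OF i] Y_def by (rule ev_move_front) (rule Wcoeff_perm)
      ultimately show "(W (length I) g (x # Y) - W (length I) g (I[i := t])) / (x - t)
          = (ev (Wcoeff T hbar g) (x # Y) - ev (Wcoeff T hbar g) (t # Y)) / (x - t)"
        by simp
    qed (use good in auto)
    then show "deriv (\<lambda>s. (W (length I) g (x # (take i I @ drop (Suc i) I)) - W (length I) g
        (I[i := s])) / (x - s)) (I ! i)
      = divdiff (Wcoeff T hbar g) x (I ! i) (take i I @ drop (Suc i) I)" by (simp only: Y_def)
  qed
  also have "\<dots> = pick_sum (divdiff (Wcoeff T hbar g) x) I" by (rule sum_lessThan_pick_sum)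
  finally have 4: "(\<Sum>i<length I. deriv (\<lambda>s. (W (length I) g (x # (take i I @ drop (Suc i) I)) - W
      (length I) g (I[i := s])) / (x - s)) (I ! i)) = \<dots>" .
  show ?thesis
    unfolding loop_rhs_def src_ev_def[OF T_pos] Let_def list.sel diff_Suc_1 3 4
    using 1 2 by (intro arg_cong2[where f = "(+)"] if_cong refl)
qed

text \<open>Any number of steps from 2g + n on yields the same value; this slack lets the hypothesis
  for \<open>N\<close> serve all correlators of smaller order. For \<open>N = 0\<close> there is
  nothing to prove, as \<open>n\<close> is positive.\<close>

lemma funpow_W_step_eq:
  "1 \<le> n \<Longrightarrow> 2 * g + n \<le> N \<Longrightarrow> length p = n \<Longrightarrow> set p \<subseteq> ext_disc T \<Longrightarrow>
     ((W_step T hbar) ^^ N) (\<lambda>_ _ _. 0) n g p = ev (Wcoeff T hbar g) p"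
proof (induction N arbitrary: n g p)
  case (Suc N)
  define W where "W = ((W_step T hbar) ^^ N) (\<lambda>_ _ _. 0)"
  have W: "W n' g' q = ev (Wcoeff T hbar g') q" if "1 \<le> n'" "2 * g' + n' < 2 * g + n" "length q
      = n'" "set q \<subseteq> ext_disc T" for n' g' q
    unfolding W_def by (rule Suc.IH) (use that Suc.prems in auto)
  obtain x I where p: "p = x # I" using Suc.prems by (cases p) auto
  have n: "n = Suc (length I)" using p Suc.prems by simp
  have "W_step T hbar W n g p = ev (Wcoeff T hbar g) p"
  proof (cases "n = 1 \<and> g = 0")
    case True
    then show ?thesis using ybr_eq(1)[OF T_pos, of x hbar] Suc.prems p n by (simp add: W_step_def)
  next
    case False
    have 1: "eventually (\<lambda>q. ev (Wcoeff T hbar g) q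
        = loop_rhs T hbar W n g q / ybr T (hd q)) (near_filter T n p)"
    proof -
      obtain R where R: "2 * sqrt T < R" "0 < R" "\<And>x. x \<in> set p \<Longrightarrow> R < cmod x"
        using radius_below[OF Suc.prems(4)] by blast
      show ?thesis using eventually_near_radius[OF Suc.prems(3) R(3)]
      proof (rule eventually_mono)
        fix q assume "q \<in> generic_pts T n \<and> (\<forall>x\<in>set q. R < cmod x)"
        then have q: "length q = n" "distinct q" "set q \<subseteq> ext_disc T" using R(1)
            by (auto simp: generic_pts_def ext_disc_def)
        then obtain y J where qJ: "q = y # J" using n by (cases q) auto
        have nJ: "n = Suc (length J)" using q qJ by simp
        have "loop_rhs T hbar W n g q = src_ev T hbar g y J"
          unfolding qJ nJ by (rule loop_rhs_eq) (use W q qJ nJ in auto)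
        also have "\<dots> = ybr T y * ev (Wcoeff T hbar g) (y # J)"
          using False nJ q qJ by (intro loop_equation[OF T_pos, symmetric]) auto
        finally show "ev (Wcoeff T hbar g) q = loop_rhs T hbar W n g q / ybr T (hd q)"
          using ybr_eq(2)[OF T_pos, of y] q qJ by simp
      qed
    qed
    \<comment> \<open>The loop equation has been used at generic points near \<open>p\<close>;
      continuity of the series turns it into the value at \<open>p\<close>, diagonal or not.\<close>
    have "(ev (Wcoeff T hbar g) \<longlongrightarrow> ev (Wcoeff T hbar g) p) (near_filter T n p)"
      by (rule tendsto_ev) (use Suc.prems good_Wcoeff[OF T_pos] in auto)
    then have "((\<lambda>q. loop_rhs T hbar W n g q / ybr T (hd q))
        \<longlongrightarrow> ev (Wcoeff T hbar g) p) (near_filter T n p)"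
      by (rule Lim_transform_eventually[OF _ 1])
    then have "Lim (near_filter T n p) (\<lambda>q. loop_rhs T hbar W n g q / ybr T (hd q))
        = ev (Wcoeff T hbar g) p"
      by (rule tendsto_Lim[OF near_filter_nontrivial[OF Suc.prems(3,4)]])
    then show ?thesis using False by (simp only: W_step_def if_False)
  qed
  then show ?case by (simp add: W_def)
qed simp

lemma Wcorr_eq:
  "1 \<le> n \<Longrightarrow> length p = n \<Longrightarrow> set p \<subseteq> ext_disc T \<Longrightarrow> Wcorr T hbar n g p = ev (Wcoeff T hbar g) p"
  unfolding Wcorr_def by (rule funpow_W_step_eq) auto

section \<open>Decay when all arguments coincide\<close>

lemma ev_replicate_bound:
  assumes "1 \<le> n"
  obtains C where "\<And>x. 2 * sqrt T + 1 \<le> cmod x \<Longrightarrow> cmod (ev (Wcoeff T hbar g) (replicate n x))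
      \<le> C * (1 / cmod x) ^ (3 * n + 2 * g - 2)"
proof -
  define R where "R = 2 * sqrt T + 1"
  define d where "d = 3 * n + 2 * g - 2"
  have R: "2 * sqrt T < R" "0 < R" using T_pos by (auto simp: R_def add_nonneg_pos)
  have good: "good T n (Wcoeff T hbar g)" using good_Wcoeff[OF T_pos assms] .
  define B where "B = (\<Sum>\<^sub>\<infinity>K\<in>idx n. cmod (Wcoeff T hbar g K) * (1 / R) ^ (sum_list K + n))"
  have B: "((\<lambda>K. cmod (Wcoeff T hbar g K) * (1 / R) ^ (sum_list K + n)) has_sum B) (idx n)"
    unfolding B_def by (rule has_sum_infsum[OF summable_radius[OF good R]])
  have "cmod (ev (Wcoeff T hbar g) (replicate n x)) \<le> (R ^ d * B) * (1 / cmod x) ^ d" if x: "R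
      \<le> cmod x" for x
  proof -
    have h: "((\<lambda>K. Wcoeff T hbar g K * mon (replicate n x) K)
        has_sum ev (Wcoeff T hbar g) (replicate n x)) (idx n)"
      using has_sum_ev[OF T_pos, of "replicate n x" "Wcoeff T hbar g"] good x R
          by (auto simp: ext_disc_def set_replicate_conv_if)
    have "((\<lambda>K. R ^ d * (1 / cmod x) ^ d * (cmod (Wcoeff T hbar g K) * (1 / R) ^ (sum_list K
        + n))) has_sum R ^ d * (1 / cmod x) ^ d * B) (idx n)"
      by (rule has_sum_cmult_right[OF B])
    with h have "cmod (ev (Wcoeff T hbar g) (replicate n x)) \<le> R ^ d * (1 / cmod x) ^ d * B"
    proof (rule norm_infsum_le)
      fix K assume "K \<in> idx n"
      then have K: "length K = n" by (simp add: idx_def)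
      show "cmod (Wcoeff T hbar g K * mon (replicate n x) K)
          \<le> R ^ d * (1 / cmod x) ^ d * (cmod (Wcoeff T hbar g K) * (1 / R) ^ (sum_list K + n))"
      proof (cases "Wcoeff T hbar g K = 0")
        case False
        have "\<not> sum_list K + 2 < 2 * length K + 2 * g"
            using Wcoeff_vanish[of K g T hbar] False K assms by (cases K) auto
        \<comment> \<open>The bound on the weight, plus \<open>n\<close> from the shift of the
          exponents by one.\<close>
        then have "d \<le> sum_list K + n" using K by (simp add: d_def)
        then obtain j where j: "sum_list K + n = d + j" using le_Suc_ex by blast
        \<comment> \<open>The first \<open>d\<close> powers give the decay. The surplus
          \<open>j\<close> powers are bounded at the fixed radius \<open>R\<close>, where the
          coefficients are summable; the price is the constant \<open>R ^ d\<close>.\<close>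
        have "(1 / cmod x) ^ (d + j) \<le> (1 / cmod x) ^ d * (1 / R) ^ j"
          unfolding power_add using x R
              by (intro mult_left_mono power_mono divide_left_mono mult_pos_pos) auto
        also have "\<dots> = R ^ d * (1 / cmod x) ^ d * (1 / R) ^ (d + j)"
          using R by (simp add: power_add field_simps)
        finally have "cmod (Wcoeff T hbar g K) * (1 / cmod x) ^ (d + j)
            \<le> cmod (Wcoeff T hbar g K) * (R ^ d * (1 / cmod x) ^ d * (1 / R) ^ (d + j))"
          by (rule mult_left_mono) simp
        then show ?thesis unfolding j[symmetric]
            by (simp add: mon_replicate[OF K] norm_mult norm_power norm_divide ac_simps)
      qed simp
    qed
    then show ?thesis by (simp add: ac_simps)
  qed
  then show ?thesis using that unfolding d_def R_def by blast
qed

end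

theorem theorem2:
  fixes T :: real and hbar :: complex and n g :: nat
  assumes "T > 0" and "1 \<le> n"
  shows "(\<lambda>x. Wcorr T hbar n g (replicate n x)) \<in> O[at_infinity](\<lambda>x. 1 / x ^ (3 * n + 2 * g - 2))"
proof -
  obtain C where C: "\<And>x. 2 * sqrt T + 1 \<le> cmod x \<Longrightarrow>
      cmod (ev (Wcoeff T hbar g) (replicate n x)) \<le> C * (1 / cmod x) ^ (3 * n + 2 * g - 2)"
    using ev_replicate_bound[OF assms] by blast
  show ?thesis
  proof (rule bigoI[where c = C], unfold eventually_at_infinity, intro exI allI impI)
    fix x :: complex assume x: "2 * sqrt T + 1 \<le> cmod x"
    then have "Wcorr T hbar n g (replicate n x) = ev (Wcoeff T hbar g) (replicate n x)"
      by (intro Wcorr_eq assms) (auto simp: ext_disc_def)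
    then show "norm (Wcorr T hbar n g (replicate n x)) \<le> C * norm (1 / x ^ (3 * n + 2 * g - 2))"
      using C[OF x] by (simp add: norm_divide norm_power power_divide)
  qed
qed

end
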